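(* For $m\in(1,2]$ the quantity $\mathcal{L}(m)$ is given by \[ \mathcal{L}(m) = \begin{cases} g_{\sigma(1\overline{0})}(m) & \text{if } m \in [\mu_{\sigma(1\overline{0})}, \mu_{\sigma(01\overline{0})}] \text{ for some } \sigma \in \{L,M,R\}^* M, \\[.5ex] f_{\sigma(0\overline{1})}(m) & \text{if } m \in [\mu_{\sigma(10\overline{1})}, \mu_{\sigma(0\overline{1})}] \text{ for some } \sigma \in \{L,M,R\}^* M, \\[.5ex] g_{0\overline{1}}(m) & \text{if } m \in [\mu_{0\overline{1}},2], \\[.5ex] f_\mathbf{u}(m) & \text{if } m = \mu_\mathbf{u} \text{ for some } \mathbf{u} \in \mathcal{S}_{\{L,M,R\}}, \end{cases} \] and these cases cover all $m\in(1,2]$. Moreover, for every $m\in(1,2]$ and every $\beta > \mathcal{L}(m)$, the Hausdorff dimension of $\pi_\beta(U_\beta(m))\subset\mathbb{R}$ is positive.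
   Context: For $\beta>1$ and a sequence $\mathbf u=u_1u_2\cdots$ of real digits, $\pi_\beta(\mathbf u)=\sum_{k\ge1}u_k\beta^{-k}$. For $m\in(1,2]$, $U_\beta(m)$ is the set of $\mathbf u\in\{0,1,m\}^{\mathbb N}$ such that $\pi_\beta(\mathbf u)\ne\pi_\beta(\mathbf v)$ for all $\mathbf v\in\{0,1,m\}^{\mathbb N}\setminus\{\mathbf u\}$, and $\mathcal L(m)=\inf\{\beta>1:\ U_\beta(m)\cap\{0,1\}^{\mathbb N}\text{ is uncountable}\}$. $\overline{w}$ denotes the infinite repetition of a finite word $w$; infinite words over $\{0,1\}$ are ordered lexicographically. For $\mathbf u=u_1u_2\cdots\in\{0,1\}^{\mathbb N}$, $O(\mathbf u)=\{u_ku_{k+1}\cdots:k\ge1\}$, $\sup(\mathbf u)=\sup O(\mathbf u)$, $\inf(\mathbf u)=\inf O(\mathbf u)$ (lexicographic). For $m\in(1,2]$: $g_{\mathbf u}(m)$ is the unique positive real $\beta$ with $(\beta-1)(1+\pi_\beta(\inf(\mathbf u)))=m$; if $\mathbf u$ contains at least two ones, $f_{\mathbf u}(m)$ is the unique positive real $\beta$ with $\beta\,\pi_\beta(\sup(\mathbf u))=m$, and $\mu_{\mathbf u}$ is the unique $m\in(1,2]$ with $f_{\mathbf u}(m)=g_{\mathbf u}(m)$. The substitutions (monoid morphisms on words, extended letterwise to infinite words) are $L:0\mapsto0,1\mapsto01$; $M:0\mapsto01,1\mapsto10$; $R:0\mapsto01,1\mapsto1$. $\{L,M,R\}^*$ is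 the monoid they generate under composition (including the identity), and $\{L,M,R\}^*M=\{\tau M:\tau\in\{L,M,R\}^*\}$. A sequence $(\sigma_n)_{n\ge1}\in\{L,M,R\}^{\mathbb N}$ is primitive if it is not eventually constantly $L$ and not eventually constantly $R$. An infinite word $\mathbf u$ is a limit word of $(\sigma_n)$ if there are infinite words $\mathbf u^{(n)}$ with $\mathbf u^{(1)}=\mathbf u$ and $\mathbf u^{(n)}=\sigma_n(\mathbf u^{(n+1)})$ for all $n\ge1$. $\mathcal S_{\{L,M,R\}}$ is the set of limit words of primitive sequences in $\{L,M,R\}^{\mathbb N}$. *)

theory Defs
  imports "HOL-Analysis.Analysis"
begin

text \<open>Sequences u_1 u_2 ... are indexed from 0: u k is the digit u_(k+1).\<close>

definition pib :: "real \<Rightarrow> (nat \<Rightarrow> real) \<Rightarrow> real" where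
  "pib \<beta> u = (\<Sum>k. u k / \<beta> ^ (Suc k))"

definition digseq :: "real \<Rightarrow> (nat \<Rightarrow> real) set" where
  "digseq m = {u. \<forall>k. u k \<in> {0, 1, m}}"

definition Ub :: "real \<Rightarrow> real \<Rightarrow> (nat \<Rightarrow> real) set" where
  "Ub \<beta> m = {u \<in> digseq m. \<forall>v \<in> digseq m - {u}. pib \<beta> u \<noteq> pib \<beta> v}"

definition Lcrit :: "real \<Rightarrow> real" where
  "Lcrit m = Inf {\<beta>. \<beta> > 1 \<and> uncountable (Ub \<beta> m \<inter> {u. \<forall>k. u k \<in> {0, 1}})}"

definition binary :: "(nat \<Rightarrow> nat) \<Rightarrow> bool" where
  "binary u \<longleftrightarrow> (\<forall>k. u k \<in> {0, 1})"

definition rw :: "(nat \<Rightarrow> nat) \<Rightarrow> nat \<Rightarrow> real" where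
  "rw u = (\<lambda>k. real (u k))"

definition lex_less :: "(nat \<Rightarrow> nat) \<Rightarrow> (nat \<Rightarrow> nat) \<Rightarrow> bool" where
  "lex_less u v \<longleftrightarrow> (\<exists>n. (\<forall>i<n. u i = v i) \<and> u n < v n)"

definition lex_le :: "(nat \<Rightarrow> nat) \<Rightarrow> (nat \<Rightarrow> nat) \<Rightarrow> bool" where
  "lex_le u v \<longleftrightarrow> u = v \<or> lex_less u v"

definition orbit :: "(nat \<Rightarrow> nat) \<Rightarrow> (nat \<Rightarrow> nat) set" where
  "orbit u = {(\<lambda>i. u (k + i)) | k. True}"

definition lex_sup :: "(nat \<Rightarrow> nat) set \<Rightarrow> (nat \<Rightarrow> nat)" where
  "lex_sup S = (THE s. binary s \<and> (\<forall>x\<in>S. lex_le x s) \<and>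
      (\<forall>t. binary t \<and> (\<forall>x\<in>S. lex_le x t) \<longrightarrow> lex_le s t))"

definition lex_inf :: "(nat \<Rightarrow> nat) set \<Rightarrow> (nat \<Rightarrow> nat)" where
  "lex_inf S = (THE s. binary s \<and> (\<forall>x\<in>S. lex_le s x) \<and>
      (\<forall>t. binary t \<and> (\<forall>x\<in>S. lex_le t x) \<longrightarrow> lex_le t s))"

definition supw :: "(nat \<Rightarrow> nat) \<Rightarrow> (nat \<Rightarrow> nat)" where
  "supw u = lex_sup (orbit u)"

definition infw :: "(nat \<Rightarrow> nat) \<Rightarrow> (nat \<Rightarrow> nat)" where
  "infw u = lex_inf (orbit u)"

text \<open>pi_beta is only defined for beta > 1, so the unique solution is sought among beta > 1.\<close>
definition gfun :: "(nat \<Rightarrow> nat) \<Rightarrow> real \<Rightarrow> real" where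
  "gfun u m = (THE \<beta>. \<beta> > 1 \<and> (\<beta> - 1) * (1 + pib \<beta> (rw (infw u))) = m)"

definition ffun :: "(nat \<Rightarrow> nat) \<Rightarrow> real \<Rightarrow> real" where
  "ffun u m = (THE \<beta>. \<beta> > 1 \<and> \<beta> * pib \<beta> (rw (supw u)) = m)"

definition mu :: "(nat \<Rightarrow> nat) \<Rightarrow> real" where
  "mu u = (THE m. 1 < m \<and> m \<le> 2 \<and> ffun u m = gfun u m)"

datatype subst = L | M | R

fun img :: "subst \<Rightarrow> nat \<Rightarrow> nat list" where
  "img L a = (if a = 0 then [0] else [0, 1])"
| "img M a = (if a = 0 then [0, 1] else [1, 0])"
| "img R a = (if a = 0 then [0, 1] else [1])"

text \<open>Letterwise extension to infinite words (all images are nonempty, so the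
  first n+1 letters determine the first n+1 letters of the image).\<close>
definition subst_inf :: "subst \<Rightarrow> (nat \<Rightarrow> nat) \<Rightarrow> (nat \<Rightarrow> nat)" where
  "subst_inf s u = (\<lambda>n. concat (map (img s) (map u [0..<Suc n])) ! n)"

text \<open>An element of the monoid {L,M,R}^* is represented by a list [s1,...,sk],
  standing for the composition s1 o ... o sk (the empty list is the identity).\<close>
definition apply_inf :: "subst list \<Rightarrow> (nat \<Rightarrow> nat) \<Rightarrow> (nat \<Rightarrow> nat)" where
  "apply_inf ss u = foldr subst_inf ss u"

definition endsM :: "subst list set" where
  "endsM = {ss @ [M] | ss. True}"

definition primitive :: "(nat \<Rightarrow> subst) \<Rightarrow> bool" where
  "primitive s \<longleftrightarrow> \<not> (\<exists>N. \<forall>n\<ge>N. s n = L) \<and> \<not> (\<exists>N. \<forall>n\<ge>N. s n = R)"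

definition limit_word :: "(nat \<Rightarrow> subst) \<Rightarrow> (nat \<Rightarrow> nat) \<Rightarrow> bool" where
  "limit_word s u \<longleftrightarrow> (\<exists>U :: nat \<Rightarrow> nat \<Rightarrow> nat. U 0 = u \<and> (\<forall>n. binary (U n)) \<and>
      (\<forall>n. U n = subst_inf (s n) (U (Suc n))))"

definition S_LMR :: "(nat \<Rightarrow> nat) set" where
  "S_LMR = {u. \<exists>s. primitive s \<and> limit_word s u}"

definition w10 :: "nat \<Rightarrow> nat" where "w10 = (\<lambda>n. if n = 0 then 1 else 0)"
definition w010 :: "nat \<Rightarrow> nat" where "w010 = (\<lambda>n. if n = 1 then 1 else 0)"
definition w01 :: "nat \<Rightarrow> nat" where "w01 = (\<lambda>n. if n = 0 then 0 else 1)"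
definition w101 :: "nat \<Rightarrow> nat" where "w101 = (\<lambda>n. if n = 1 then 0 else 1)"

definition diam_pow :: "real \<Rightarrow> real set \<Rightarrow> real" where
  "diam_pow s X = (if X = {} then 0 else if s = 0 then 1 else diameter X powr s)"

definition hcontent :: "real \<Rightarrow> real \<Rightarrow> real set \<Rightarrow> ennreal" where
  "hcontent s \<delta> A = (INF C \<in> {C :: nat \<Rightarrow> real set. A \<subseteq> (\<Union>i. C i) \<and>
       (\<forall>i. bounded (C i) \<and> diameter (C i) \<le> \<delta>)}. (\<Sum>i. ennreal (diam_pow s (C i))))"

definition hausdorff_measure :: "real \<Rightarrow> real set \<Rightarrow> ennreal" where
  "hausdorff_measure s A = (SUP \<delta> \<in> {0<..}. hcontent s \<delta> A)"

definition hausdorff_dim :: "real set \<Rightarrow> ereal" where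
  "hausdorff_dim A = Inf (ereal ` {s. s \<ge> 0 \<and> hausdorff_measure s A = 0})"

end

theory Submission
  imports Defs
begin

text \<open>
  A non-zero binary word can only have a unique expansion if \<open>\<beta> > 2\<close>. Then \<open>pib \<beta>\<close> is increasing
  for the lexicographic order, and uniqueness says that the tails of the word lie strictly between
  two bounds, one belonging to \<open>g\<close> and one to \<open>f\<close>. Such sets of words are renormalised:
  unless there is room for the image of the full shift under some element of \<open>{L,M,R}\<^sup>*\<close>, all words in
  the set are, up to a finite prefix, images of words under one of \<open>L\<close>, \<open>M\<close>, \<open>R\<close>, and the
  preimages lie in a set of the same kind. If the full shift fits in, a Hoelder map onto \<open>[0,1]\<close>
  gives positive dimension; if the renormalisation reaches a set that contains only constant words,
  the original set is countable. Comparing \<open>f\<close> and \<open>g\<close> at each level for fixed \<open>m\<close> yields a path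
  in \<open>{L,M,R}\<close> that either stops in one of the intervals of the theorem or is primitive, and in
  the latter case \<open>m = \<mu>\<^sub>u\<close> for the limit word \<open>u\<close> of the path.
\<close>


text \<open>Each node \<open>\<tau>\<close> compares two pairs of words: f at \<open>w10\<close>
  with g at \<open>z0\<close>, and f at \<open>z1\<close> with g at \<open>w01\<close>. As f
  decreases and g increases in m, the first pair bounds m from below and the second from above. The
  coincidences in \<open>lo_hi_const\<close> glue the three children together: inside the window of
  \<open>\<tau>\<close>, the \<open>L\<close>-window ends at the mu of \<open>\<tau> M w10\<close>,
  the \<open>M\<close>-window runs between those of \<open>\<tau> M w010\<close> and
  \<open>\<tau> M w101\<close>, and the \<open>R\<close>-window starts at that of
  \<open>\<tau> M w01\<close>. The intervals of the theorem are the two gaps between the children.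
  In the left gap both words share their infimum, which fixes g; in the right gap they share their
  supremum, which fixes f. An obstacle is that order arguments need a base of at least 2, while f
  and g may lie below 2. Comparisons in m are therefore made over all bases above 1, and room for
  the full shift is shown to force a base above 2. Limits are handled by contraction: each
  application of \<open>lo\<close> or \<open>hi\<close> fixes one more letter, so strict
  inequalities pass between limit words and finite levels.\<close>

section \<open>Infinite words: prepending, tails and common prefixes\<close>

definition scons :: "nat \<Rightarrow> (nat \<Rightarrow> nat) \<Rightarrow> nat \<Rightarrow> nat" (infixr \<open>##\<close> 65) where
  "c ## u = case_nat c u"

definition shift :: "nat \<Rightarrow> (nat \<Rightarrow> nat) \<Rightarrow> nat \<Rightarrow> nat" where
  "shift k u = (\<lambda>i. u (k + i))"

text \<open>Common prefixes play the role of the product topology; all limits and open conditions on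
  words are expressed through them.\<close>

definition agree :: "nat \<Rightarrow> (nat \<Rightarrow> nat) \<Rightarrow> (nat \<Rightarrow> nat) \<Rightarrow> bool" where
  "agree n u v \<longleftrightarrow> (\<forall>i<n. u i = v i)"

definition tail :: "(nat \<Rightarrow> nat) \<Rightarrow> (nat \<Rightarrow> nat) \<Rightarrow> bool" where
  "tail u v \<longleftrightarrow> (\<exists>k. shift k u = v)"

definition z0 :: "nat \<Rightarrow> nat" where "z0 = (\<lambda>_. 0)"
definition z1 :: "nat \<Rightarrow> nat" where "z1 = (\<lambda>_. 1)"
definition a01 :: "nat \<Rightarrow> nat" where "a01 = (\<lambda>n. n mod 2)"
definition a10 :: "nat \<Rightarrow> nat" where "a10 = (\<lambda>n. Suc n mod 2)"

lemma scons_0 [simp]: "(c ## u) 0 = c"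
  and scons_Suc [simp]: "(c ## u) (Suc n) = u n"
  by (simp_all add: scons_def)

lemma scons_inject [simp]: "c ## u = d ## v \<longleftrightarrow> c = d \<and> u = v"
proof
  assume h: "c ## u = d ## v"
  have "u n = v n" for n using fun_cong[OF h, of "Suc n"] by simp
  then show "c = d \<and> u = v" using fun_cong[OF h, of 0] by auto
qed simp

lemma scons_shift: "u 0 ## shift 1 u = u"
  by (rule ext, rename_tac n, case_tac n) (auto simp: shift_def)

lemma scons_cases: obtains c v where "u = c ## v" "c = u 0"
  by (metis scons_shift)

lemma shift_0 [simp]: "shift 0 u = u"
  by (simp add: shift_def)

lemma shift_Suc_scons [simp]: "shift (Suc k) (c ## u) = shift k u"
  by (auto simp: shift_def)

lemma shift_shift [simp]: "shift j (shift k u) = shift (k + j) u"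
  by (auto simp: shift_def add.assoc)

lemma shift_apply: "shift k u i = u (k + i)"
  by (simp add: shift_def)

lemma shift_unfold: "shift k u = u k ## shift (Suc k) u"
  using scons_shift[of "shift k u"] by (simp add: shift_apply)

lemma shift_1_scons [simp]: "shift 1 (c ## u) = u"
  by (auto simp: shift_def)

lemma orbit_tail: "orbit u = {v. tail u v}"
  by (auto simp: orbit_def tail_def shift_def)

lemma binaryD: "binary u \<Longrightarrow> u k = 0 \<or> u k = 1"
  by (auto simp: binary_def)

lemma binary_scons [simp]: "binary (c ## u) \<longleftrightarrow> c \<in> {0,1} \<and> binary u"
proof -
  have "(\<forall>k. P k) \<longleftrightarrow> P 0 \<and> (\<forall>k. P (Suc k))" for P :: "nat \<Rightarrow> bool"
    by (metis not0_implies_Suc)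
  from this[of "\<lambda>k. (c ## u) k \<in> {0,1}"] show ?thesis by (simp add: binary_def)
qed

lemma binary_shift [simp]: "binary u \<Longrightarrow> binary (shift k u)"
  by (auto simp: binary_def shift_def)

lemma binary_cases: assumes "binary u" obtains v where "u = 0 ## v" "binary v" | v where "u = 1 ## v" "binary v"
proof -
  obtain c v where "u = c ## v" by (rule scons_cases)
  then show ?thesis using assms that by auto
qed

lemma scons_hd: "u 0 = c \<Longrightarrow> binary u \<Longrightarrow> \<exists>v. u = c ## v \<and> binary v"
  by (rule exI[of _ "shift 1 u"]) (use scons_shift[of u] in auto)

lemma binary_zs [simp]: "binary z0" "binary z1" "binary a01" "binary a10" "binary w10" "binary w010"
  "binary w01" "binary w101"
  by (auto simp: binary_def z0_def z1_def a01_def a10_def w10_def w010_def w01_def w101_def)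

lemma z0_unfold: "z0 = 0 ## z0" and z1_unfold: "z1 = 1 ## z1"
  and a01_unfold: "a01 = 0 ## a10" and a10_unfold: "a10 = 1 ## a01"
  and w10_eq: "w10 = 1 ## z0" and w010_eq: "w010 = 0 ## 1 ## z0"
  and w01_eq: "w01 = 0 ## z1" and w101_eq: "w101 = 1 ## 0 ## z1"
  by (auto simp: z0_def z1_def a01_def a10_def w10_def w010_def w01_def w101_def scons_def fun_eq_iff
      mod_Suc split: nat.splits)

lemma tail_refl [simp]: "tail u u"
  unfolding tail_def by (rule exI[of _ 0]) simp

lemma tail_trans: "tail u v \<Longrightarrow> tail v w \<Longrightarrow> tail u w"
  unfolding tail_def by (metis shift_shift)

lemma tail_scons: "tail (c ## u) v \<longleftrightarrow> v = c ## u \<or> tail u v"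
proof
  assume "tail (c ## u) v"
  then obtain k where "shift k (c ## u) = v" by (auto simp: tail_def)
  then show "v = c ## u \<or> tail u v" by (cases k) (auto simp: tail_def)
next
  assume "v = c ## u \<or> tail u v"
  then show "tail (c ## u) v"
    by (metis shift_Suc_scons tail_def tail_refl)
qed

lemma tail_sconsI: "tail u (c ## v) \<Longrightarrow> tail u v"
  by (meson tail_refl tail_scons tail_trans)

lemma tail_shift: "tail u (shift k u)"
  by (auto simp: tail_def)

lemma tail_binary: "tail u v \<Longrightarrow> binary u \<Longrightarrow> binary v"
  by (auto simp: tail_def)

lemma tail_z1: "tail z1 v \<longleftrightarrow> v = z1"
  by (auto simp: tail_def shift_def z1_def)

lemma tail_a01: "tail a01 v \<Longrightarrow> v = a01 \<or> v = a10"
  and tail_a10: "tail a10 v \<Longrightarrow> v = a01 \<or> v = a10"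
proof -
  have *: "shift k a01 \<in> {a01, a10}" for k
  proof (induction k)
    case (Suc k)
    have "shift (Suc k) a01 = shift 1 (shift k a01)" by simp
    also have "\<dots> \<in> {a10, a01}" using Suc a01_unfold a10_unfold shift_1_scons
      by (metis insert_iff singletonD)
    finally show ?case by auto
  qed simp
  then show **: "tail a01 v \<Longrightarrow> v = a01 \<or> v = a10" for v by (auto simp: tail_def)
  assume "tail a10 v"
  then have "tail a01 v" by (subst a01_unfold) (simp add: tail_scons)
  then show "v = a01 \<or> v = a10" by (rule **)
qed

lemma agree_refl [simp]: "agree n u u" by (simp add: agree_def)
lemma agree_0 [simp]: "agree 0 u v" by (simp add: agree_def)
lemma agree_sym: "agree n u v \<Longrightarrow> agree n v u" by (simp add: agree_def)
lemma agree_trans: "agree n u v \<Longrightarrow> agree n v w \<Longrightarrow> agree n u w" by (simp add: agree_def)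
lemma agree_mono: "agree n u v \<Longrightarrow> k \<le> n \<Longrightarrow> agree k u v" by (simp add: agree_def)
lemma agree_Suc [simp]: "agree (Suc n) (c ## u) (d ## v) \<longleftrightarrow> c = d \<and> agree n u v"
  by (auto simp: agree_def All_less_Suc2)
lemma agree_sconsI: "agree n u v \<Longrightarrow> agree n (c ## u) (c ## v)"
  by (metis agree_Suc agree_mono le_SucI order_refl)

lemma agree_eqI: "(\<And>n. agree n u v) \<Longrightarrow> u = v"
  by (rule ext) (metis agree_def lessI)


subsection \<open>Lexicographic order\<close>

lemma lex_less_scons [simp]: "lex_less (c ## u) (d ## v) \<longleftrightarrow> c < d \<or> c = d \<and> lex_less u v"
proof
  assume "lex_less (c ## u) (d ## v)"
  then obtain n where n: "\<forall>i<n. (c ## u) i = (d ## v) i" "(c ## u) n < (d ## v) n"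
    by (auto simp: lex_less_def)
  show "c < d \<or> c = d \<and> lex_less u v"
  proof (cases n)
    case (Suc k)
    then have "c = d" using n by (metis scons_0 zero_less_Suc)
    moreover have "\<forall>i<k. u i = v i" using n Suc by (metis Suc_mono scons_Suc)
    ultimately show ?thesis using n Suc by (auto simp: lex_less_def)
  qed (use n in auto)
next
  assume "c < d \<or> c = d \<and> lex_less u v"
  then show "lex_less (c ## u) (d ## v)"
  proof
    assume "c < d" then show ?thesis unfolding lex_less_def by (intro exI[of _ 0]) simp
  next
    assume "c = d \<and> lex_less u v"
    then obtain n where "c = d" "\<forall>i<n. u i = v i" "u n < v n" by (auto simp: lex_less_def)
    then show ?thesis unfolding lex_less_def
      by (intro exI[of _ "Suc n"]) (auto simp: All_less_Suc2)
  qed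
qed

lemma lex_le_scons [simp]: "lex_le (c ## u) (d ## v) \<longleftrightarrow> c < d \<or> c = d \<and> lex_le u v"
  by (auto simp: lex_le_def)

lemma lex_le_refl [simp]: "lex_le u u" by (simp add: lex_le_def)

lemma lex_less_trans: "lex_less u v \<Longrightarrow> lex_less v w \<Longrightarrow> lex_less u w"
proof -
  assume "lex_less u v" "lex_less v w"
  then obtain a b where a: "\<forall>i<a. u i = v i" "u a < v a" and b: "\<forall>i<b. v i = w i" "v b < w b"
    by (auto simp: lex_less_def)
  show "lex_less u w" unfolding lex_less_def
  proof (intro exI[of _ "min a b"] conjI allI impI)
    show "u (min a b) < w (min a b)"
      using a b by (cases a b rule: linorder_cases) (auto simp: min_def)
  qed (use a b in auto)
qed

lemma lex_less_irrefl [simp]: "\<not> lex_less u u" by (simp add: lex_less_def)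

lemma lex_le_trans: "lex_le u v \<Longrightarrow> lex_le v w \<Longrightarrow> lex_le u w"
  unfolding lex_le_def using lex_less_trans by blast

lemma lex_le_antisym: "lex_le u v \<Longrightarrow> lex_le v u \<Longrightarrow> u = v"
  unfolding lex_le_def using lex_less_trans lex_less_irrefl by blast

lemma lex_linear: "lex_le u v \<or> lex_less v u"
proof (cases "u = v")
  case False
  define n where "n = (LEAST n. u n \<noteq> v n)"
  have "u n \<noteq> v n" unfolding n_def by (rule LeastI_ex) (use False in \<open>auto simp: fun_eq_iff\<close>)
  moreover have "\<forall>i<n. u i = v i" unfolding n_def using not_less_Least by blast
  ultimately show ?thesis unfolding lex_le_def lex_less_def
    by (cases "u n < v n") (auto intro!: exI[of _ n])
qed simp

lemma lex_not_le: "\<not> lex_le u v \<longleftrightarrow> lex_less v u"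
  by (metis lex_le_antisym lex_le_def lex_less_irrefl lex_linear)

lemma z0_lex_le [simp]: "lex_le z0 u"
  using lex_linear[of z0 u] by (auto simp: lex_less_def z0_def)

lemma lex_le_z1 [simp]: assumes "binary u" shows "lex_le u z1"
proof -
  have "\<not> 1 < u n" for n using assms by (auto simp: binary_def dest: spec[of _ n])
  then have "\<not> lex_less z1 u" by (auto simp: lex_less_def z1_def)
  then show ?thesis using lex_linear by blast
qed

text \<open>Agreement with the word delayed by one letter propagates the leading 0, so up to a first
  disagreement \<open>0 ## u\<close> consists of zeros and cannot be the larger one there.\<close>

lemma zero_scons_le: assumes "binary u" shows "lex_le (0 ## u) u"
proof (rule ccontr)
  assume "\<not> lex_le (0 ## u) u"
  then obtain n where n: "\<forall>i<n. u i = (0 ## u) i" "u n < (0 ## u) n"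
    by (auto simp: lex_not_le lex_less_def)
  have "i \<le> n \<Longrightarrow> (0 ## u) i = 0" for i
    by (induction i) (use n in auto)
  then show False using n by auto
qed

lemma one_scons_ge: assumes "binary u" shows "lex_le u (1 ## u)"
proof (rule ccontr)
  assume "\<not> lex_le u (1 ## u)"
  then obtain n where n: "\<forall>i<n. (1 ## u) i = u i" "(1 ## u) n < u n"
    unfolding lex_not_le lex_less_def by blast
  have "i \<le> n \<Longrightarrow> (1 ## u) i = 1" for i
    by (induction i) (use n(1) in \<open>auto dest: spec\<close>)
  moreover have "u n \<le> 1" using assms by (auto simp: binary_def dest: spec[of _ n])
  ultimately show False using n by auto
qed

text \<open>Lexicographic half-lines are closed: a strict violation is visible in a finite prefix,
  which some v shares with w.\<close>

lemma lex_le_limit: assumes "\<And>n. \<exists>v. agree n v w \<and> lex_le u v" shows "lex_le u w"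
proof (rule ccontr)
  assume "\<not> lex_le u w"
  then obtain n where n: "\<forall>i<n. w i = u i" "w n < u n" by (auto simp: lex_not_le lex_less_def)
  obtain v where v: "agree (Suc n) v w" "lex_le u v" using assms by blast
  then have "lex_less v u" unfolding lex_less_def using n
    by (intro exI[of _ n]) (auto simp: agree_def)
  then show False using v lex_not_le by blast
qed

lemma lex_ge_limit: assumes "\<And>n. \<exists>v. agree n v w \<and> lex_le v u" shows "lex_le w u"
proof (rule ccontr)
  assume "\<not> lex_le w u"
  then obtain n where n: "\<forall>i<n. u i = w i" "u n < w n" by (auto simp: lex_not_le lex_less_def)
  obtain v where v: "agree (Suc n) v w" "lex_le v u" using assms by blast
  then have "lex_less u v" unfolding lex_less_def using n
    by (intro exI[of _ n]) (auto simp: agree_def)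
  then show False using v lex_not_le by blast
qed


subsection \<open>Substitutions\<close>

definition conc :: "nat list \<Rightarrow> (nat \<Rightarrow> nat) \<Rightarrow> nat \<Rightarrow> nat" where
  "conc xs u = foldr (##) xs u"

lemma conc_simps [simp]: "conc [] u = u" "conc (x # xs) u = x ## conc xs u"
  by (simp_all add: conc_def)

lemma conc_nth: "conc xs u n = (if n < length xs then xs ! n else u (n - length xs))"
proof (induction xs arbitrary: n)
  case (Cons x xs) then show ?case by (cases n) auto
qed simp

lemma img_length: "length (img s a) \<in> {1, 2}"
  by (cases s) auto

lemma subst_inf_scons: "subst_inf s (a ## u) = conc (img s a) (subst_inf s u)"
proof
  fix n
  let ?l = "length (img s a)"
  let ?c = "\<lambda>k. concat (map (img s) (map u [0..<k]))"
  have len: "k \<le> length (?c k)" for k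
  proof (induction k)
    case (Suc k)
    have "1 \<le> length (img s (u k))" using img_length[of s "u k"] by auto
    then show ?case using Suc by simp
  qed simp
  have e: "map (a ## u) [0..<Suc n] = a # map u [0..<n]"
    by (subst upt_conv_Cons) (auto simp: map_Suc_upt[symmetric] simp del: upt_Suc)
  have "subst_inf s (a ## u) n = (img s a @ ?c n) ! n"
    unfolding subst_inf_def e by simp
  also have "\<dots> = conc (img s a) (subst_inf s u) n"
  proof (cases "n < ?l")
    case False
    let ?k = "n - ?l"
    have "Suc ?k \<le> n" using False img_length[of s a] by auto
    then have "[0..<n] = [0..<Suc ?k] @ [Suc ?k..<n]"
      by (metis le0 le_add_diff_inverse upt_add_eq_append)
    then have "?c n = ?c (Suc ?k) @ concat (map (img s) (map u [Suc ?k..<n]))"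
      by (simp del: upt_Suc)
    moreover have "?k < length (?c (Suc ?k))" using len[of "Suc ?k"] by linarith
    ultimately have "?c n ! ?k = ?c (Suc ?k) ! ?k" by (metis nth_append)
    then show ?thesis using False by (simp add: nth_append conc_nth subst_inf_def)
  qed (simp add: nth_append conc_nth)
  finally show "subst_inf s (a ## u) n = conc (img s a) (subst_inf s u) n" .
qed

lemma subst_scons [simp]:
  "subst_inf L (0 ## u) = 0 ## subst_inf L u"
  "subst_inf L (1 ## u) = 0 ## 1 ## subst_inf L u"
  "subst_inf L (Suc 0 ## u) = 0 ## 1 ## subst_inf L u"
  "subst_inf M (0 ## u) = 0 ## 1 ## subst_inf M u"
  "subst_inf M (1 ## u) = 1 ## 0 ## subst_inf M u"
  "subst_inf M (Suc 0 ## u) = 1 ## 0 ## subst_inf M u"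
  "subst_inf R (0 ## u) = 0 ## 1 ## subst_inf R u"
  "subst_inf R (1 ## u) = 1 ## subst_inf R u"
  "subst_inf R (Suc 0 ## u) = 1 ## subst_inf R u"
  by (simp_all add: subst_inf_scons)

lemma subst_agree:
  assumes "agree n u v" shows "agree n (subst_inf s u) (subst_inf s v)"
  using assms
proof (induction n arbitrary: u v)
  case (Suc n)
  obtain c u' d v' where e: "u = c ## u'" "v = d ## v'" by (metis scons_cases)
  then have "c = d" "agree n (subst_inf s u') (subst_inf s v')" using Suc by auto
  moreover have "\<exists>x xs. img s c = x # xs" using img_length[of s c] by (cases "img s c") auto
  moreover have "agree k a b \<Longrightarrow> agree k (conc xs a) (conc xs b)" for k xs a b
    by (induction xs) (auto intro: agree_sconsI)
  ultimately show ?case using e by (auto simp: subst_inf_scons)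
qed simp

lemma binary_subst [simp]: "binary (subst_inf s u)"
proof -
  have *: "subst_inf s u n \<in> {0,1}" for n u
  proof (induction n arbitrary: u rule: less_induct)
    case (less n)
    obtain c u' where u: "u = c ## u'" by (rule scons_cases)
    have "set (img s c) \<subseteq> {0,1}" by (cases s) auto
    then have "n < length (img s c) \<Longrightarrow> img s c ! n \<in> {0,1}" using nth_mem by blast
    moreover have "subst_inf s u' (n - length (img s c)) \<in> {0,1}" if "\<not> n < length (img s c)"
      by (rule less.IH) (use that img_length[of s c] in auto)
    ultimately show ?case unfolding u subst_inf_scons conc_nth by auto
  qed
  then show ?thesis unfolding binary_def by blast
qed

lemma subst_L_0: "binary u \<Longrightarrow> \<exists>v. subst_inf L u = 0 ## v \<and> binary v"
  by (erule binary_cases) auto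

text \<open>At the first difference 0 < 1 the images under \<open>M\<close> and \<open>R\<close>
  already differ in their first letter. Under \<open>L\<close> both begin with 0 and the second
  letter decides, because the image of whatever follows the 0 begins with 0 again.\<close>

lemma subst_lex_less:
  assumes "lex_less u v" "binary u" "binary v"
  shows "lex_less (subst_inf s u) (subst_inf s v)"
proof -
  obtain n where n: "\<forall>i<n. u i = v i" "u n < v n" using assms(1) by (auto simp: lex_less_def)
  then show ?thesis using assms(2,3)
  proof (induction n arbitrary: u v)
    case 0
    then have "u 0 = 0" "v 0 = 1" using binaryD[of u 0] binaryD[of v 0] by auto
    then obtain u' v' where e: "u = 0 ## u'" "v = 1 ## v'" "binary u'" "binary v'"
      using scons_hd[OF _ 0(3)] scons_hd[OF _ 0(4)] by blast
    then obtain w where "subst_inf L u' = 0 ## w" using subst_L_0 by blast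
    then show ?case using e by (cases s) auto
  next
    case (Suc n)
    obtain c u' d v' where e: "u = c ## u'" "v = d ## v'" by (metis scons_cases)
    have "c = d" using Suc(2) e by force
    moreover have "lex_less (subst_inf s u') (subst_inf s v')"
    proof (rule Suc.IH)
      show "\<forall>i<n. u' i = v' i" using Suc.prems(1) e by (metis Suc_mono scons_Suc)
      show "u' n < v' n" using Suc.prems e by simp
    qed (use Suc.prems e in auto)
    moreover have "lex_less (conc xs a) (conc xs b)" if "lex_less a b" for xs a b
      using that by (induction xs) auto
    ultimately show ?case using e by (auto simp: subst_inf_scons)
  qed
qed

text \<open>Images have at most two letters, so the image of letter n begins at position 2n or
  earlier; under \<open>L\<close> the difference shows one position after that.\<close>

lemma subst_sep:
  assumes "\<exists>i\<le>n. u i \<noteq> v i" "binary u" "binary v"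
  shows "\<exists>j\<le>2 * n + 1. subst_inf s u j \<noteq> subst_inf s v j"
  using assms
proof (induction n arbitrary: u v)
  case 0
  have *: "\<exists>j\<le>Suc 0. subst_inf s x j \<noteq> subst_inf s y j"
    if h: "x 0 = 0" "y 0 = 1" "binary x" "binary y" for x y
  proof -
    obtain x' y' where e: "x = 0 ## x'" "y = 1 ## y'" "binary x'" "binary y'"
      using scons_hd[OF h(1,3)] scons_hd[OF h(2,4)] by blast
    then obtain w where w: "subst_inf L x' = 0 ## w" using subst_L_0 by blast
    show ?thesis
    proof (cases "s = L")
      case True then show ?thesis using e w by (intro exI[of _ 1]) simp
    next
      case False then show ?thesis using e by (intro exI[of _ 0]) (cases s, simp_all)
    qed
  qed
  have "u 0 \<noteq> v 0" using 0 by auto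
  then consider "u 0 = 0" "v 0 = 1" | "u 0 = 1" "v 0 = 0"
    using binaryD[OF 0(2), of 0] binaryD[OF 0(3), of 0] by auto
  then show ?case
  proof cases
    case 1 then show ?thesis using *[of u v] 0 by simp
  next
    case 2
    then obtain j where "j \<le> Suc 0" "subst_inf s v j \<noteq> subst_inf s u j"
      using *[of v u] 0 by blast
    then show ?thesis by (intro exI[of _ j]) auto
  qed
next
  case (Suc n)
  obtain c u' d v' where e: "u = c ## u'" "v = d ## v'" by (metis scons_cases)
  show ?case
  proof (cases "c = d")
    case True
    obtain i where i: "i \<le> Suc n" "u i \<noteq> v i" using Suc.prems(1) by blast
    have "\<exists>i\<le>n. u' i \<noteq> v' i"
      by (cases i) (use i e True in auto)
    then obtain j where "j \<le> 2 * n + 1" "subst_inf s u' j \<noteq> subst_inf s v' j"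
      using Suc e by auto
    then show ?thesis using e True img_length[of s c]
      by (intro exI[of _ "length (img s c) + j"]) (auto simp: subst_inf_scons conc_nth)
  next
    case False
    then have "\<exists>i\<le>n. u i \<noteq> v i" using e by (intro exI[of _ 0]) auto
    then obtain j where "j \<le> 2 * n + 1" "subst_inf s u j \<noteq> subst_inf s v j"
      using Suc by blast
    then show ?thesis by (intro exI[of _ j]) auto
  qed
qed

text \<open>A tail of an image starts either at a block boundary or in the middle of a two-letter
  block.\<close>

lemma subst_tail_cases:
  assumes "tail (subst_inf s u) v"
  obtains w where "tail u w" "v = subst_inf s w"
    | a b c w where "tail u (a ## w)" "img s a = [b, c]" "v = c ## subst_inf s w"
proof -
  have "(\<exists>w. tail u w \<and> shift k (subst_inf s u) = subst_inf s w) \<or>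
     (\<exists>a b c w. tail u (a ## w) \<and> img s a = [b, c] \<and> shift k (subst_inf s u) = c ## subst_inf s w)" for k
  proof (induction k)
    case 0 then show ?case by (metis shift_0 tail_refl)
  next
    case (Suc k)
    have sh: "shift (Suc k) (subst_inf s u) = shift 1 (shift k (subst_inf s u))" by simp
    from Suc show ?case
    proof (elim disjE exE conjE)
      fix w assume w: "tail u w" "shift k (subst_inf s u) = subst_inf s w"
      obtain a w' where e: "w = a ## w'" by (rule scons_cases)
      have "tail u w'" using w e tail_sconsI by blast
      consider b where "img s a = [b]" | b c where "img s a = [b, c]"
        using img_length[of s a] by (auto simp: length_Suc_conv numeral_2_eq_2)
      then show ?case
      proof cases
        case 1
        then have "shift (Suc k) (subst_inf s u) = subst_inf s w'"
          unfolding sh w(2) e subst_inf_scons by simp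
        then show ?thesis using \<open>tail u w'\<close> by blast
      next
        case 2
        then have "shift (Suc k) (subst_inf s u) = c ## subst_inf s w'"
          unfolding sh w(2) e subst_inf_scons by simp
        then show ?thesis using w e 2 by blast
      qed
    next
      fix a b c w assume w: "tail u (a ## w)" "shift k (subst_inf s u) = c ## subst_inf s w"
      then have "shift (Suc k) (subst_inf s u) = subst_inf s w" unfolding sh by simp
      then show ?case using w(1) tail_sconsI by blast
    qed
  qed
  then show ?thesis using assms that by (metis tail_def)
qed

lemma tail_conc: "tail (conc xs u) u"
  by (induction xs) (auto simp: tail_scons)

lemma subst_tail: "tail u v \<Longrightarrow> tail (subst_inf s u) (subst_inf s v)"
proof -
  have "tail (subst_inf s u) (subst_inf s (shift k u))" for k
  proof (induction k)
    case (Suc k)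
    have "subst_inf s (shift k u) = conc (img s (u k)) (subst_inf s (shift (Suc k) u))"
      by (subst shift_unfold) (simp add: subst_inf_scons)
    then show ?case using Suc tail_conc tail_trans by metis
  qed simp
  then show "tail u v \<Longrightarrow> ?thesis" by (auto simp: tail_def)
qed


subsection \<open>The action on infima and suprema\<close>

text \<open>If \<open>u\<close> has infimum \<open>i\<close> and supremum \<open>s\<close>, then the image of \<open>u\<close> under a substitution has
  infimum \<open>lo i\<close> and supremum \<open>hi s\<close>, provided that \<open>i\<close> is approached after ones and
  \<open>s\<close> after zeros.\<close>

fun lo :: "subst \<Rightarrow> (nat \<Rightarrow> nat) \<Rightarrow> nat \<Rightarrow> nat" where
  "lo L u = subst_inf L u"
| "lo M u = 0 ## subst_inf M u"
| "lo R u = subst_inf R u"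

fun hi :: "subst \<Rightarrow> (nat \<Rightarrow> nat) \<Rightarrow> nat \<Rightarrow> nat" where
  "hi L u = shift 1 (subst_inf L u)"
| "hi M u = 1 ## subst_inf M u"
| "hi R u = 1 ## subst_inf R u"

definition los :: "subst list \<Rightarrow> (nat \<Rightarrow> nat) \<Rightarrow> nat \<Rightarrow> nat" where
  "los \<tau> u = foldr lo \<tau> u"

definition his :: "subst list \<Rightarrow> (nat \<Rightarrow> nat) \<Rightarrow> nat \<Rightarrow> nat" where
  "his \<tau> u = foldr hi \<tau> u"

lemma los_simps [simp]: "los [] u = u" "los (s # \<tau>) u = lo s (los \<tau> u)" "los (\<tau> @ \<tau>') u = los \<tau> (los \<tau>' u)"
  by (simp_all add: los_def)

lemma his_simps [simp]: "his [] u = u" "his (s # \<tau>) u = hi s (his \<tau> u)" "his (\<tau> @ \<tau>') u = his \<tau> (his \<tau>' u)"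
  by (simp_all add: his_def)

lemma apply_inf_simps [simp]: "apply_inf [] u = u" "apply_inf (s # \<tau>) u = subst_inf s (apply_inf \<tau> u)"
  "apply_inf (\<tau> @ \<tau>') u = apply_inf \<tau> (apply_inf \<tau>' u)"
  by (simp_all add: apply_inf_def)

lemma binary_lo [simp]: "binary u \<Longrightarrow> binary (lo s u)" and binary_hi [simp]: "binary u \<Longrightarrow> binary (hi s u)"
  by (cases s; simp)+

lemma binary_los [simp]: "binary u \<Longrightarrow> binary (los \<tau> u)" and binary_his [simp]: "binary u \<Longrightarrow> binary (his \<tau> u)"
  and binary_apply [simp]: "binary u \<Longrightarrow> binary (apply_inf \<tau> u)"
  by (induction \<tau>) auto

text \<open>Every \<open>L\<close>-image begins with 0, and \<open>hi L\<close> removes exactly this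
  letter; properties of \<open>hi L\<close> are thus inherited from \<open>L\<close>.\<close>

lemma subst_L_scons: "binary u \<Longrightarrow> subst_inf L u = 0 ## hi L u"
  by (metis scons_shift hi.simps(1) subst_L_0 scons_0)

lemma subst_lex_le: "lex_le u v \<Longrightarrow> binary u \<Longrightarrow> binary v \<Longrightarrow> lex_le (subst_inf s u) (subst_inf s v)"
  using subst_lex_less unfolding lex_le_def by blast

lemma lo_lex_le: "lex_le u v \<Longrightarrow> binary u \<Longrightarrow> binary v \<Longrightarrow> lex_le (lo s u) (lo s v)"
  by (cases s) (simp_all add: subst_lex_le)

lemma hi_lex_le: assumes "lex_le u v" "binary u" "binary v" shows "lex_le (hi s u) (hi s v)"
proof (cases s)
  case L
  then show ?thesis using subst_lex_le[OF assms, of L] assms by (simp add: subst_L_scons del: hi.simps)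
qed (simp_all add: subst_lex_le assms)

lemma los_lex_le: "lex_le u v \<Longrightarrow> binary u \<Longrightarrow> binary v \<Longrightarrow> lex_le (los \<tau> u) (los \<tau> v)"
  by (induction \<tau>) (auto intro: lo_lex_le)

lemma his_lex_le: "lex_le u v \<Longrightarrow> binary u \<Longrightarrow> binary v \<Longrightarrow> lex_le (his \<tau> u) (his \<tau> v)"
  by (induction \<tau>) (auto intro: hi_lex_le)

text \<open>The extra letter has a different source each time: under \<open>L\<close> it is the 0
  that begins the image of the remainder, under \<open>M\<close> the 0 put in front, and under
  \<open>R\<close> the leading 0 becomes two letters.\<close>

lemma lo_grow:
  assumes "agree (Suc n) u v" "u 0 = 0" "binary u" "binary v"
  shows "agree (Suc (Suc n)) (lo s u) (lo s v)"
proof (cases s)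
  case L
  have *: "agree (Suc n) (subst_inf L x) (subst_inf L y)" if "agree n x y" "binary x" "binary y" for n x y
    using that
  proof (induction n arbitrary: x y)
    case 0 then show ?case by (metis agree_Suc agree_0 subst_L_0)
  next
    case (Suc n)
    obtain c x' d y' where e: "x = c ## x'" "y = d ## y'" by (metis scons_cases)
    then have "c = d" "agree (Suc n) (subst_inf L x') (subst_inf L y')" using Suc by auto
    then show ?case using e Suc.prems agree_sconsI[of "Suc n" _ _ 1] by auto
  qed
  show ?thesis using *[OF assms(1,3,4)] L by simp
next
  case M
  then show ?thesis using subst_agree[OF assms(1), of M] by simp
next
  case R
  obtain u' v' where "u = 0 ## u'" "v = 0 ## v'" "agree n u' v'"
    using assms by (metis scons_cases agree_Suc scons_0)
  then show ?thesis using R by (simp add: subst_agree)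
qed

lemma lo_0: "u 0 = 0 \<Longrightarrow> binary u \<Longrightarrow> lo s u 0 = 0"
  using scons_hd[of u 0] by (cases s) auto

lemma hi_1: "u 0 = 1 \<Longrightarrow> binary u \<Longrightarrow> hi s u 0 = 1"
  using scons_hd[of u 1] by (cases s) auto

lemma hi_grow:
  assumes "agree (Suc n) u v" "u 0 = 1" "binary u" "binary v"
  shows "agree (Suc (Suc n)) (hi s u) (hi s v)"
proof (cases s)
  case L
  obtain u' v' where e: "u = 1 ## u'" "v = 1 ## v'" "agree n u' v'" "binary u'" "binary v'"
    using assms by (metis scons_cases agree_Suc scons_0 binary_scons)
  have "agree (Suc (Suc n)) (subst_inf L (0 ## u')) (subst_inf L (0 ## v'))"
    using lo_grow[of n "0 ## u'" "0 ## v'" L] e by simp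
  then show ?thesis using L e by simp
qed (use subst_agree[OF assms(1)] in auto)

lemma los_0: "u 0 = 0 \<Longrightarrow> binary u \<Longrightarrow> los \<tau> u 0 = 0"
  by (induction \<tau>) (auto intro: lo_0)

lemma his_1: "u 0 = 1 \<Longrightarrow> binary u \<Longrightarrow> his \<tau> u 0 = 1"
  by (induction \<tau>) (auto simp: hi_1[simplified])

lemma los_grow:
  assumes "agree (Suc n) u v" "u 0 = 0" "binary u" "binary v"
  shows "agree (Suc (n + length \<tau>)) (los \<tau> u) (los \<tau> v)"
  using assms by (induction \<tau>) (auto intro: lo_grow los_0)

lemma his_grow:
  assumes "agree (Suc n) u v" "u 0 = 1" "binary u" "binary v"
  shows "agree (Suc (n + length \<tau>)) (his \<tau> u) (his \<tau> v)"
  using assms by (induction \<tau>) (auto intro!: hi_grow simp: his_1[simplified])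

text \<open>One letter is gained per substitution, so the first \<open>length \<tau>\<close> letters
  at level \<open>\<tau>\<close> no longer depend on the word that was inserted. Every passage
  between limit words and finite levels rests on this.\<close>

lemma los_contract:
  assumes "u 0 = 0" "v 0 = 0" "binary u" "binary v" "n \<le> length \<tau>"
  shows "agree n (los \<tau> u) (los \<tau> v)"
  by (rule agree_mono[OF los_grow[of 0]]) (use assms in \<open>auto simp: agree_def\<close>)

lemma his_contract:
  assumes "u 0 = 1" "v 0 = 1" "binary u" "binary v" "n \<le> length \<tau>"
  shows "agree n (his \<tau> u) (his \<tau> v)"
  by (rule agree_mono[OF his_grow[of 0]]) (use assms in \<open>auto simp: agree_def\<close>)

lemma subst_const: "subst_inf L z0 = z0" "subst_inf R z1 = z1" "subst_inf M z0 = a01" "subst_inf R z0 = a01"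
  "subst_inf M z1 = a10" "subst_inf L z1 = a01"
proof -
  \<comment> \<open>An equation that expresses a word by itself behind a nonempty block has only one
    solution, since agreement on n letters implies agreement on more.\<close>
  have 1: "x = y" if "x = c ## x" "y = c ## y" for c x y
  proof (rule agree_eqI)
    show "agree n x y" for n
    proof (induction n)
      case (Suc n)
      then have "agree (Suc n) (c ## x) (c ## y)" by simp
      then show ?case by (simp only: that[symmetric])
    qed simp
  qed
  have 2: "x = y" if "x = c ## d ## x" "y = c ## d ## y" for c d x y
  proof (rule agree_eqI)
    show "agree n x y" for n
    proof (induction n)
      case (Suc n)
      then have "agree (Suc n) (c ## d ## x) (c ## d ## y)" by (simp add: agree_sconsI)
      then show ?case by (simp only: that[symmetric])
    qed simp
  qed
  have a: "a01 = 0 ## 1 ## a01" "a10 = 1 ## 0 ## a10" using a01_unfold a10_unfold by simp_all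
  show "subst_inf L z0 = z0"
    by (rule 1[of _ 0], rule trans[OF arg_cong[OF z0_unfold, of "subst_inf L"] subst_scons(1)], rule z0_unfold)
  show "subst_inf R z1 = z1"
    by (rule 1[of _ 1], rule trans[OF arg_cong[OF z1_unfold, of "subst_inf R"] subst_scons(8)], rule z1_unfold)
  show "subst_inf M z0 = a01"
    by (rule 2[of _ 0 1], rule trans[OF arg_cong[OF z0_unfold, of "subst_inf M"] subst_scons(4)], rule a)
  show "subst_inf R z0 = a01"
    by (rule 2[of _ 0 1], rule trans[OF arg_cong[OF z0_unfold, of "subst_inf R"] subst_scons(7)], rule a)
  show "subst_inf M z1 = a10"
    by (rule 2[of _ 1 0], rule trans[OF arg_cong[OF z1_unfold, of "subst_inf M"] subst_scons(5)], rule a)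
  show "subst_inf L z1 = a01"
    by (rule 2[of _ 0 1], rule trans[OF arg_cong[OF z1_unfold, of "subst_inf L"] subst_scons(2)], rule a)
qed

text \<open>Neighbouring children share bounds: \<open>0 ## a01\<close> is both
  \<open>lo L w01\<close> and \<open>lo M z0\<close>, and \<open>1 ## a10\<close> is both
  \<open>hi M z1\<close> and \<open>hi R w10\<close>. Moreover \<open>L\<close> keeps
  \<open>z0\<close> and \<open>w10\<close>, while \<open>R\<close> keeps \<open>w01\<close> and
  \<open>z1\<close>.\<close>

lemma lo_hi_const:
  "lo L z0 = z0" "lo L w01 = 0 ## a01" "lo M z0 = 0 ## a01" "lo R z0 = a01" "lo R w01 = w01"
  "hi L z1 = a10" "hi L w10 = w10" "hi M z1 = 1 ## a10" "hi R w10 = 1 ## a10" "hi R z1 = z1"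
proof -
  have z: "Suc 0 ## z1 = z1" "Suc 0 ## a01 = a10" "shift (Suc 0) a01 = a10"
    using z1_unfold a10_unfold a01_unfold shift_1_scons[of 0 a10] by simp_all
  show "lo L z0 = z0" "lo L w01 = 0 ## a01" "lo M z0 = 0 ## a01" "lo R z0 = a01" "lo R w01 = w01"
  "hi L z1 = a10" "hi L w10 = w10" "hi M z1 = 1 ## a10" "hi R w10 = 1 ## a10" "hi R z1 = z1"
    by (simp_all add: subst_const w01_eq w10_eq z)
qed

subsection \<open>Words with all tails between two bounds\<close>

text \<open>The bounds are predicates instead of words because the thresholds for a given m and base
  need not be attained by words. Renormalisation becomes composition of the predicates with
  \<open>lo\<close> and \<open>hi\<close>.\<close>

definition Om :: "((nat \<Rightarrow> nat) \<Rightarrow> bool) \<Rightarrow> ((nat \<Rightarrow> nat) \<Rightarrow> bool) \<Rightarrow> (nat \<Rightarrow> nat) set" where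
  "Om U D = {u. binary u \<and> (\<forall>v. tail u v \<longrightarrow> U v \<and> D v)}"

definition upc :: "((nat \<Rightarrow> nat) \<Rightarrow> bool) \<Rightarrow> bool" where
  "upc U \<longleftrightarrow> (\<forall>x y. binary x \<longrightarrow> binary y \<longrightarrow> U x \<longrightarrow> lex_le x y \<longrightarrow> U y)"

definition dnc :: "((nat \<Rightarrow> nat) \<Rightarrow> bool) \<Rightarrow> bool" where
  "dnc D \<longleftrightarrow> (\<forall>x y. binary x \<longrightarrow> binary y \<longrightarrow> D y \<longrightarrow> lex_le x y \<longrightarrow> D x)"

lemma upcD: "upc U \<Longrightarrow> U x \<Longrightarrow> lex_le x y \<Longrightarrow> binary x \<Longrightarrow> binary y \<Longrightarrow> U y"
  unfolding upc_def by blast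

lemma dncD: "dnc D \<Longrightarrow> D y \<Longrightarrow> lex_le x y \<Longrightarrow> binary x \<Longrightarrow> binary y \<Longrightarrow> D x"
  unfolding dnc_def by blast

lemma upc_lo: "upc U \<Longrightarrow> upc (\<lambda>x. U (lo s x))"
  unfolding upc_def using lo_lex_le by (meson binary_lo)

lemma dnc_hi: "dnc D \<Longrightarrow> dnc (\<lambda>x. D (hi s x))"
  unfolding dnc_def using hi_lex_le by (meson binary_hi)

lemma Om_tail: "u \<in> Om U D \<Longrightarrow> tail u v \<Longrightarrow> v \<in> Om U D"
  unfolding Om_def using tail_trans tail_binary by blast

lemma Om_binary: "u \<in> Om U D \<Longrightarrow> binary u"
  and OmU: "u \<in> Om U D \<Longrightarrow> U u" and OmD: "u \<in> Om U D \<Longrightarrow> D u"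
  unfolding Om_def using tail_refl by blast+

text \<open>Each tail of the image lies between \<open>lo s w\<close> and \<open>hi s w\<close> for
  some tail w of z, and the two predicates are monotone.\<close>

lemma subst_in_Om:
  assumes U: "upc U" and D: "dnc D" and z: "z \<in> Om (\<lambda>x. U (lo s x)) (\<lambda>x. D (hi s x))"
  shows "subst_inf s z \<in> Om U D"
proof -
  have "U v \<and> D v" if t: "tail (subst_inf s z) v" for v
  proof -
    have v: "binary v" using tail_binary[OF t] by simp
    have *: "U (lo s w) \<and> D (hi s w) \<and> binary w" if "tail z w" for w
      using z that tail_binary unfolding Om_def by blast
    have **: "U v \<and> D v" if "tail z w" "lex_le (lo s w) v" "lex_le v (hi s w)" for w
      using *[OF that(1)] that upcD[OF U] dncD[OF D] v by (meson binary_lo binary_hi)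
    show ?thesis using t
    proof (cases rule: subst_tail_cases)
      case (1 w)
      have w: "binary w" using 1 * by blast
      have "lex_le (lo s w) v \<and> lex_le v (hi s w)"
        using 1 zero_scons_le[of "subst_inf s w"] one_scons_ge[of "subst_inf s w"]
          zero_scons_le[of "hi L w"] w
        by (cases s) (auto simp: subst_L_scons simp del: hi.simps(1))
      then show ?thesis using 1 ** by blast
    next
      case (2 a b c w)
      have aw: "binary (a ## w)" "binary w" using 2 * tail_sconsI by blast+
      show ?thesis
      proof (cases s)
        case L
        then have "a = 1" "c = 1" using 2(2) aw by auto
        then have v: "v = hi L (a ## w)" "lo L (a ## w) = 0 ## v" using L 2(3) by simp_all
        then have "lex_le (lo s (a ## w)) v" "lex_le v (hi s (a ## w))"
          using L zero_scons_le[OF \<open>binary v\<close>] by (simp_all del: lo.simps hi.simps)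
        then show ?thesis using ** 2 by blast
      next
        case M
        then have "c = 0 \<or> c = 1" using 2(2) by (auto split: if_splits)
        then have "lex_le (lo s w) v" "lex_le v (hi s w)" using 2 M by auto
        then show ?thesis using ** 2 tail_sconsI by blast
      next
        case R
        then have "c = 1" using 2(2) by (auto split: if_splits)
        then have "lex_le (lo s w) v" "lex_le v (hi s w)"
          using 2 R one_scons_ge[of "subst_inf R w"] by auto
        then show ?thesis using ** 2 tail_sconsI by blast
      qed
    qed
  qed
  then show ?thesis by (simp add: Om_def)
qed

lemma apply_in_Om:
  assumes "upc U" "dnc D" "z \<in> Om (\<lambda>x. U (los \<tau> x)) (\<lambda>x. D (his \<tau> x))"
  shows "apply_inf \<tau> z \<in> Om U D"
  using assms
proof (induction \<tau> arbitrary: U D)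
  case (Cons s \<tau>)
  have "apply_inf \<tau> z \<in> Om (\<lambda>x. U (lo s x)) (\<lambda>x. D (hi s x))"
    using Cons.prems by (intro Cons.IH upc_lo dnc_hi) auto
  then show ?case using subst_in_Om Cons.prems by simp
qed simp


section \<open>Desubstitution and countability\<close>

text \<open>A coinductive argument: stripping one block stays inside X, so iteration reads off the
  letters of a preimage, and the prefixes already matched grow without bound.\<close>

lemma desubst_exists:
  assumes "\<And>u. u \<in> X \<Longrightarrow> \<exists>a\<in>{0,1}. \<exists>u'\<in>X. u = conc (img s a) u'" and "u \<in> X"
  shows "\<exists>v. binary v \<and> u = subst_inf s v"
proof -
  obtain a f where af: "\<And>u. u \<in> X \<Longrightarrow> a u \<in> {0,1} \<and> f u \<in> X \<and> u = conc (img s (a u)) (f u)"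
    using assms(1) by metis
  define w where "w u = (\<lambda>k. a ((f ^^ k) u))" for u
  have w: "w u = a u ## w (f u)" for u
    by (rule ext, rename_tac k, case_tac k) (auto simp: w_def funpow_swap1)
  have X: "(f ^^ k) u \<in> X" for k
    by (induction k) (use af assms(2) in auto)
  then have "binary (w u)" unfolding binary_def w_def using af by blast
  moreover have "agree n x (subst_inf s (w x))" if "x \<in> X" for x n
    using that
  proof (induction n arbitrary: x)
    case (Suc n)
    have "agree n (f x) (subst_inf s (w (f x)))" using Suc af by blast
    moreover have "\<exists>y ys. img s (a x) = y # ys" using img_length[of s "a x"] by (cases "img s (a x)") auto
    moreover have "agree k p q \<Longrightarrow> agree k (conc xs p) (conc xs q)" for k xs p q
      by (induction xs) (auto intro: agree_sconsI)
    ultimately have "agree (Suc n) (conc (img s (a x)) (f x)) (conc (img s (a x)) (subst_inf s (w (f x))))"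
      by auto
    then show ?case using af[OF Suc.prems] w[of x] by (metis subst_inf_scons)
  qed simp
  then have "u = subst_inf s (w u)" using assms(2) agree_eqI by blast
  ultimately show ?thesis by blast
qed

lemma countable_eventually:
  assumes "countable C" shows "countable {u. \<exists>v\<in>C. tail u v}"
proof -
  have "{u. \<exists>v\<in>C. tail u v} \<subseteq> (\<lambda>(xs, v). conc xs v) ` (UNIV \<times> C)"
  proof safe
    fix u v assume "v \<in> C" "tail u v"
    then obtain k where k: "v = shift k u" by (auto simp: tail_def)
    have "u = conc (map u [0..<k]) (shift k u)"
      by (rule ext) (simp add: conc_nth shift_apply)
    then show "u \<in> (\<lambda>(xs, v). conc xs v) ` (UNIV \<times> C)" using k \<open>v \<in> C\<close>
      by (intro image_eqI[of _ _ "(map u [0..<k], v)"]) auto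
  qed
  moreover have "countable ((\<lambda>(xs, v). conc xs v) ` (UNIV \<times> C))" using assms by blast
  ultimately show ?thesis by (rule countable_subset)
qed

lemma first_occurrence:
  assumes "tail u v" "v 0 \<noteq> u 0" "binary u"
  shows "\<exists>w. tail u (u 0 ## w) \<and> w 0 \<noteq> u 0"
proof -
  obtain k where k: "v = shift k u" using assms by (auto simp: tail_def)
  define j where "j = (LEAST j. u j \<noteq> u 0)"
  have ex: "\<exists>j. u j \<noteq> u 0" using k assms by (auto simp: shift_apply)
  have j: "u j \<noteq> u 0" unfolding j_def using LeastI_ex[OF ex] .
  have jl: "u i = u 0" if "i < j" for i using that not_less_Least unfolding j_def by blast
  obtain i where i: "j = Suc i" using j by (cases j) auto
  have "shift i u = u 0 ## shift j u" using shift_unfold[of i u] jl[of i] by (simp add: i)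
  then have "tail u (u 0 ## shift j u)" using tail_shift[of u i] by simp
  moreover have "shift j u 0 \<noteq> u 0" using j by (simp add: shift_apply)
  ultimately show ?thesis by blast
qed

lemma const_word: assumes "binary u" "\<And>v. tail u v \<Longrightarrow> v 0 = c" shows "u = (\<lambda>_. c)"
  using assms(2)[OF tail_shift] by (auto simp: shift_apply)

text \<open>Prepending zeros only decreases a word, so a lower bound for the tails that follow a one
  is a lower bound for all tails after the first one.\<close>

lemma upc_after_one:
  assumes "upc U" "binary u" "u 0 = 1"
    and "\<And>w. tail u (1 ## w) \<Longrightarrow> U w"
  shows "U (shift (Suc k) u)"
proof (induction k)
  case 0
  then show ?case using assms scons_shift[of u] by (metis tail_refl One_nat_def)
next
  case (Suc k)
  have e: "shift (Suc k) u = u (Suc k) ## shift (Suc (Suc k)) u" by (rule shift_unfold)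
  show ?case
  proof (cases "u (Suc k) = 1")
    case True then show ?thesis using e assms(4) tail_shift by metis
  next
    case False
    then have "u (Suc k) = 0" using binaryD[OF assms(2), of "Suc k"] by auto
    then show ?thesis using e Suc upcD[OF assms(1)] zero_scons_le assms(2) by (metis binary_shift)
  qed
qed

lemma dnc_after_zero:
  assumes "dnc D" "binary u" "u 0 = 0"
    and "\<And>w. tail u (0 ## w) \<Longrightarrow> D w"
  shows "D (shift (Suc k) u)"
proof (induction k)
  case 0
  then show ?case using assms scons_shift[of u] by (metis tail_refl One_nat_def)
next
  case (Suc k)
  have e: "shift (Suc k) u = u (Suc k) ## shift (Suc (Suc k)) u" by (rule shift_unfold)
  show ?case
  proof (cases "u (Suc k) = 0")
    case True then show ?thesis using e assms(4) tail_shift by metis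
  next
    case False
    then have "u (Suc k) = 1" using binaryD[OF assms(2), of "Suc k"] by auto
    then show ?thesis using e Suc dncD[OF assms(1)] one_scons_ge assms(2) by (metis binary_shift)
  qed
qed

text \<open>Since \<open>hi L y\<close> is at most \<open>a10\<close>, the upper bound excludes
  \<open>a10\<close> and with it the factor 11. From its first 0 on, a word thus splits into blocks
  0 and 01. The preimage satisfies the new bounds because \<open>L w\<close> and
  \<open>hi L w\<close> are both tails of the image.\<close>

lemma countable_Om_L:
  assumes U: "upc U" and D: "dnc D" and "\<not> D (hi L y)" "binary y"
    and c: "countable (Om (\<lambda>x. U (lo L x)) (\<lambda>x. D (hi L x)))"
  shows "countable (Om U D)"
proof -
  let ?O = "Om (\<lambda>x. U (lo L x)) (\<lambda>x. D (hi L x))"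
  have "lex_le (hi L y) a10" using hi_lex_le[OF lex_le_z1 _ _, of y L] assms lo_hi_const by simp
  then have nD: "\<not> D a10" using assms(3,4) dncD[OF D] by (meson binary_hi binary_zs)
  have no11: "1 ## 1 ## w \<notin> Om U D" for w
  proof
    assume *: "1 ## 1 ## w \<in> Om U D"
    have "lex_le a10 (1 ## 1 ## w)" using a10_unfold a01_unfold by (metis lex_le_scons zero_less_one)
    then show False using * nD dncD[OF D] by (metis OmD Om_binary binary_zs(4))
  qed
  define X where "X = {u \<in> Om U D. u 0 = 0}"
  have X: "\<exists>v. binary v \<and> u = subst_inf L v" if "u \<in> X" for u
  proof (rule desubst_exists[OF _ that])
    fix u assume u: "u \<in> X"
    then obtain u' where e: "u = 0 ## u'" by (metis (mono_tags) X_def mem_Collect_eq scons_cases)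
    have u': "u' \<in> Om U D" using u e Om_tail tail_sconsI tail_refl unfolding X_def by blast
    from Om_binary[OF u'] show "\<exists>a\<in>{0,1}. \<exists>u'\<in>X. u = conc (img L a) u'"
    proof (cases rule: binary_cases)
      case (1 v)
      then have "u' \<in> X" using u' unfolding X_def by simp
      then show ?thesis using e by (intro bexI[of _ 0] bexI[of _ u']) auto
    next
      case (2 v)
      then have v: "v \<in> Om U D" using u' Om_tail tail_sconsI tail_refl by blast
      from Om_binary[OF v] have "v 0 = 0"
        by (cases rule: binary_cases) (use no11 u' 2 in auto)
      then have "v \<in> X" using v unfolding X_def by simp
      then show ?thesis using e 2 by (intro bexI[of _ 1] bexI[of _ v]) auto
    qed
  qed
  have XO: "u \<in> subst_inf L ` ?O" if "u \<in> X" for u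
  proof -
    obtain v where v: "binary v" "u = subst_inf L v" using X \<open>u \<in> X\<close> by blast
    have "U (lo L w) \<and> D (hi L w)" if t: "tail v w" for w
    proof -
      have t': "tail u (subst_inf L w)" unfolding v using subst_tail[OF t] .
      then have "tail u (0 ## hi L w)" using subst_L_scons tail_binary[OF t v(1)] by metis
      then have "tail u (hi L w)" using tail_sconsI by blast
      then show ?thesis using t' \<open>u \<in> X\<close> unfolding X_def Om_def by simp
    qed
    then show ?thesis using v unfolding Om_def by blast
  qed
  have "Om U D \<subseteq> {u. \<exists>v\<in>subst_inf L ` ?O. tail u v}"
  proof
    fix u assume u: "u \<in> Om U D"
    from Om_binary[OF u] show "u \<in> {u. \<exists>v\<in>subst_inf L ` ?O. tail u v}"
    proof (cases rule: binary_cases)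
      case 1
      then have "u \<in> X" using u unfolding X_def by simp
      then show ?thesis using XO tail_refl by blast
    next
      case (2 v)
      then have v: "v \<in> Om U D" using u Om_tail tail_sconsI tail_refl by blast
      from Om_binary[OF v] have "v 0 = 0"
        by (cases rule: binary_cases) (use no11 u 2 in auto)
      then have "v \<in> X" using v unfolding X_def by simp
      then show ?thesis using XO 2 tail_sconsI tail_refl by blast
    qed
  qed
  then show ?thesis using countable_eventually[OF countable_image[OF c]] countable_subset by blast
qed

text \<open>Dually, \<open>lo R y\<close> is at least \<open>a01\<close>, which excludes the factor
  00, and every word splits into blocks 01 and 1.\<close>

lemma countable_Om_R:
  assumes U: "upc U" and D: "dnc D" and "\<not> U (lo R y)" "binary y"
    and c: "countable (Om (\<lambda>x. U (lo R x)) (\<lambda>x. D (hi R x)))"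
  shows "countable (Om U D)"
proof -
  let ?O = "Om (\<lambda>x. U (lo R x)) (\<lambda>x. D (hi R x))"
  have "lex_le a01 (lo R y)" using lo_lex_le[OF z0_lex_le _ _, of y R] assms lo_hi_const by simp
  then have nU: "\<not> U a01" using assms(3,4) upcD[OF U] by (meson binary_lo binary_zs)
  have no00: "0 ## 0 ## w \<notin> Om U D" for w
  proof
    assume *: "0 ## 0 ## w \<in> Om U D"
    have "lex_le (0 ## 0 ## w) a01" using a10_unfold a01_unfold by (metis lex_le_scons zero_less_one)
    then show False using * nU upcD[OF U] by (metis OmU Om_binary binary_zs(3))
  qed
  have X: "\<exists>v. binary v \<and> u = subst_inf R v" if "u \<in> Om U D" for u
  proof (rule desubst_exists[OF _ that])
    fix u assume u: "u \<in> Om U D"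
    from Om_binary[OF u] show "\<exists>a\<in>{0,1}. \<exists>u'\<in>Om U D. u = conc (img R a) u'"
    proof (cases rule: binary_cases)
      case (1 v)
      then have v: "v \<in> Om U D" using u Om_tail tail_sconsI tail_refl by blast
      from Om_binary[OF v] show ?thesis
      proof (cases rule: binary_cases)
        case (2 w)
        then have "w \<in> Om U D" using v Om_tail tail_sconsI tail_refl by blast
        then show ?thesis using 1 2 by (intro bexI[of _ 0] bexI[of _ w]) auto
      qed (use no00 u 1 in auto)
    next
      case (2 v)
      then have v: "v \<in> Om U D" using u Om_tail tail_sconsI tail_refl by blast
      then show ?thesis using 2 by (intro bexI[of _ 1] bexI[of _ v]) auto
    qed
  qed
  have "Om U D \<subseteq> {u. \<exists>v\<in>subst_inf R ` ?O. tail u v}"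
  proof
    fix u assume u: "u \<in> Om U D"
    obtain v where v: "binary v" "u = subst_inf R v" using X u by blast
    have t: "tail u (1 ## subst_inf R w)" if "tail v (c ## w)" for c w
    proof -
      have "c = 0 \<or> c = 1" using tail_binary[OF that v(1)] by auto
      then show ?thesis using subst_tail[OF that, of R] v(2)
        by (auto intro: tail_sconsI)
    qed
    \<comment> \<open>The word \<open>hi R x\<close> has a 1 in front of \<open>R x\<close>. It
      occurs as a tail as soon as some letter precedes x, because both blocks end in 1; hence the
      first letter of v is given up.\<close>
    obtain c w where cw: "v = c ## w" by (rule scons_cases)
    have "U (lo R x) \<and> D (hi R x)" if x: "tail w x" for x
    proof -
      obtain k where "x = shift k w" using x by (auto simp: tail_def)
      then have "shift k v = v k ## x" using cw shift_unfold[of k v] by simp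
      then have "tail u (1 ## subst_inf R x)" using t tail_shift by metis
      then have "tail u (hi R x)" "tail u (lo R x)" using tail_sconsI by auto
      then show ?thesis using u unfolding Om_def by blast
    qed
    then have "w \<in> ?O" using v cw unfolding Om_def by simp
    moreover have "tail u (subst_inf R w)" using t cw tail_refl tail_sconsI by blast
    ultimately show "u \<in> {u. \<exists>v\<in>subst_inf R ` ?O. tail u v}" by blast
  qed
  then show ?thesis using countable_eventually[OF countable_image[OF c]] countable_subset by blast
qed

text \<open>The two violations exclude \<open>0 ## a01\<close> and \<open>1 ## a10\<close>, so what
  follows a 0 is at least \<open>a01\<close> and what follows a 1 is at most \<open>a10\<close>. Any
  repeated letter then starts a splitting into blocks 01 and 10.\<close>

lemma countable_Om_M:
  assumes U: "upc U" and D: "dnc D" and "\<not> U (lo M x)" "binary x" "\<not> D (hi M y)" "binary y"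
    and c: "countable (Om (\<lambda>x. U (lo M x)) (\<lambda>x. D (hi M x)))"
  shows "countable (Om U D)"
proof -
  let ?O = "Om (\<lambda>x. U (lo M x)) (\<lambda>x. D (hi M x))"
  have "lex_le (0 ## a01) (lo M x)" using lo_lex_le[OF z0_lex_le _ _, of x M] assms lo_hi_const by simp
  then have nU: "\<not> U (0 ## a01)" using assms(3,4) upcD[OF U] by (meson binary_lo binary_zs binary_scons insertCI)
  have "lex_le (hi M y) (1 ## a10)" using hi_lex_le[OF lex_le_z1 _ _, of y M] assms lo_hi_const by simp
  then have nD: "\<not> D (1 ## a10)" using assms(5,6) dncD[OF D] by (meson binary_hi binary_zs binary_scons insertCI)
  have lo: "lex_le a01 v" if v: "0 ## v \<in> Om U D" for v
  proof (rule ccontr)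
    assume "\<not> lex_le a01 v"
    then have "lex_le (0 ## v) (0 ## a01)" by (simp only: lex_not_le) (simp add: lex_le_def)
    then show False using nU OmU[OF v] Om_binary[OF v] upcD[OF U] by (metis binary_scons binary_zs(3) insertCI)
  qed
  have hi: "lex_le v a10" if v: "1 ## v \<in> Om U D" for v
  proof (rule ccontr)
    assume "\<not> lex_le v a10"
    then have "lex_le (1 ## a10) (1 ## v)" by (simp only: lex_not_le) (simp add: lex_le_def)
    then show False using nD OmD[OF v] Om_binary[OF v] dncD[OF D] by (metis binary_scons binary_zs(4) insertCI)
  qed
  \<comment> \<open>The bounds are the images of \<open>z0\<close> and \<open>z1\<close> under
    \<open>M\<close>, the least and the greatest image. A word of X begins with 01 or 10, and
    removing this block leads back to X.\<close>
  define X where "X = {y \<in> Om U D. lex_le a01 y \<and> lex_le y a10}"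
  have a: "a01 = 0 ## 1 ## a01" "a10 = 1 ## 0 ## a10" using a01_unfold a10_unfold by simp_all
  have X: "\<exists>v. binary v \<and> u = subst_inf M v" if "u \<in> X" for u
  proof (rule desubst_exists[OF _ that])
    fix u assume "u \<in> X"
    then have u: "u \<in> Om U D" "lex_le a01 u" "lex_le u a10" by (auto simp: X_def)
    from Om_binary[OF u(1)] show "\<exists>a\<in>{0,1}. \<exists>u'\<in>X. u = conc (img M a) u'"
    proof (cases rule: binary_cases)
      case (1 v)
      then have v: "v \<in> Om U D" using u Om_tail tail_sconsI tail_refl by blast
      have le: "lex_le (1 ## a01) v" using u(2) 1 a(1) by (metis lex_le_scons less_irrefl)
      from Om_binary[OF v] show ?thesis
      proof (cases rule: binary_cases)
        case (2 w)
        then have w: "w \<in> Om U D" using v Om_tail tail_sconsI tail_refl by blast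
        have "lex_le a01 w" "lex_le w a10" using le 2 hi v by auto
        then have "w \<in> X" using w by (simp add: X_def)
        then show ?thesis using 1 2 by (intro bexI[of _ 0] bexI[of _ w]) auto
      qed (use le in auto)
    next
      case (2 v)
      then have v: "v \<in> Om U D" using u Om_tail tail_sconsI tail_refl by blast
      have le: "lex_le v (0 ## a10)" using u(3) 2 a(2) by (metis lex_le_scons less_irrefl)
      from Om_binary[OF v] show ?thesis
      proof (cases rule: binary_cases)
        case (1 w)
        then have w: "w \<in> Om U D" using v Om_tail tail_sconsI tail_refl by blast
        have "lex_le a01 w" "lex_le w a10" using le 1 lo v by auto
        then have "w \<in> X" using w by (simp add: X_def)
        then show ?thesis using 1 2 by (intro bexI[of _ 1] bexI[of _ w]) auto
      qed (use le in auto)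
    qed
  qed
  \<comment> \<open>The constant words are added by hand: they violate the renormalised bounds
    through \<open>lo M z0 = 0 ## a01\<close> and \<open>hi M z1 = 1 ## a10\<close>, although their
    images may belong to the set.\<close>
  let ?C = "subst_inf M ` (insert z0 (insert z1 ?O))"
  have XC: "\<exists>v\<in>?C. tail u v" if "u \<in> X" for u
  proof -
    have u: "u \<in> Om U D" using that by (simp add: X_def)
    obtain v where v: "binary v" "u = subst_inf M v" using X \<open>u \<in> X\<close> by blast
    \<comment> \<open>The word \<open>lo M w\<close> appears as a tail only behind a 1, and
      \<open>hi M w\<close> only behind a 0. One change of letter makes both bounds available, and
      prepended letters then extend them to all later tails.\<close>
    have p0: "U (lo M w)" if "tail v (1 ## w)" for w
    proof -
      have "tail u (1 ## lo M w)" using subst_tail[OF that, of M] v by simp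
      then have "tail u (lo M w)" by (rule tail_sconsI)
      then show ?thesis using u unfolding Om_def by blast
    qed
    have p1: "D (hi M w)" if "tail v (0 ## w)" for w
    proof -
      have "tail u (0 ## hi M w)" using subst_tail[OF that, of M] v by simp
      then have "tail u (hi M w)" by (rule tail_sconsI)
      then show ?thesis using u unfolding Om_def by blast
    qed
    have upM: "upc (\<lambda>x. U (lo M x))" and dnM: "dnc (\<lambda>x. D (hi M x))"
      using upc_lo[OF U] dnc_hi[OF D] by blast+
    show ?thesis
    proof (cases "\<exists>w. tail v w \<and> w 0 \<noteq> v 0")
      case False
      then have "v = (\<lambda>_. v 0)" using const_word v(1) by blast
      then have "v = z0 \<or> v = z1" using binaryD[OF v(1), of 0] by (auto simp: z0_def z1_def)
      then show ?thesis using v tail_refl by blast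
    next
      case True
      then obtain w where w: "tail v (v 0 ## w)" "w 0 \<noteq> v 0" using first_occurrence v(1) by blast
      then have tw: "tail v w" using tail_sconsI by blast
      then have bw: "binary w" using v(1) tail_binary by blast
      obtain d w' where w': "w = d ## w'" by (rule scons_cases)
      have bw': "binary w'" using bw w' by simp
      consider "v 0 = 0" "d = 1" | "v 0 = 1" "d = 0"
        using binaryD[OF v(1), of 0] binaryD[OF bw, of 0] w w' by auto
      then have *: "U (lo M x) \<and> D (hi M x)" if h: "tail w' x" for x
      proof cases
        case 1
        obtain k where k: "x = shift (Suc k) w" using h w' by (auto simp: tail_def)
        have "U (lo M (shift (Suc k) w))"
          by (rule upc_after_one[OF upM bw]) (use 1 w' p0 tw tail_trans in auto)
        \<comment> \<open>The 0 in front of w is restored, since the propagation lemma starts from a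
          word that begins with 0.\<close>
        moreover have "D (hi M (shift (Suc (Suc k)) (0 ## w)))"
          by (rule dnc_after_zero[OF dnM]) (use 1 w bw p1 tail_trans in auto)
        ultimately show ?thesis using k by simp
      next
        case 2
        obtain k where k: "x = shift (Suc k) w" using h w' by (auto simp: tail_def)
        have "D (hi M (shift (Suc k) w))"
          by (rule dnc_after_zero[OF dnM bw]) (use 2 w' p1 tw tail_trans in auto)
        moreover have "U (lo M (shift (Suc (Suc k)) (1 ## w)))"
          by (rule upc_after_one[OF upM]) (use 2 w bw p0 tail_trans in auto)
        ultimately show ?thesis using k by simp
      qed
      then have "w' \<in> ?O" using bw' by (simp add: Om_def)
      moreover have "tail u (subst_inf M w')" using tw w' subst_tail tail_sconsI v(2) by blast
      ultimately show ?thesis by blast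
    qed
  qed
  \<comment> \<open>The second of two equal letters begins a word of X: the first one gives the
    nontrivial comparison, the letter itself the other.\<close>
  have rep: "\<exists>w\<in>?C. tail u w" if "c ## c ## v \<in> Om U D" "tail u (c ## c ## v)" for u c v
  proof -
    have "c = 0 \<or> c = 1" using Om_binary[OF that(1)] by auto
    then have "c ## v \<in> X"
    proof
      assume "c = 0"
      then show ?thesis using that(1) lo Om_tail[OF that(1) tail_sconsI[OF tail_refl]] a10_unfold
        unfolding X_def by (metis (mono_tags, lifting) lex_le_scons mem_Collect_eq zero_less_one)
    next
      assume "c = 1"
      then show ?thesis using that(1) hi Om_tail[OF that(1) tail_sconsI[OF tail_refl]] a01_unfold
        unfolding X_def by (metis (mono_tags, lifting) lex_le_scons mem_Collect_eq zero_less_one)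
    qed
    then show ?thesis using XC that(2) tail_sconsI tail_trans by metis
  qed
  have "\<exists>v\<in>?C. tail u v" if u: "u \<in> Om U D" for u
  proof (cases "\<exists>c v. tail u (c ## c ## v)")
    case True then show ?thesis using rep u Om_tail by metis
  next
    case False
    have ne: "u (Suc k) \<noteq> u k" for k
      using False tail_shift[of u k] shift_unfold[of k u] shift_unfold[of "Suc k" u] by metis
    have nx: "u (Suc k) = 1 - u k" for k
      using ne[of k] binaryD[OF Om_binary[OF u], of k] binaryD[OF Om_binary[OF u], of "Suc k"] by auto
    have uk: "u k = (u 0 + k) mod 2" for k
    proof (induction k)
      case 0 then show ?case using binaryD[OF Om_binary[OF u], of 0] by auto
    next
      case (Suc k) then show ?case using nx[of k] by (auto simp: mod_Suc)
    qed
    have "u = (\<lambda>k. (u 0 + k) mod 2)" by (rule ext) (rule uk)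
    moreover have "u 0 = 0 \<or> u 0 = 1" using binaryD[OF Om_binary[OF u], of 0] .
    ultimately have "u = (\<lambda>k. (0 + k) mod 2) \<or> u = (\<lambda>k. (1 + k) mod 2)" by metis
    then have "u = a01 \<or> u = a10" by (simp add: a01_def a10_def)
    then have "u = subst_inf M z0 \<or> u = subst_inf M z1" by (simp add: subst_const)
    then show ?thesis using tail_refl by blast
  qed
  then have "Om U D \<subseteq> {u. \<exists>v\<in>?C. tail u v}" by blast
  moreover have "countable ?C" using c by (intro countable_image) simp
  ultimately show ?thesis using countable_eventually countable_subset by blast
qed

text \<open>One violation of each bound at the deepest level serves every intermediate level,
  because \<open>los (s # \<tau>) x\<close> is \<open>lo s\<close> of \<open>los \<tau> x\<close>,
  and likewise for \<open>his\<close>. The guards admit the empty path, which is used for m at least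
  \<open>mu w01\<close>.\<close>

lemma countable_Om:
  assumes "upc U" "dnc D" "\<tau> \<noteq> [] \<Longrightarrow> \<not> U (los \<tau> x)" "\<tau> \<noteq> [] \<Longrightarrow> \<not> D (his \<tau> y)" "binary x" "binary y"
    and "countable (Om (\<lambda>x. U (los \<tau> x)) (\<lambda>x. D (his \<tau> x)))"
  shows "countable (Om U D)"
  using assms
proof (induction \<tau> arbitrary: U D)
  case (Cons s \<tau>)
  have c: "countable (Om (\<lambda>x. U (lo s x)) (\<lambda>x. D (hi s x)))"
  proof (rule Cons.IH[OF upc_lo[OF Cons.prems(1)] dnc_hi[OF Cons.prems(2)]])
    show "\<not> U (lo s (los \<tau> x))" "\<not> D (hi s (his \<tau> y))" using Cons.prems(3,4) by simp_all
    show "countable (Om (\<lambda>x. U (lo s (los \<tau> x))) (\<lambda>x. D (hi s (his \<tau> x))))"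
      using Cons.prems(7) by (simp only: los_simps his_simps)
  qed fact+
  have n: "\<not> U (lo s (los \<tau> x))" "\<not> D (hi s (his \<tau> y))" using Cons.prems(3,4) by simp_all
  have b: "binary (los \<tau> x)" "binary (his \<tau> y)" using Cons.prems(5,6) by simp_all
  show ?case
  proof (cases s)
    case L
    show ?thesis
      by (rule countable_Om_L[OF Cons.prems(1,2) _ b(2)]) (use n c L in \<open>simp_all only: not_False_eq_True\<close>)
  next
    case M
    show ?thesis
      by (rule countable_Om_M[OF Cons.prems(1,2) _ b(1) _ b(2)])
        (use n c M in \<open>simp_all only: not_False_eq_True\<close>)
  next
    case R
    show ?thesis
      by (rule countable_Om_R[OF Cons.prems(1,2) _ b(1)]) (use n c R in \<open>simp_all only: not_False_eq_True\<close>)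
  qed
qed simp

subsection \<open>Expansions in base \<open>\<beta>\<close>\<close>

lemma pib_summable:
  fixes \<beta> :: real
  assumes "1 < \<beta>" "\<And>k. \<bar>c k\<bar> \<le> B" shows "summable (\<lambda>k. c k / \<beta> ^ Suc k)"
proof (rule summable_comparison_test')
  show "summable (\<lambda>k. B / \<beta> * (1 / \<beta>) ^ k)"
    using assms(1) by (intro summable_mult summable_geometric) auto
  show "norm (c k / \<beta> ^ Suc k) \<le> B / \<beta> * (1 / \<beta>) ^ k" if "k \<ge> 0" for k
  proof -
    have "norm (c k / \<beta> ^ Suc k) = \<bar>c k\<bar> / \<beta> ^ Suc k" using assms(1) by simp
    also have "\<dots> \<le> B / \<beta> ^ Suc k" using assms by (intro divide_right_mono) auto
    finally show ?thesis by (simp add: power_divide)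
  qed
qed

lemma pib_split:
  assumes "1 < \<beta>" "\<And>k. \<bar>c k\<bar> \<le> B" shows "pib \<beta> c = (c 0 + pib \<beta> (\<lambda>k. c (Suc k))) / \<beta>"
proof -
  have s: "summable (\<lambda>k. c (Suc k) / \<beta> ^ Suc k)" by (rule pib_summable[OF assms(1)]) (rule assms(2))
  have "pib \<beta> c = c 0 / \<beta> + (\<Sum>k. c (Suc k) / \<beta> ^ Suc (Suc k))"
    unfolding pib_def using suminf_split_head[of "\<lambda>k. c k / \<beta> ^ Suc k", OF pib_summable[OF assms]] by simp
  also have "(\<Sum>k. c (Suc k) / \<beta> ^ Suc (Suc k)) = (\<Sum>k. c (Suc k) / \<beta> ^ Suc k / \<beta>)"
    by (simp add: mult.commute)
  also have "\<dots> = pib \<beta> (\<lambda>k. c (Suc k)) / \<beta>" unfolding pib_def by (rule suminf_divide[OF s])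
  finally show ?thesis by (simp add: add_divide_distrib)
qed

lemma pib_mono:
  assumes "1 < \<beta>" "\<And>k. \<bar>c k\<bar> \<le> B" "\<And>k. \<bar>d k\<bar> \<le> B" "\<And>k. c k \<le> d k" shows "pib \<beta> c \<le> pib \<beta> d"
  unfolding pib_def by (intro suminf_le pib_summable[of _ _ B] divide_right_mono) (use assms in auto)

lemma pib_const: assumes "1 < \<beta>" shows "pib \<beta> (\<lambda>_. m) = m / (\<beta> - 1)"
proof -
  have "pib \<beta> (\<lambda>_. m) = (m + pib \<beta> (\<lambda>_. m)) / \<beta>" using pib_split[OF assms, of "\<lambda>_. m" "\<bar>m\<bar>"] by simp
  then show ?thesis using assms by (simp add: field_simps)
qed

lemma pib_const_minus:
  assumes "1 < \<beta>" "\<And>k. \<bar>c k\<bar> \<le> B" shows "pib \<beta> (\<lambda>k. m - c k) = m / (\<beta> - 1) - pib \<beta> c"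
proof -
  have "summable (\<lambda>k. m / \<beta> ^ Suc k)" by (rule pib_summable[OF assms(1), of _ "\<bar>m\<bar>"]) simp
  from suminf_diff[OF this pib_summable[OF assms]]
  have "pib \<beta> (\<lambda>k. m - c k) = pib \<beta> (\<lambda>k. m) - pib \<beta> c"
    unfolding pib_def by (simp add: diff_divide_distrib)
  then show ?thesis using pib_const[OF assms(1)] by simp
qed

lemma pib_nonneg: assumes "1 < \<beta>" "\<And>k. 0 \<le> c k" "\<And>k. c k \<le> B" shows "0 \<le> pib \<beta> c"
  unfolding pib_def
  by (intro suminf_nonneg pib_summable[of _ _ B] divide_nonneg_nonneg) (use assms in auto)

lemma pib_strict_antimono:
  assumes "1 < \<beta>" "\<beta> < \<gamma>" "\<And>k. 0 \<le> c k" "\<And>k. c k \<le> B" "0 < c j" shows "pib \<gamma> c < pib \<beta> c"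
proof -
  have s: "summable (\<lambda>k. c k / \<beta> ^ Suc k)" "summable (\<lambda>k. c k / \<gamma> ^ Suc k)"
    by (rule pib_summable[of _ _ B]; use assms in auto)+
  have le: "c k / \<gamma> ^ Suc k \<le> c k / \<beta> ^ Suc k" for k
    using assms by (intro divide_left_mono power_mono mult_pos_pos) auto
  have "\<beta> ^ Suc j < \<gamma> ^ Suc j" using assms by (intro power_strict_mono) auto
  then have "c j / \<gamma> ^ Suc j < c j / \<beta> ^ Suc j"
    using assms by (intro divide_strict_left_mono mult_pos_pos) auto
  then have "0 < (\<Sum>k. c k / \<beta> ^ Suc k - c k / \<gamma> ^ Suc k)"
    by (intro suminf_pos2[of _ j] summable_diff s) (use le in \<open>auto simp: diff_ge_0_iff_ge\<close>)
  then show ?thesis unfolding pib_def using suminf_diff[OF s] by simp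
qed

text \<open>Up to the factor \<open>1 / \<beta>\<close> this is a power series in
  \<open>1 / \<beta>\<close> with bounded coefficients, evaluated inside the unit disc.\<close>

lemma pib_isCont:
  assumes "1 < \<beta>" "\<And>k. \<bar>c k\<bar> \<le> B" shows "isCont (\<lambda>\<beta>. pib \<beta> c) \<beta>"
proof -
  obtain K where K: "1 / \<beta> < K" "K < 1" using dense[of "1 / \<beta>" 1] assms(1) by auto
  have K0: "0 < K" using K assms(1) by (meson divide_pos_pos less_trans zero_less_one)
  have p: "pib x c = 1 / x * (\<Sum>n. c n * (1 / x) ^ n)" if "1 < x" for x
  proof -
    have "summable (\<lambda>k. x * (c k / x ^ Suc k))" by (intro summable_mult pib_summable[of x c B] that assms(2))
    then have "summable (\<lambda>n. c n * (1 / x) ^ n)" using that by (simp add: power_divide)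
    then have "1 / x * (\<Sum>n. c n * (1 / x) ^ n) = (\<Sum>n. 1 / x * (c n * (1 / x) ^ n))"
      by (rule suminf_mult[symmetric])
    then show ?thesis unfolding pib_def by (simp add: power_divide field_simps)
  qed
  have "summable (\<lambda>n. c n * K ^ n)"
  proof (rule summable_comparison_test')
    show "summable (\<lambda>n. B * K ^ n)" using K K0 by (intro summable_mult summable_geometric) auto
    show "norm (c n * K ^ n) \<le> B * K ^ n" if "n \<ge> 0" for n
      using assms(2)[of n] K0 by (simp add: abs_mult mult_right_mono)
  qed
  then have "isCont (\<lambda>x. \<Sum>n. c n * (1 / x) ^ n) \<beta>"
    by (rule isCont_powser'[rotated]) (use K K0 assms in auto)
  then have "isCont (\<lambda>x. 1 / x * (\<Sum>n. c n * (1 / x) ^ n)) \<beta>"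
    using assms by (intro continuous_intros) auto
  moreover have "\<forall>\<^sub>F x in nhds \<beta>. 1 / x * (\<Sum>n. c n * (1 / x) ^ n) = pib x c"
    by (rule eventually_nhds_in_open[of "{1<..}", THEN eventually_mono]) (use assms p in auto)
  ultimately show ?thesis by (subst (asm) isCont_cong) auto
qed

abbreviation wval :: "real \<Rightarrow> (nat \<Rightarrow> nat) \<Rightarrow> real" where
  "wval \<beta> u \<equiv> pib \<beta> (rw u)"

lemma rw_bound: "binary u \<Longrightarrow> \<bar>rw u k\<bar> \<le> 1" "0 \<le> rw u k" "binary u \<Longrightarrow> rw u k \<le> 1"
  using binaryD[of u k] by (auto simp: rw_def)

lemma wval_scons: "1 < \<beta> \<Longrightarrow> binary (c ## u) \<Longrightarrow> wval \<beta> (c ## u) = (real c + wval \<beta> u) / \<beta>"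
  using pib_split[of \<beta> "rw (c ## u)" 1] rw_bound(1)[of "c ## u"] by (simp add: rw_def)

lemma wval_nonneg: "1 < \<beta> \<Longrightarrow> binary u \<Longrightarrow> 0 \<le> wval \<beta> u"
  by (rule pib_nonneg[of _ _ 1]) (auto simp: rw_bound)

lemma wval_le: "1 < \<beta> \<Longrightarrow> binary u \<Longrightarrow> wval \<beta> u \<le> 1 / (\<beta> - 1)"
  using pib_mono[of \<beta> "rw u" 1 "\<lambda>_. 1"] pib_const[of \<beta> 1] by (auto simp: rw_bound)

lemma wval_agree:
  assumes "1 < \<beta>" "binary u" "binary v" "agree n u v"
  shows "\<bar>wval \<beta> u - wval \<beta> v\<bar> \<le> 1 / (\<beta> - 1) / \<beta> ^ n"
  using assms(2-4)
proof (induction n arbitrary: u v)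
  case 0
  then show ?case
    using wval_nonneg[of \<beta> u] wval_nonneg[of \<beta> v] wval_le[of \<beta> u] wval_le[of \<beta> v] assms(1) by (auto simp: abs_if)
next
  case (Suc n)
  obtain c u' d v' where e: "u = c ## u'" "v = d ## v'" by (metis scons_cases)
  then have "c = d" "\<bar>wval \<beta> u' - wval \<beta> v'\<bar> \<le> 1 / (\<beta> - 1) / \<beta> ^ n" using Suc by auto
  then have "\<bar>wval \<beta> u' - wval \<beta> v'\<bar> / \<beta> \<le> 1 / (\<beta> - 1) / \<beta> ^ n / \<beta>"
    using assms(1) by (intro divide_right_mono) auto
  moreover have "wval \<beta> u - wval \<beta> v = (wval \<beta> u' - wval \<beta> v') / \<beta>"
    using e Suc \<open>c = d\<close> wval_scons assms(1) by (simp add: diff_divide_distrib add_divide_distrib)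
  moreover have "1 / (\<beta> - 1) / \<beta> ^ n / \<beta> = 1 / (\<beta> - 1) / \<beta> ^ Suc n" by (simp add: mult_ac)
  ultimately show ?case using assms(1) by (simp only: abs_divide)
qed

lemma wval_continuous:
  assumes "1 < \<beta>" "0 < e"
  shows "\<exists>N. \<forall>u v. binary u \<longrightarrow> binary v \<longrightarrow> agree N u v \<longrightarrow> \<bar>wval \<beta> u - wval \<beta> v\<bar> < e"
proof -
  have "(\<lambda>n. 1 / (\<beta> - 1) * (1 / \<beta>) ^ n) \<longlonglongrightarrow> 1 / (\<beta> - 1) * 0"
    using assms(1) by (intro tendsto_mult LIMSEQ_power_zero tendsto_const) auto
  then have "\<forall>\<^sub>F n in sequentially. 1 / (\<beta> - 1) * (1 / \<beta>) ^ n < e"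
    using assms(2) by (auto intro: order_tendstoD)
  then obtain N where "1 / (\<beta> - 1) * (1 / \<beta>) ^ N < e"
    using eventually_happens'[OF sequentially_bot] by blast
  then have "1 / (\<beta> - 1) / \<beta> ^ N < e" by (simp add: power_divide)
  then show ?thesis using wval_agree[OF assms(1)] by (intro exI[of _ N]) fastforce
qed

text \<open>From base 2 on, the remainder is worth at most \<open>1 / (\<beta> - 1)\<close>, hence
  at most 1, and cannot compensate a smaller digit.\<close>

lemma wval_lex_le:
  assumes "2 \<le> \<beta>" "binary u" "binary v" "lex_le u v" shows "wval \<beta> u \<le> wval \<beta> v"
proof (cases "u = v")
  case False
  then obtain n where "\<forall>i<n. u i = v i" "u n < v n" using assms(4) by (auto simp: lex_le_def lex_less_def)
  then show ?thesis using assms(2,3)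
  proof (induction n arbitrary: u v)
    case 0
    then have "u 0 = 0" "v 0 = 1" using binaryD[of u 0] binaryD[of v 0] by auto
    then obtain u' v' where e: "u = 0 ## u'" "v = 1 ## v'" "binary u'" "binary v'"
      using scons_hd[OF _ 0(3)] scons_hd[OF _ 0(4)] by blast
    have "1 / (\<beta> - 1) \<le> 1" using assms(1) by simp
    then have "wval \<beta> u' \<le> 1 + wval \<beta> v'" using wval_le[of \<beta> u'] wval_nonneg[of \<beta> v'] assms(1) e by linarith
    then show ?case using wval_scons assms(1) e by (simp add: divide_right_mono)
  next
    case (Suc n)
    obtain c u' d v' where e: "u = c ## u'" "v = d ## v'" by (metis scons_cases)
    have "c = d" using Suc.prems(1) e by force
    moreover have "wval \<beta> u' \<le> wval \<beta> v'"
    proof (rule Suc.IH)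
      show "\<forall>i<n. u' i = v' i" using Suc.prems(1) e by (metis Suc_mono scons_Suc)
      show "u' n < v' n" using Suc.prems e by simp
    qed (use Suc.prems e in auto)
    ultimately show ?case using e Suc.prems wval_scons assms(1) by (auto simp: divide_right_mono)
  qed
qed simp

text \<open>At the first difference the values, scaled to that position, are at least
  \<open>1 - 1 / (\<beta> - 1)\<close> apart, which is \<open>(\<beta> - 2) / (\<beta> - 1)\<close>.
  This positive gap is the source of the dimension bound.\<close>

lemma wval_sep:
  assumes "2 < \<beta>" "binary u" "binary v" "\<exists>i\<le>n. u i \<noteq> v i"
  shows "(\<beta> - 2) / (\<beta> - 1) / \<beta> ^ Suc n \<le> \<bar>wval \<beta> u - wval \<beta> v\<bar>"
  using assms(2-4)
proof (induction n arbitrary: u v)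
  case 0
  have *: "(\<beta> - 2) / (\<beta> - 1) / \<beta> \<le> wval \<beta> y - wval \<beta> x"
    if h: "x 0 = 0" "y 0 = 1" "binary x" "binary y" for x y
  proof -
    obtain x' y' where e: "x = 0 ## x'" "y = 1 ## y'" "binary x'" "binary y'"
      using scons_hd[OF h(1,3)] scons_hd[OF h(2,4)] by blast
    have "(\<beta> - 2) / (\<beta> - 1) = 1 - 1 / (\<beta> - 1)" using assms(1) by (simp add: field_simps)
    also have "\<dots> \<le> 1 + wval \<beta> y' - wval \<beta> x'" using wval_le[of \<beta> x'] wval_nonneg[of \<beta> y'] e assms(1) by simp
    finally have "(\<beta> - 2) / (\<beta> - 1) / \<beta> \<le> (1 + wval \<beta> y' - wval \<beta> x') / \<beta>"
      using assms(1) by (intro divide_right_mono) auto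
    then show ?thesis using e wval_scons assms(1) by (simp add: diff_divide_distrib)
  qed
  have "u 0 \<noteq> v 0" using 0 by auto
  then consider "u 0 = 0" "v 0 = 1" | "u 0 = 1" "v 0 = 0"
    using binaryD[OF 0(1), of 0] binaryD[OF 0(2), of 0] by auto
  then show ?case using *[of u v] *[of v u] 0 by cases auto
next
  case (Suc n)
  obtain c u' d v' where e: "u = c ## u'" "v = d ## v'" by (metis scons_cases)
  show ?case
  proof (cases "c = d")
    case True
    obtain i where i: "i \<le> Suc n" "u i \<noteq> v i" using Suc.prems(3) by blast
    have "\<exists>i\<le>n. u' i \<noteq> v' i"
      by (cases i) (use i e True in auto)
    then have "(\<beta> - 2) / (\<beta> - 1) / \<beta> ^ Suc n \<le> \<bar>wval \<beta> u' - wval \<beta> v'\<bar>" using Suc e by auto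
    then have "(\<beta> - 2) / (\<beta> - 1) / \<beta> ^ Suc n / \<beta> \<le> \<bar>wval \<beta> u' - wval \<beta> v'\<bar> / \<beta>"
      using assms(1) by (intro divide_right_mono) auto
    moreover have "wval \<beta> u - wval \<beta> v = (wval \<beta> u' - wval \<beta> v') / \<beta>"
      using e Suc.prems True wval_scons assms(1) by (simp add: diff_divide_distrib add_divide_distrib)
    moreover have "(\<beta> - 2) / (\<beta> - 1) / \<beta> ^ Suc n / \<beta> = (\<beta> - 2) / (\<beta> - 1) / \<beta> ^ Suc (Suc n)"
      by (simp add: mult_ac)
    ultimately show ?thesis using assms(1) by (simp only: abs_divide)
  next
    case False
    then have "\<exists>i\<le>n. u i \<noteq> v i" using e by (intro exI[of _ 0]) auto
    then have "(\<beta> - 2) / (\<beta> - 1) / \<beta> ^ Suc n \<le> \<bar>wval \<beta> u - wval \<beta> v\<bar>" using Suc by blast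
    moreover have "(\<beta> - 2) / (\<beta> - 1) / \<beta> ^ Suc (Suc n) \<le> (\<beta> - 2) / (\<beta> - 1) / \<beta> ^ Suc n"
      using assms(1) by (intro divide_left_mono power_increasing mult_pos_pos zero_less_power) auto
    ultimately show ?thesis by linarith
  qed
qed

text \<open>The greedy algorithm: consecutive digits differ by at most 1, and
  \<open>\<beta> \<le> 1 + m\<close> makes the admissible interval at least that long, so the
  remainder never leaves it. The case m = 1 in base 2 gives ordinary binary expansions.\<close>

lemma expansion_exists:
  assumes "1 \<le> m" "m \<le> 2" "1 < \<beta>" "\<beta> \<le> 1 + m" "0 \<le> x" "x \<le> m / (\<beta> - 1)"
  shows "\<exists>v\<in>digseq m. pib \<beta> v = x"
proof -
  define d where "d r = (if \<beta> * r \<ge> m then m else if \<beta> * r \<ge> 1 then 1 else 0)" for r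
  define r where "r = rec_nat x (\<lambda>_ r. \<beta> * r - d r)"
  have r0: "r 0 = x" and rS: "r (Suc n) = \<beta> * r n - d (r n)" for n by (simp_all add: r_def)
  have m1: "1 \<le> m / (\<beta> - 1)" using assms by simp
  have rb: "0 \<le> r n \<and> r n \<le> m / (\<beta> - 1)" for n
  proof (induction n)
    case 0 then show ?case using assms r0 by simp
  next
    case (Suc n)
    have "\<beta> * r n \<le> \<beta> * (m / (\<beta> - 1))" using Suc assms by (intro mult_left_mono) auto
    also have "\<dots> = m / (\<beta> - 1) + m" using assms by (simp add: field_simps)
    finally have "\<beta> * r n - m \<le> m / (\<beta> - 1)" by simp
    moreover have "0 \<le> \<beta> * r n" using Suc assms by simp
    ultimately show ?case unfolding rS d_def using m1 assms(1,2) by (auto simp del: pos_le_divide_eq le_divide_eq_1 intro: order_trans[OF _ m1])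
  qed
  have sum: "(\<Sum>k<n. d (r k) / \<beta> ^ Suc k) = x - r n / \<beta> ^ n" for n
  proof (induction n)
    case (Suc n)
    have "d (r n) / \<beta> ^ Suc n = (\<beta> * r n - r (Suc n)) / \<beta> ^ Suc n" using rS[of n] by simp
    also have "\<dots> = r n / \<beta> ^ n - r (Suc n) / \<beta> ^ Suc n" using assms(3) by (simp add: diff_divide_distrib)
    finally show ?case using Suc by simp
  qed (simp add: r0)
  have "(\<lambda>n. r n / \<beta> ^ n) \<longlonglongrightarrow> 0"
  proof (rule Lim_null_comparison)
    show "\<forall>\<^sub>F n in sequentially. norm (r n / \<beta> ^ n) \<le> m / (\<beta> - 1) * (1 / \<beta>) ^ n"
    proof (intro always_eventually allI)
      fix n
      have "norm (r n / \<beta> ^ n) = r n / \<beta> ^ n" using rb[of n] assms(3) by simp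
      also have "\<dots> \<le> m / (\<beta> - 1) / \<beta> ^ n" using rb[of n] assms(3) by (intro divide_right_mono) auto
      finally show "norm (r n / \<beta> ^ n) \<le> m / (\<beta> - 1) * (1 / \<beta>) ^ n" by (simp add: power_divide)
    qed
    have "(\<lambda>n. m / (\<beta> - 1) * (1 / \<beta>) ^ n) \<longlonglongrightarrow> m / (\<beta> - 1) * 0"
      using assms(3) by (intro tendsto_mult LIMSEQ_power_zero tendsto_const) auto
    then show "(\<lambda>n. m / (\<beta> - 1) * (1 / \<beta>) ^ n) \<longlonglongrightarrow> 0" by simp
  qed
  then have "(\<lambda>n. x - r n / \<beta> ^ n) \<longlonglongrightarrow> x - 0" by (intro tendsto_diff tendsto_const)
  then have "(\<lambda>k. d (r k) / \<beta> ^ Suc k) sums x" unfolding sums_def sum by simp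
  then have "pib \<beta> (\<lambda>k. d (r k)) = x" unfolding pib_def by (simp add: sums_iff)
  moreover have "(\<lambda>k. d (r k)) \<in> digseq m" by (simp add: digseq_def d_def)
  ultimately show ?thesis by blast
qed


subsection \<open>The two families of constraints\<close>

text \<open>A digit 1 in front of x cannot be lowered to 0, because the new remainder would exceed
  the largest value \<open>m / (\<beta> - 1)\<close>. If x is the infimum of an orbit, this is the
  condition that the base exceeds g.\<close>

definition Up :: "real \<Rightarrow> real \<Rightarrow> (nat \<Rightarrow> nat) \<Rightarrow> bool" where
  "Up m \<beta> x \<longleftrightarrow> m < (\<beta> - 1) * (1 + wval \<beta> x)"

text \<open>If x begins with 1, this digit cannot be raised to m. If x is the supremum of an orbit,
  this is the condition that the base exceeds f.\<close>

definition Dn :: "real \<Rightarrow> real \<Rightarrow> (nat \<Rightarrow> nat) \<Rightarrow> bool" where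
  "Dn m \<beta> x \<longleftrightarrow> \<beta> * wval \<beta> x < m"

text \<open>In this form the monotonicity in \<open>\<beta>\<close> becomes visible, as all digits are positive.\<close>

lemma g_equation:
  assumes "1 < \<beta>" "binary x"
  shows "m < (\<beta> - 1) * (1 + wval \<beta> x) \<longleftrightarrow> pib \<beta> (\<lambda>k. m - rw x k) < 1"
    and "m = (\<beta> - 1) * (1 + wval \<beta> x) \<longleftrightarrow> pib \<beta> (\<lambda>k. m - rw x k) = 1"
proof -
  have "pib \<beta> (\<lambda>k. m - rw x k) = m / (\<beta> - 1) - wval \<beta> x"
    by (rule pib_const_minus[of _ _ 1]) (use assms in \<open>auto simp: rw_bound\<close>)
  moreover have *: "m < (\<beta> - 1) * y \<longleftrightarrow> m / (\<beta> - 1) < y" "m = (\<beta> - 1) * y \<longleftrightarrow> m / (\<beta> - 1) = y" for y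
    using assms(1) by (auto simp: pos_divide_less_eq nonzero_divide_eq_eq mult.commute)
  ultimately show "m < (\<beta> - 1) * (1 + wval \<beta> x) \<longleftrightarrow> pib \<beta> (\<lambda>k. m - rw x k) < 1"
    "m = (\<beta> - 1) * (1 + wval \<beta> x) \<longleftrightarrow> pib \<beta> (\<lambda>k. m - rw x k) = 1"
    using * assms(1) by auto
qed

text \<open>With the leading digit split off, the base occurs only in negative powers, which
  exhibits the monotonicity on the side of f.\<close>

lemma f_equation:
  assumes "1 < \<beta>" "binary x" shows "\<beta> * wval \<beta> x = real (x 0) + wval \<beta> (shift 1 x)"
proof -
  obtain c y where e: "x = c ## y" by (rule scons_cases)
  then show ?thesis using assms wval_scons[of \<beta> c y] by simp
qed

text \<open>A weak inequality becomes strict at any larger base, since the digits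
  \<open>m - rw x k\<close> are positive for m > 1.\<close>

lemma Up_less:
  assumes "1 < m" "1 < \<beta>" "\<beta> < \<gamma>" "binary x" "m \<le> (\<beta> - 1) * (1 + wval \<beta> x)" shows "Up m \<gamma> x"
proof -
  have "pib \<gamma> (\<lambda>k. m - rw x k) < pib \<beta> (\<lambda>k. m - rw x k)"
    by (rule pib_strict_antimono[of _ _ _ m 0])
      (use assms rw_bound(2,3)[of x] in \<open>auto intro: less_imp_le le_less_trans\<close>)
  moreover have "pib \<beta> (\<lambda>k. m - rw x k) \<le> 1"
    using g_equation[OF assms(2,4)] assms(5) by (metis le_less less_irrefl)
  ultimately show ?thesis unfolding Up_def using g_equation(1)[of \<gamma> x m] assms by simp
qed

lemma Up_mono: "1 < m \<Longrightarrow> 1 < \<beta> \<Longrightarrow> \<beta> \<le> \<gamma> \<Longrightarrow> binary x \<Longrightarrow> Up m \<beta> x \<Longrightarrow> Up m \<gamma> x"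
  using Up_less[of m \<beta> \<gamma> x] by (cases "\<beta> = \<gamma>") (auto simp: Up_def)

lemma Dn_less:
  assumes "1 < m" "1 < \<beta>" "\<beta> < \<gamma>" "binary x" "\<beta> * wval \<beta> x \<le> m" shows "Dn m \<gamma> x"
proof (cases "\<exists>j. 0 < rw (shift 1 x) j")
  case True
  then obtain j where "0 < rw (shift 1 x) j" by blast
  then have "wval \<gamma> (shift 1 x) < wval \<beta> (shift 1 x)"
    by (rule pib_strict_antimono[of _ _ _ 1 j, rotated 4]) (use assms in \<open>auto simp: rw_bound\<close>)
  then show ?thesis unfolding Dn_def using f_equation[of _ x] assms by simp
next
  case False
  then have "rw (shift 1 x) = (\<lambda>_. 0)" using rw_bound(2)[of "shift 1 x"] by (force simp: le_less)
  then have "wval \<gamma> (shift 1 x) = 0" by (simp add: pib_def)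
  then show ?thesis unfolding Dn_def using f_equation[of \<gamma> x] assms binaryD[of x 0] by auto
qed

lemma Dn_mono: "1 < m \<Longrightarrow> 1 < \<beta> \<Longrightarrow> \<beta> \<le> \<gamma> \<Longrightarrow> binary x \<Longrightarrow> Dn m \<beta> x \<Longrightarrow> Dn m \<gamma> x"
  using Dn_less[of m \<beta> \<gamma> x] by (cases "\<beta> = \<gamma>") (auto simp: Dn_def)

text \<open>Strict inequalities depend only on a finite prefix. The negated versions below start
  from a strict reverse inequality for the same reason: equality would not survive a
  perturbation.\<close>

lemma Up_open:
  assumes "1 < \<beta>" "binary x" "Up m \<beta> x"
  shows "\<exists>N. \<forall>y. binary y \<longrightarrow> agree N x y \<longrightarrow> Up m \<beta> y"
proof -
  let ?e = "1 + wval \<beta> x - m / (\<beta> - 1)"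
  have "m / (\<beta> - 1) < 1 + wval \<beta> x" using assms by (simp add: Up_def field_simps)
  then obtain N where N: "\<And>u v. binary u \<Longrightarrow> binary v \<Longrightarrow> agree N u v \<Longrightarrow> \<bar>wval \<beta> u - wval \<beta> v\<bar> < ?e"
    using wval_continuous[OF assms(1), of ?e] by auto
  have "Up m \<beta> y" if "binary y" "agree N x y" for y
  proof -
    have "m / (\<beta> - 1) < 1 + wval \<beta> y" using N[OF assms(2) that] by linarith
    then show ?thesis using assms(1) by (simp add: Up_def field_simps)
  qed
  then show ?thesis by blast
qed

lemma not_Up_open:
  assumes "1 < \<beta>" "binary x" "(\<beta> - 1) * (1 + wval \<beta> x) < m"
  shows "\<exists>N. \<forall>y. binary y \<longrightarrow> agree N x y \<longrightarrow> \<not> Up m \<beta> y"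
proof -
  let ?e = "m / (\<beta> - 1) - (1 + wval \<beta> x)"
  have "1 + wval \<beta> x < m / (\<beta> - 1)" using assms by (simp add: field_simps)
  then obtain N where N: "\<And>u v. binary u \<Longrightarrow> binary v \<Longrightarrow> agree N u v \<Longrightarrow> \<bar>wval \<beta> u - wval \<beta> v\<bar> < ?e"
    using wval_continuous[OF assms(1), of ?e] by auto
  have "\<not> Up m \<beta> y" if "binary y" "agree N x y" for y
  proof -
    have "1 + wval \<beta> y < m / (\<beta> - 1)" using N[OF assms(2) that] by linarith
    then have "(\<beta> - 1) * (1 + wval \<beta> y) < m" using assms(1) by (simp add: field_simps)
    then show ?thesis by (simp add: Up_def)
  qed
  then show ?thesis by blast
qed

lemma Dn_open:
  assumes "1 < \<beta>" "binary x" "Dn m \<beta> x"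
  shows "\<exists>N. \<forall>y. binary y \<longrightarrow> agree N x y \<longrightarrow> Dn m \<beta> y"
proof -
  let ?e = "m / \<beta> - wval \<beta> x"
  have "wval \<beta> x < m / \<beta>" using assms by (simp add: Dn_def field_simps)
  then obtain N where N: "\<And>u v. binary u \<Longrightarrow> binary v \<Longrightarrow> agree N u v \<Longrightarrow> \<bar>wval \<beta> u - wval \<beta> v\<bar> < ?e"
    using wval_continuous[OF assms(1), of ?e] by auto
  have "Dn m \<beta> y" if "binary y" "agree N x y" for y
  proof -
    have "wval \<beta> y < m / \<beta>" using N[OF assms(2) that] by linarith
    then show ?thesis using assms(1) by (simp add: Dn_def field_simps)
  qed
  then show ?thesis by blast
qed

lemma not_Dn_open:
  assumes "1 < \<beta>" "binary x" "m < \<beta> * wval \<beta> x"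
  shows "\<exists>N. \<forall>y. binary y \<longrightarrow> agree N x y \<longrightarrow> \<not> Dn m \<beta> y"
proof -
  let ?e = "wval \<beta> x - m / \<beta>"
  have "m / \<beta> < wval \<beta> x" using assms by (simp add: field_simps)
  then obtain N where N: "\<And>u v. binary u \<Longrightarrow> binary v \<Longrightarrow> agree N u v \<Longrightarrow> \<bar>wval \<beta> u - wval \<beta> v\<bar> < ?e"
    using wval_continuous[OF assms(1), of ?e] by auto
  have "\<not> Dn m \<beta> y" if "binary y" "agree N x y" for y
  proof -
    have "m / \<beta> < wval \<beta> y" using N[OF assms(2) that] by linarith
    then have "m < \<beta> * wval \<beta> y" using assms(1) by (simp add: field_simps)
    then show ?thesis by (simp add: Dn_def)
  qed
  then show ?thesis by blast
qed

section \<open>Strict comparison of f and g as an open condition\<close>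

lemma wval_isCont: "1 < \<beta> \<Longrightarrow> binary x \<Longrightarrow> isCont (\<lambda>\<beta>. wval \<beta> x) \<beta>"
  by (rule pib_isCont[of _ _ 1]) (auto simp: rw_bound)

lemma less_open_left:
  fixes f :: "real \<Rightarrow> real"
  assumes "isCont f b" "f b < y" "c < b"
  shows "\<exists>b'. c < b' \<and> b' < b \<and> f b' < y"
proof -
  have "(f \<longlongrightarrow> f b) (at_left b)" using assms(1) by (simp add: isCont_def tendsto_within_subset filterlim_at_split)
  then have "\<forall>\<^sub>F x in at_left b. f x < y" using assms(2) by (rule order_tendstoD)
  moreover have "\<forall>\<^sub>F x in at_left b. x \<in> {c<..<b}" using assms(3) by (rule eventually_at_left_real)
  ultimately have "\<forall>\<^sub>F x in at_left b. c < x \<and> x < b \<and> f x < y" by eventually_elim auto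
  then show ?thesis using eventually_happens'[OF trivial_limit_at_left_real] by blast
qed

text \<open>\<open>flt m s i\<close> and \<open>glt m i s\<close> stand for \<open>f(m) < g(m)\<close> and \<open>g(m) < f(m)\<close>, where \<open>s\<close> is the supremum
  and \<open>i\<close> the infimum; they also make sense for the word \<open>s = w10\<close>, for which \<open>f\<close> is not defined.\<close>

definition flt :: "real \<Rightarrow> (nat \<Rightarrow> nat) \<Rightarrow> (nat \<Rightarrow> nat) \<Rightarrow> bool" where
  "flt m s i \<longleftrightarrow> (\<exists>\<beta>>1. Dn m \<beta> s \<and> \<not> Up m \<beta> i)"

definition glt :: "real \<Rightarrow> (nat \<Rightarrow> nat) \<Rightarrow> (nat \<Rightarrow> nat) \<Rightarrow> bool" where
  "glt m i s \<longleftrightarrow> (\<exists>\<beta>>1. Up m \<beta> i \<and> \<not> Dn m \<beta> s)"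

text \<open>Both constraints persist when the base grows, so two witnesses in either order
  contradict each other.\<close>

lemma flt_glt: "1 < m \<Longrightarrow> binary s \<Longrightarrow> binary i \<Longrightarrow> flt m s i \<Longrightarrow> glt m i s \<Longrightarrow> False"
  unfolding flt_def glt_def by (metis Dn_mono Up_mono linear)

text \<open>A witness only gives the weak inequality on the side of g. Decreasing the base slightly
  keeps the strict one for f by continuity and makes the other strict by monotonicity, after which
  both depend on a prefix.\<close>

lemma flt_open:
  assumes "1 < m" "binary s" "binary i" "flt m s i"
  shows "\<exists>N. \<forall>s' i'. binary s' \<longrightarrow> binary i' \<longrightarrow> agree N s s' \<longrightarrow> agree N i i' \<longrightarrow> flt m s' i'"
proof -
  obtain \<beta> where b: "1 < \<beta>" "Dn m \<beta> s" "\<not> Up m \<beta> i" using assms(4) by (auto simp: flt_def)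
  have "isCont (\<lambda>\<beta>. \<beta> * wval \<beta> s) \<beta>" using wval_isCont[OF b(1) assms(2)] by (intro continuous_intros) auto
  then obtain \<gamma> where g: "1 < \<gamma>" "\<gamma> < \<beta>" "\<gamma> * wval \<gamma> s < m"
    using less_open_left[of \<beta> "\<lambda>\<beta>. \<beta> * wval \<beta> s" m 1] b by (auto simp: Dn_def)
  then have "(\<gamma> - 1) * (1 + wval \<gamma> i) < m" using Up_less[of m \<gamma> \<beta> i] assms b by force
  then obtain N1 where N1: "\<And>y. binary y \<Longrightarrow> agree N1 i y \<Longrightarrow> \<not> Up m \<gamma> y"
    using not_Up_open g assms by blast
  obtain N2 where N2: "\<And>y. binary y \<Longrightarrow> agree N2 s y \<Longrightarrow> Dn m \<gamma> y"
    using Dn_open[OF g(1) assms(2)] g(3) Dn_def by blast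
  show ?thesis
  proof (intro exI[of _ "max N1 N2"] allI impI)
    fix s' i' assume "binary s'" "binary i'" "agree (max N1 N2) s s'" "agree (max N1 N2) i i'"
    then have "Dn m \<gamma> s'" "\<not> Up m \<gamma> i'" using N1 N2 agree_mono by (meson max.cobounded1 max.cobounded2)+
    then show "flt m s' i'" using g(1) by (auto simp: flt_def)
  qed
qed

lemma glt_open:
  assumes "1 < m" "binary s" "binary i" "glt m i s"
  shows "\<exists>N. \<forall>s' i'. binary s' \<longrightarrow> binary i' \<longrightarrow> agree N s s' \<longrightarrow> agree N i i' \<longrightarrow> glt m i' s'"
proof -
  obtain \<beta> where b: "1 < \<beta>" "Up m \<beta> i" "\<not> Dn m \<beta> s" using assms(4) by (auto simp: glt_def)
  have "isCont (\<lambda>\<beta>. - ((\<beta> - 1) * (1 + wval \<beta> i))) \<beta>"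
    using wval_isCont[OF b(1) assms(3)] by (intro continuous_intros) auto
  then obtain \<gamma> where g: "1 < \<gamma>" "\<gamma> < \<beta>" "- ((\<gamma> - 1) * (1 + wval \<gamma> i)) < - m"
    using less_open_left[of \<beta> "\<lambda>\<beta>. - ((\<beta> - 1) * (1 + wval \<beta> i))" "- m" 1] b by (auto simp: Up_def)
  then have gU: "Up m \<gamma> i" by (simp add: Up_def)
  have "m < \<gamma> * wval \<gamma> s" using Dn_less[of m \<gamma> \<beta> s] assms b g by force
  then obtain N1 where N1: "\<And>y. binary y \<Longrightarrow> agree N1 s y \<Longrightarrow> \<not> Dn m \<gamma> y"
    using not_Dn_open g assms by blast
  obtain N2 where N2: "\<And>y. binary y \<Longrightarrow> agree N2 i y \<Longrightarrow> Up m \<gamma> y"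
    using Up_open[OF g(1) assms(3) gU] by blast
  show ?thesis
  proof (intro exI[of _ "max N1 N2"] allI impI)
    fix s' i' assume "binary s'" "binary i'" "agree (max N1 N2) s s'" "agree (max N1 N2) i i'"
    then have "Up m \<gamma> i'" "\<not> Dn m \<gamma> s'" using N1 N2 agree_mono by (meson max.cobounded1 max.cobounded2)+
    then show "glt m i' s'" using g(1) by (auto simp: glt_def)
  qed
qed

subsection \<open>Unique expansions\<close>

lemma upc_Up: "2 \<le> \<beta> \<Longrightarrow> upc (Up m \<beta>)"
  unfolding upc_def Up_def
proof (intro allI impI)
  fix x y assume "2 \<le> \<beta>" "binary x" "binary y" "m < (\<beta> - 1) * (1 + wval \<beta> x)" "lex_le x y"
  moreover from this have "(\<beta> - 1) * (1 + wval \<beta> x) \<le> (\<beta> - 1) * (1 + wval \<beta> y)"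
    by (intro mult_left_mono add_left_mono wval_lex_le) auto
  ultimately show "m < (\<beta> - 1) * (1 + wval \<beta> y)" by linarith
qed

lemma dnc_Dn: "2 \<le> \<beta> \<Longrightarrow> dnc (Dn m \<beta>)"
  unfolding dnc_def Dn_def
proof (intro allI impI)
  fix x y assume "2 \<le> \<beta>" "binary x" "binary y" "\<beta> * wval \<beta> y < m" "lex_le x y"
  moreover from this have "\<beta> * wval \<beta> x \<le> \<beta> * wval \<beta> y"
    by (intro mult_left_mono wval_lex_le) auto
  ultimately show "\<beta> * wval \<beta> x < m" by linarith
qed

lemma digseq_bound: "1 < m \<Longrightarrow> v \<in> digseq m \<Longrightarrow> 0 \<le> v k \<and> v k \<le> m"
  unfolding digseq_def by (drule CollectD, drule spec[of _ k]) auto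

lemma Up_less_tail: "1 < \<beta> \<Longrightarrow> Up m \<beta> w \<Longrightarrow> m / (\<beta> - 1) < 1 + wval \<beta> w"
  by (simp add: Up_def pos_divide_less_eq mult.commute)

text \<open>Only the first digit that differs matters. Raising 0 fails because the remainder is
  below 1, raising 1 to m fails by \<open>Dn\<close>, and lowering 1 to 0 fails by
  \<open>Up\<close>.\<close>

lemma Om_in_Ub:
  assumes m: "1 < m" "m \<le> 2" and b: "2 < \<beta>" and u: "u \<in> Om (Up m \<beta>) (Dn m \<beta>)"
  shows "rw u \<in> Ub \<beta> m"
proof -
  have ne: "wval \<beta> u \<noteq> pib \<beta> v"
    if "u \<in> Om (Up m \<beta>) (Dn m \<beta>)" "v \<in> digseq m" "\<forall>i<n. rw u i = v i" "rw u n \<noteq> v n" for u v n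
    using that
  proof (induction n arbitrary: u v)
    case 0
    obtain c w where e: "u = c ## w" by (rule scons_cases)
    have w: "w \<in> Om (Up m \<beta>) (Dn m \<beta>)" using 0(1) Om_tail e tail_sconsI tail_refl by blast
    have bu: "binary u" "binary w" using Om_binary 0(1) w by auto
    have v: "0 \<le> v k \<and> v k \<le> m" for k using digseq_bound m 0(2) by blast
    let ?t = "pib \<beta> (\<lambda>k. v (Suc k))"
    have pv: "pib \<beta> v = (v 0 + ?t) / \<beta>"
      by (rule pib_split[of _ _ m]) (use b v in auto)
    have t: "0 \<le> ?t" "?t \<le> m / (\<beta> - 1)"
      using pib_nonneg[of \<beta> "\<lambda>k. v (Suc k)" m] pib_mono[of \<beta> "\<lambda>k. v (Suc k)" m "\<lambda>_. m"]
        pib_const[of \<beta> m] v b m by auto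
    have pu: "wval \<beta> u = (real c + wval \<beta> w) / \<beta>" using wval_scons e bu b by simp
    have v0: "v 0 \<in> {0,1,m}" using 0(2) by (simp add: digseq_def)
    have c: "rw u 0 = real c" using e by (simp add: rw_def)
    have "real c + wval \<beta> w \<noteq> v 0 + ?t"
    proof (cases "c = 0")
      case True
      \<comment> \<open>\<open>Dn\<close> at the tail w gives the bound m, and m is at most 2, hence
        below the base.\<close>
      have "\<beta> * wval \<beta> w < \<beta> * 1" using OmD[OF w] m b unfolding Dn_def by linarith
      then have "wval \<beta> w < 1" using b by (subst (asm) mult_less_cancel_left_pos) auto
      moreover have "1 \<le> v 0" using v0 0(4) c True m by auto
      ultimately show ?thesis using t True by simp
    next
      case False
      then have c1: "c = 1" using bu e by auto
      have "\<beta> * wval \<beta> u < m" using OmD[OF 0(1)] by (simp add: Dn_def)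
      then have "1 + wval \<beta> w < m" using pu c1 b by simp
      moreover have "m / (\<beta> - 1) < 1 + wval \<beta> w" using Up_less_tail OmU[OF w] b by simp
      moreover have "v 0 = 0 \<or> v 0 = m" using v0 0(4) c c1 by auto
      ultimately show ?thesis using t c1 by auto
    qed
    then show ?case using pu pv b by simp
  next
    case (Suc n)
    obtain c w where e: "u = c ## w" by (rule scons_cases)
    have w: "w \<in> Om (Up m \<beta>) (Dn m \<beta>)" using Suc.prems(1) Om_tail e tail_sconsI tail_refl by blast
    have v: "0 \<le> v k \<and> v k \<le> m" for k using digseq_bound m Suc.prems(2) by blast
    have pv: "pib \<beta> v = (v 0 + pib \<beta> (\<lambda>k. v (Suc k))) / \<beta>"
      by (rule pib_split[of _ _ m]) (use b v in auto)
    have pu: "wval \<beta> u = (real c + wval \<beta> w) / \<beta>" using wval_scons e Om_binary[OF Suc.prems(1)] b by simp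
    have s: "rw u (Suc i) = rw w i" for i using e by (simp add: rw_def)
    have "wval \<beta> w \<noteq> pib \<beta> (\<lambda>k. v (Suc k))"
    proof (rule Suc.IH[OF w])
      show "(\<lambda>k. v (Suc k)) \<in> digseq m" using Suc.prems(2) by (simp add: digseq_def)
      show "\<forall>i<n. rw w i = v (Suc i)" using Suc.prems(3) s by auto
      show "rw w n \<noteq> v (Suc n)" using Suc.prems(4) s by auto
    qed
    moreover have "v 0 = real c" using Suc.prems(3) e by (auto simp: rw_def)
    ultimately show ?case using pu pv b by simp
  qed
  have "wval \<beta> u \<noteq> pib \<beta> v" if v: "v \<in> digseq m - {rw u}" for v
  proof -
    have ex: "\<exists>n. rw u n \<noteq> v n"
    proof (rule ccontr)
      assume "\<nexists>n. rw u n \<noteq> v n"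
      then have "rw u = v" by auto
      then show False using v by blast
    qed
    show ?thesis
    proof (rule ne[OF u, of v "LEAST n. rw u n \<noteq> v n"])
      show "rw u (LEAST n. rw u n \<noteq> v n) \<noteq> v (LEAST n. rw u n \<noteq> v n)" using LeastI_ex[OF ex] .
      show "\<forall>i<LEAST n. rw u n \<noteq> v n. rw u i = v i" using not_less_Least by blast
    qed (use v in auto)
  qed
  moreover have "rw u \<in> digseq m"
    unfolding digseq_def
  proof (intro CollectI allI)
    show "rw u k \<in> {0, 1, m}" for k using binaryD[OF Om_binary[OF u], of k] by (auto simp: rw_def)
  qed
  ultimately show ?thesis by (auto simp: Ub_def)
qed

lemma pib_cong_from:
  assumes "1 < \<beta>" "\<And>k. \<bar>c k\<bar> \<le> B" "\<And>k. \<bar>d k\<bar> \<le> B" "\<And>i. i < k \<Longrightarrow> c i = d i"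
    and "pib \<beta> (\<lambda>i. c (k + i)) = pib \<beta> (\<lambda>i. d (k + i))"
  shows "pib \<beta> c = pib \<beta> d"
  using assms(2-)
proof (induction k arbitrary: c d)
  case (Suc k)
  have "pib \<beta> (\<lambda>i. c (Suc i)) = pib \<beta> (\<lambda>i. d (Suc i))"
    by (rule Suc.IH) (use Suc.prems in auto)
  then show ?case
    using pib_split[OF assms(1), of c B] pib_split[OF assms(1), of d B] Suc.prems by simp
qed simp

text \<open>If the remainder left by the digit d lies in the admissible interval, the greedy
  algorithm completes it to a second expansion of the same number.\<close>

lemma Ub_no_replacement:
  assumes m: "1 < m" "m \<le> 2" and b: "1 < \<beta>" "\<beta> \<le> 1 + m" and x: "binary x" "rw x \<in> Ub \<beta> m"
    and d: "d \<in> {0, 1, m}" "d \<noteq> real (x k)"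
    and y: "0 \<le> real (x k) + wval \<beta> (shift (Suc k) x) - d" "real (x k) + wval \<beta> (shift (Suc k) x) - d \<le> m / (\<beta> - 1)"
  shows False
proof -
  obtain v where v: "v \<in> digseq m" "pib \<beta> v = real (x k) + wval \<beta> (shift (Suc k) x) - d"
    using expansion_exists[OF _ m(2) b y] m(1) by auto
  define w where "w = (\<lambda>i. if i < k then rw x i else if i = k then d else v (i - Suc k))"
  have xd: "rw x i \<in> {0,1,m}" for i using binaryD[OF x(1), of i] by (auto simp: rw_def)
  have w: "w \<in> digseq m" unfolding digseq_def w_def using xd d v(1) by (auto simp: digseq_def)
  have wb: "\<bar>w i\<bar> \<le> m" "\<bar>rw x i\<bar> \<le> m" for i
    using digseq_bound[OF m(1) w, of i] xd[of i] m by auto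
  have "pib \<beta> w = wval \<beta> x"
  proof (rule pib_cong_from[OF b(1) wb])
    show "i < k \<Longrightarrow> w i = rw x i" for i by (simp add: w_def)
    have "pib \<beta> (\<lambda>i. w (k + i)) = (w k + pib \<beta> (\<lambda>i. w (k + Suc i))) / \<beta>"
      using pib_split[OF b(1), of "\<lambda>i. w (k + i)" m] wb by simp
    also have "(\<lambda>i. w (k + Suc i)) = v" by (auto simp: w_def)
    also have "w k = d" by (simp add: w_def)
    also have "(d + pib \<beta> v) / \<beta> = (rw x k + wval \<beta> (shift (Suc k) x)) / \<beta>"
      using v(2) by (simp add: rw_def)
    also have "\<dots> = pib \<beta> (\<lambda>i. rw x (k + i))"
      using pib_split[OF b(1), of "\<lambda>i. rw x (k + i)" m] wb by (simp add: rw_def shift_def)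
    finally show "pib \<beta> (\<lambda>i. w (k + i)) = pib \<beta> (\<lambda>i. rw x (k + i))" .
  qed
  moreover have "w \<noteq> rw x" using d(2) by (auto simp: w_def rw_def fun_eq_iff intro!: exI[of _ k])
  ultimately show False using x(2) w unfolding Ub_def by (metis (mono_tags, lifting) DiffI mem_Collect_eq singletonD)
qed

lemma Ub_tails:
  assumes m: "1 < m" "m \<le> 2" and b: "1 < \<beta>" "\<beta> \<le> 1 + m" and x: "binary x" "rw x \<in> Ub \<beta> m"
  shows "x k = 0 \<Longrightarrow> wval \<beta> (shift (Suc k) x) < 1"
    and "x k = 1 \<Longrightarrow> 1 + wval \<beta> (shift (Suc k) x) < m"
    and "x k = 1 \<Longrightarrow> m / (\<beta> - 1) < 1 + wval \<beta> (shift (Suc k) x)"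
proof -
  let ?t = "wval \<beta> (shift (Suc k) x)"
  have t: "0 \<le> ?t" "?t \<le> 1 / (\<beta> - 1)" using wval_nonneg wval_le b x by auto
  have le: "1 / (\<beta> - 1) \<le> m / (\<beta> - 1)" using m b by (intro divide_right_mono) auto
  note no = Ub_no_replacement[OF m b x, of _ k]
  show "?t < 1" if "x k = 0" using no[of 1] that t le by force
  show "1 + ?t < m" if "x k = 1" using no[of m] that t le m by force
  show "m / (\<beta> - 1) < 1 + ?t" if "x k = 1" using no[of 0] that t le m by force
qed

text \<open>Apart from the zero word, every word considered has a tail in the set cut out by the two
  bounds: behind a 1 the lower bound is given by uniqueness, and it propagates over prepended
  zeros.\<close>

lemma countable_Ub:
  assumes m: "1 < m" "m \<le> 2" and b: "1 < \<beta>" "\<beta> \<le> 1 + m"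
    and c: "2 < \<beta> \<Longrightarrow> countable (Om (Up m \<beta>) (Dn m \<beta>))"
  shows "countable (Ub \<beta> m \<inter> {u. \<forall>k. u k \<in> {0, 1}})"
proof -
  let ?O = "if 2 < \<beta> then Om (Up m \<beta>) (Dn m \<beta>) else {}"
  have "Ub \<beta> m \<inter> {u. \<forall>k. u k \<in> {0, 1}} \<subseteq> rw ` ({z0} \<union> {x. \<exists>v\<in>?O. tail x v})"
  proof
    fix u assume u: "u \<in> Ub \<beta> m \<inter> {u. \<forall>k. u k \<in> {0, 1}}"
    define x where "x = (\<lambda>k. if u k = 0 then 0 else 1 :: nat)"
    have x: "binary x" by (simp add: x_def binary_def)
    have "rw x k = u k" for k
    proof -
      have "u k = 0 \<or> u k = 1" using u by blast
      then show ?thesis by (auto simp: x_def rw_def)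
    qed
    then have ux: "u = rw x" by auto
    then have xU: "rw x \<in> Ub \<beta> m" using u by simp
    note T = Ub_tails[OF m b x xU]
    have "x = z0 \<or> (\<exists>v\<in>?O. tail x v)"
    proof (cases "\<exists>k. x k = 1")
      case False
      then show ?thesis using binaryD[OF x] by (auto simp: z0_def fun_eq_iff)
    next
      case True
      then obtain k where k: "x k = 1" by blast
      \<comment> \<open>The two conditions behind a digit 1 leave a nonempty gap between
        \<open>m / (\<beta> - 1)\<close> and m; this is what forces the base above 2.\<close>
      have "m / (\<beta> - 1) < m" using T(2,3)[OF k] by linarith
      then have "m * 1 < m * (\<beta> - 1)" using b by (simp add: pos_divide_less_eq)
      then have b2: "2 < \<beta>" using m by (subst (asm) mult_less_cancel_left_pos) auto
      have D: "Dn m \<beta> v" if "tail x v" for v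
      proof -
        obtain j where j: "v = shift j x" using \<open>tail x v\<close> by (auto simp: tail_def)
        have "\<beta> * wval \<beta> v = real (x j) + wval \<beta> (shift (Suc j) x)"
          unfolding j using f_equation[of \<beta> "shift j x"] b x by (simp add: shift_apply)
        then show ?thesis unfolding Dn_def using T(1,2)[of j] binaryD[OF x, of j] m by auto
      qed
      have U1: "Up m \<beta> v" if "tail x (1 ## v)" for v
      proof -
        obtain j where j: "shift j x = 1 ## v" using \<open>tail x (1 ## v)\<close> by (auto simp: tail_def)
        then have "x j = 1" "shift (Suc j) x = v" using shift_unfold[of j x] by auto
        then have "m / (\<beta> - 1) < 1 + wval \<beta> v" using T(3)[of j] by simp
        then show ?thesis using b by (simp add: Up_def pos_divide_less_eq mult.commute)
      qed
      let ?w = "shift k x"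
      have w: "tail x ?w" "binary ?w" "?w 0 = 1" using k x by (auto simp: tail_shift shift_apply)
      have "shift (Suc k) x \<in> Om (Up m \<beta>) (Dn m \<beta>)"
        unfolding Om_def
      proof (intro CollectI conjI allI impI)
        fix v assume v: "tail (shift (Suc k) x) v"
        then obtain j where j: "v = shift (Suc j) ?w" by (auto simp: tail_def)
        show "Up m \<beta> v" unfolding j
        proof (rule upc_after_one[OF upc_Up w(2,3)])
          show "Up m \<beta> y" if "tail ?w (1 ## y)" for y using U1 tail_trans[OF w(1) that] by blast
        qed (use b2 in simp)
        show "Dn m \<beta> v" using D tail_trans[OF tail_shift v] by blast
      qed (use x in simp)
      then show ?thesis using b2 tail_shift by auto
    qed
    then show "u \<in> rw ` ({z0} \<union> {x. \<exists>v\<in>?O. tail x v})" using ux by blast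
  qed
  moreover have "countable ?O" using c by simp
  then have "countable (rw ` ({z0} \<union> {x. \<exists>v\<in>?O. tail x v}))"
    using countable_eventually by (intro countable_image countable_Un) auto
  ultimately show ?thesis by (rule countable_subset)
qed

text \<open>Beyond 1 + m the factor \<open>\<beta> - 1\<close> alone exceeds m. The bound is the one
  under which greedy expansions exist.\<close>

lemma not_Up_base: assumes "1 < m" "1 < \<beta>" "binary x" "\<not> Up m \<beta> x" shows "\<beta> \<le> 1 + m"
proof (rule ccontr)
  assume h: "\<not> \<beta> \<le> 1 + m"
  have "(\<beta> - 1) * 1 \<le> (\<beta> - 1) * (1 + wval \<beta> x)"
    using wval_nonneg[of \<beta> x] assms by (intro mult_left_mono) auto
  then show False using h assms(4) by (simp add: Up_def)
qed

text \<open>Since \<open>w10\<close> is the least word beginning with 1, its violation forbids the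
  letter 1 after renormalisation and only \<open>z0\<close> can remain. The same two violations
  carry the countability back to the original set.\<close>

lemma countable_low0:
  assumes m: "1 < m" "m \<le> 2" and b: "1 < \<beta>" "\<not> Up m \<beta> (los \<tau> z0)" "\<not> Dn m \<beta> (his \<tau> w10)"
  shows "countable (Ub \<beta> m \<inter> {u. \<forall>k. u k \<in> {0, 1}})"
proof (rule countable_Ub[OF m b(1) not_Up_base[OF m(1) b(1) _ b(2)]])
  assume b2: "2 < \<beta>"
  have U: "upc (Up m \<beta>)" and D: "dnc (Dn m \<beta>)" using upc_Up dnc_Dn b2 by auto
  have "Om (\<lambda>x. Up m \<beta> (los \<tau> x)) (\<lambda>x. Dn m \<beta> (his \<tau> x)) \<subseteq> {z0}"
  proof
    fix u assume u: "u \<in> Om (\<lambda>x. Up m \<beta> (los \<tau> x)) (\<lambda>x. Dn m \<beta> (his \<tau> x))"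
    have "v 0 = 0" if v: "tail u v" for v
    proof (rule ccontr)
      assume h: "v 0 \<noteq> 0"
      have bv: "binary v" using tail_binary[OF v] Om_binary[OF u] by blast
      then obtain w where "v = 1 ## w" "binary w" using h by (cases rule: binary_cases) auto
      then have "lex_le w10 v" by (simp add: w10_eq)
      then have "lex_le (his \<tau> w10) (his \<tau> v)" using his_lex_le bv by simp
      moreover have "Dn m \<beta> (his \<tau> v)" using OmD[OF Om_tail[OF u v]] .
      ultimately have "Dn m \<beta> (his \<tau> w10)" using dncD[OF D] bv by (meson binary_his binary_zs)
      then show False using b by blast
    qed
    then show "u \<in> {z0}" using const_word[OF Om_binary[OF u]] by (simp add: z0_def)
  qed
  then have "countable (Om (\<lambda>x. Up m \<beta> (los \<tau> x)) (\<lambda>x. Dn m \<beta> (his \<tau> x)))"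
    by (rule countable_subset) simp
  then show "countable (Om (Up m \<beta>) (Dn m \<beta>))"
    by (rule countable_Om[OF U D b(2) b(3), rotated 2]) simp_all
qed simp

text \<open>Dually, \<open>w01\<close> is the greatest word beginning with 0, so its violation
  leaves at most \<open>z1\<close>.\<close>

lemma countable_low1:
  assumes m: "1 < m" "m \<le> 2" and b: "1 < \<beta>" "\<not> Up m \<beta> (los \<tau> w01)"
    and d: "\<tau> \<noteq> [] \<Longrightarrow> \<not> Dn m \<beta> (his \<tau> z1)"
  shows "countable (Ub \<beta> m \<inter> {u. \<forall>k. u k \<in> {0, 1}})"
proof (rule countable_Ub[OF m b(1) not_Up_base[OF m(1) b(1) _ b(2)]])
  assume b2: "2 < \<beta>"
  have U: "upc (Up m \<beta>)" and D: "dnc (Dn m \<beta>)" using upc_Up dnc_Dn b2 by auto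
  have "Om (\<lambda>x. Up m \<beta> (los \<tau> x)) (\<lambda>x. Dn m \<beta> (his \<tau> x)) \<subseteq> {z1}"
  proof
    fix u assume u: "u \<in> Om (\<lambda>x. Up m \<beta> (los \<tau> x)) (\<lambda>x. Dn m \<beta> (his \<tau> x))"
    have "v 0 = 1" if v: "tail u v" for v
    proof (rule ccontr)
      assume h: "v 0 \<noteq> 1"
      have bv: "binary v" using tail_binary[OF v] Om_binary[OF u] by blast
      then obtain w where "v = 0 ## w" "binary w" using h by (cases rule: binary_cases) auto
      then have "lex_le v w01" by (simp add: w01_eq)
      then have "lex_le (los \<tau> v) (los \<tau> w01)" using los_lex_le bv by simp
      moreover have "Up m \<beta> (los \<tau> v)" using OmU[OF Om_tail[OF u v]] .
      ultimately have "Up m \<beta> (los \<tau> w01)" using upcD[OF U] bv by (meson binary_los binary_zs)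
      then show False using b by blast
    qed
    then show "u \<in> {z1}" using const_word[OF Om_binary[OF u]] by (simp add: z1_def)
  qed
  then have "countable (Om (\<lambda>x. Up m \<beta> (los \<tau> x)) (\<lambda>x. Dn m \<beta> (his \<tau> x)))"
    by (rule countable_subset) simp
  then show "countable (Om (Up m \<beta>) (Dn m \<beta>))"
    by (rule countable_Om[OF U D b(2) d, rotated 3]) simp_all
qed simp

subsection \<open>Positive dimension\<close>

lemma binary_expansion_exists: assumes "0 \<le> y" "y \<le> 1" shows "\<exists>x. binary x \<and> wval 2 x = y"
proof -
  obtain v where v: "v \<in> digseq 1" "pib 2 v = y" using expansion_exists[of 1 2 y] assms by auto
  define x where "x = (\<lambda>k. if v k = 0 then 0 else 1 :: nat)"
  have "rw x k = v k" for k
  proof -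
    have "v k = 0 \<or> v k = 1" using v(1) by (auto simp: digseq_def)
    then show ?thesis by (auto simp: x_def rw_def)
  qed
  then have "rw x = v" by auto
  moreover have "binary x" by (simp add: x_def binary_def)
  ultimately show ?thesis using v(2) by auto
qed

text \<open>By the separation, \<open>wval 2 x\<close> is a Hoelder function of \<open>p x\<close>.
  A cover of A turns into intervals that cover [0,1], so the corresponding power sums of diameters
  cannot be small.\<close>

lemma hausdorff_dim_pos:
  fixes A :: "real set" and p :: "(nat \<Rightarrow> nat) \<Rightarrow> real"
  assumes p: "\<And>x. binary x \<Longrightarrow> p x \<in> A"
    and sep: "\<And>x y n. binary x \<Longrightarrow> binary y \<Longrightarrow> \<exists>i\<le>n. x i \<noteq> y i \<Longrightarrow> c * q ^ n \<le> \<bar>p x - p y\<bar>"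
    and c: "0 < c" and q: "0 < q" "q < 1"
  shows "hausdorff_dim A > 0"
proof -
  \<comment> \<open>The exponent is chosen so that the separation scale \<open>q ^ n\<close> becomes
    \<open>(1 / 2) ^ n\<close>, the scale of binary expansions.\<close>
  define \<alpha> where "\<alpha> = ln 2 / - ln q"
  have a0: "0 < \<alpha>" unfolding \<alpha>_def using q by (intro divide_pos_pos) auto
  have qa: "(q ^ n) powr \<alpha> = (1 / 2) ^ n" for n
  proof -
    have "ln q < 0" using q by simp
    have "(q ^ n) powr \<alpha> = exp (real n * (- ln 2))"
      using q \<open>ln q < 0\<close> by (simp add: powr_def ln_realpow \<alpha>_def field_simps)
    also have "\<dots> = exp (- ln 2) ^ n" by (rule exp_of_nat_mult)
    also have "exp (- ln 2 :: real) = 1 / 2" by (simp add: exp_minus)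
    finally show ?thesis .
  qed
  define K where "K = (1 / c) powr \<alpha>"
  have K: "0 < K" using c by (simp add: K_def)
  have hoelder: "\<bar>wval 2 x - wval 2 y\<bar> \<le> K * \<bar>p x - p y\<bar> powr \<alpha>" if b: "binary x" "binary y" for x y
  proof (cases "x = y")
    case False
    then have ex: "\<exists>n. x n \<noteq> y n" by auto
    define n where "n = (LEAST n. x n \<noteq> y n)"
    have n: "x n \<noteq> y n" unfolding n_def using LeastI_ex[OF ex] .
    have "agree n x y" unfolding agree_def n_def using not_less_Least by blast
    then have "\<bar>wval 2 x - wval 2 y\<bar> \<le> (1 / 2) ^ n" using wval_agree[of 2 x y n] b by (simp add: power_divide)
    also have "\<dots> = (q ^ n) powr \<alpha>" using qa by simp
    also have "\<dots> \<le> (1 / c * \<bar>p x - p y\<bar>) powr \<alpha>"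
    proof (rule powr_mono2)
      have "c * q ^ n \<le> \<bar>p x - p y\<bar>" using sep[OF b] n by blast
      then show "q ^ n \<le> 1 / c * \<bar>p x - p y\<bar>" using c by (simp add: field_simps)
    qed (use a0 q in auto)
    also have "\<dots> = K * \<bar>p x - p y\<bar> powr \<alpha>" unfolding K_def by (rule powr_mult)
    finally show ?thesis .
  qed simp
  have main: "\<alpha> \<le> s" if s: "0 \<le> s" "hausdorff_measure s A = 0" for s
  proof (rule ccontr)
    assume sa: "\<not> \<alpha> \<le> s"
    \<comment> \<open>With diameters at most 1, powers with the smaller exponent s dominate those
      with \<open>\<alpha>\<close>. The 2 comes from intervals that extend to both sides of their
      centre.\<close>
    have "ennreal (1 / (2 * K)) \<le> hcontent s 1 A"
      unfolding hcontent_def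
    proof (rule INF_greatest)
      fix C :: "nat \<Rightarrow> real set"
      assume "C \<in> {C. A \<subseteq> (\<Union>i. C i) \<and> (\<forall>i. bounded (C i) \<and> diameter (C i) \<le> 1)}"
      then have C: "A \<subseteq> (\<Union>i. C i)" "\<And>i. bounded (C i)" "\<And>i. diameter (C i) \<le> 1" by auto
      let ?ex = "\<lambda>i. \<exists>x. binary x \<and> p x \<in> C i"
      define z where "z i = (SOME x. binary x \<and> p x \<in> C i)" for i
      have z: "binary (z i) \<and> p (z i) \<in> C i" if "?ex i" for i
        unfolding z_def using someI_ex[OF that] .
      let ?d = "\<lambda>i. K * diameter (C i) powr \<alpha>"
      \<comment> \<open>The centre is the binary value of one chosen word whose image lies in
        \<open>C i\<close>; the radius is the Hoelder bound for the diameter of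
        \<open>C i\<close>.\<close>
      define E where "E i = (if ?ex i then {wval 2 (z i) - ?d i .. wval 2 (z i) + ?d i} else {})" for i
      have cover: "{0..1} \<subseteq> (\<Union>i. E i)"
      proof
        fix y :: real assume "y \<in> {0..1}"
        then obtain x where x: "binary x" "wval 2 x = y" using binary_expansion_exists by auto
        then obtain i where i: "p x \<in> C i" using p[OF x(1)] C(1) by blast
        then have zi: "binary (z i)" "p (z i) \<in> C i" using z x(1) by blast+
        have "\<bar>p x - p (z i)\<bar> \<le> diameter (C i)"
          using diameter_bounded_bound[OF C(2) i zi(2)] by (simp add: dist_real_def)
        then have "K * \<bar>p x - p (z i)\<bar> powr \<alpha> \<le> ?d i" using K a0 by (intro mult_left_mono powr_mono2) auto
        then have "\<bar>y - wval 2 (z i)\<bar> \<le> ?d i" using hoelder[OF x(1) zi(1)] x(2) by linarith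
        then have "y \<in> E i" unfolding E_def using i x(1) by (auto simp: abs_le_iff)
        then show "y \<in> (\<Union>i. E i)" by blast
      qed
      have Em: "E i \<in> sets lborel" for i by (simp add: E_def)
      have El: "emeasure lborel (E i) \<le> ennreal (2 * K) * ennreal (diam_pow s (C i))" for i
      proof (cases "?ex i")
        case True
        then have ne: "C i \<noteq> {}" by blast
        have d0: "0 \<le> diameter (C i)" using C(2) by (rule diameter_ge_0)
        have "diameter (C i) powr \<alpha> \<le> diam_pow s (C i)"
        proof (cases "s = 0")
          case True then show ?thesis using ne d0 C(3)[of i] a0 by (simp add: diam_pow_def powr_le1)
        next
          case False then show ?thesis using ne d0 C(3)[of i] sa by (simp add: diam_pow_def powr_mono')
        qed
        then have "2 * ?d i \<le> 2 * K * diam_pow s (C i)" using K by simp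
        moreover have "0 \<le> ?d i" using K by simp
        then have "emeasure lborel (E i) = ennreal (2 * ?d i)"
          unfolding E_def using True by (simp add: algebra_simps)
        ultimately show ?thesis using K by (simp add: ennreal_mult'[symmetric] ennreal_leI)
      next
        case False
        then have "E i = {}" unfolding E_def by (rule if_not_P)
        then show ?thesis by simp
      qed
      have "1 = emeasure lborel {0..1::real}" by simp
      also have "\<dots> \<le> emeasure lborel (\<Union>i. E i)" using cover Em by (intro emeasure_mono) auto
      also have "\<dots> \<le> (\<Sum>i. emeasure lborel (E i))" using Em by (intro emeasure_subadditive_countably) auto
      also have "\<dots> \<le> (\<Sum>i. ennreal (2 * K) * ennreal (diam_pow s (C i)))" by (intro suminf_le El) auto
      also have "\<dots> = ennreal (2 * K) * (\<Sum>i. ennreal (diam_pow s (C i)))" by (rule ennreal_suminf_cmult)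
      finally have *: "1 \<le> ennreal (2 * K) * (\<Sum>i. ennreal (diam_pow s (C i)))" .
      have "ennreal (1 / (2 * K)) * 1 \<le> ennreal (1 / (2 * K)) * (ennreal (2 * K) * (\<Sum>i. ennreal (diam_pow s (C i))))"
        by (intro mult_left_mono *) simp
      also have "\<dots> = (ennreal (1 / (2 * K)) * ennreal (2 * K)) * (\<Sum>i. ennreal (diam_pow s (C i)))"
        by (simp only: mult.assoc)
      also have "ennreal (1 / (2 * K)) * ennreal (2 * K) = 1" using K by (simp add: ennreal_mult'[symmetric])
      finally show "ennreal (1 / (2 * K)) \<le> (\<Sum>i. ennreal (diam_pow s (C i)))" by simp
    qed
    also have "hcontent s 1 A \<le> hausdorff_measure s A"
      unfolding hausdorff_measure_def by (rule SUP_upper) simp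
    finally show False using s(2) K by simp
  qed
  have "ereal \<alpha> \<le> hausdorff_dim A"
    unfolding hausdorff_dim_def by (rule Inf_greatest) (use main in auto)
  then show ?thesis using a0 by (metis ereal_less(2) less_le_trans)
qed

text \<open>By \<open>subst_sep\<close>, position j turns into at most 2j + 1, so the number of
  letters to be read at most doubles with each substitution.\<close>

lemma apply_sep:
  assumes "\<exists>i\<le>n. x i \<noteq> y i" "binary x" "binary y"
  shows "\<exists>j. Suc j \<le> 2 ^ length \<tau> * Suc n \<and> apply_inf \<tau> x j \<noteq> apply_inf \<tau> y j"
proof (induction \<tau>)
  case Nil
  then show ?case using assms(1) by auto
next
  case (Cons s \<tau>)
  then obtain j where j: "Suc j \<le> 2 ^ length \<tau> * Suc n" "apply_inf \<tau> x j \<noteq> apply_inf \<tau> y j" by blast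
  then have "\<exists>i\<le>j. apply_inf \<tau> x i \<noteq> apply_inf \<tau> y i" by blast
  then obtain k where "k \<le> 2 * j + 1" "subst_inf s (apply_inf \<tau> x) k \<noteq> subst_inf s (apply_inf \<tau> y) k"
    using subst_sep assms binary_apply by blast
  then show ?case using j by (intro exI[of _ k]) auto
qed

text \<open>The image of 1 contains a 1 directly before \<open>lo s v\<close>; under
  \<open>M\<close> this uses the 0 which \<open>lo M\<close> puts in front.\<close>

lemma subst_tail_one: "tail u (1 ## v) \<Longrightarrow> tail (subst_inf s u) (1 ## lo s v)"
  by (drule subst_tail[of _ _ s], cases s) (auto intro: tail_sconsI)

lemma subst_tail_zero:
  assumes "tail u (0 ## v)" "v 0 = 1" "binary v" shows "tail (subst_inf s u) (0 ## hi s v)"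
proof (cases s)
  case L
  obtain w where "v = 1 ## w" using scons_hd[OF assms(2,3)] by blast
  then show ?thesis using subst_tail[OF assms(1), of s] L by (auto intro: tail_sconsI)
qed (use subst_tail[OF assms(1), of s] in auto)

text \<open>The words \<open>z0\<close> and \<open>z1\<close> are the extremes of the full shift. If
  their bounds hold at level \<open>\<rho>\<close>, the image of every binary word is admissible,
  and these images are separated exponentially.\<close>

lemma dimension_pos:
  assumes m: "1 < m" "m \<le> 2" and b: "1 < \<beta>" and U: "Up m \<beta> (los \<rho> z0)" and D: "Dn m \<beta> (his \<rho> z1)"
  shows "2 < \<beta>" "uncountable (Ub \<beta> m \<inter> {u. \<forall>k. u k \<in> {0, 1}})" "hausdorff_dim (pib \<beta> ` Ub \<beta> m) > 0"
proof -
  have Om: "apply_inf \<rho> x \<in> Om (Up m \<gamma>) (Dn m \<gamma>)" if g: "2 \<le> \<gamma>" "\<beta> \<le> \<gamma>" and x: "binary x" for \<gamma> x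
  proof (rule apply_in_Om[OF upc_Up[OF g(1)] dnc_Dn[OF g(1)]])
    have "Up m \<gamma> (los \<rho> z0)" "Dn m \<gamma> (his \<rho> z1)"
      using Up_mono[OF m(1) b g(2) _ U] Dn_mono[OF m(1) b g(2) _ D] by auto
    then show "x \<in> Om (\<lambda>x. Up m \<gamma> (los \<rho> x)) (\<lambda>x. Dn m \<gamma> (his \<rho> x))"
      unfolding Om_def
      using x los_lex_le[OF z0_lex_le] his_lex_le[OF lex_le_z1] upcD[OF upc_Up[OF g(1)]] dncD[OF dnc_Dn[OF g(1)]]
        tail_binary by (auto simp del: One_nat_def)
  qed
  \<comment> \<open>Otherwise the bounds persist up to base 2, where order arguments are available.
    There an admissible word \<open>1 ## v\<close> would give m < 1 + \<open>wval 2 v\<close> by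
    \<open>Up\<close> and the reverse by \<open>Dn\<close>.\<close>
  show b2: "2 < \<beta>"
  proof (rule ccontr)
    assume "\<not> 2 < \<beta>"
    then have u: "apply_inf \<rho> z1 \<in> Om (Up m 2) (Dn m 2)" using Om[of 2 z1] by simp
    have "\<exists>v. tail (apply_inf \<rho> z1) (1 ## v)"
    proof (induction \<rho>)
      case Nil
      have "tail z1 (1 ## z1)" using z1_unfold tail_refl by metis
      then show ?case by auto
    next
      case (Cons s \<rho>) then show ?case using subst_tail_one by fastforce
    qed
    then obtain v where "tail (apply_inf \<rho> z1) (1 ## v)" by blast
    then have v: "1 ## v \<in> Om (Up m 2) (Dn m 2)" using Om_tail[OF u] by blast
    then have "v \<in> Om (Up m 2) (Dn m 2)" using Om_tail tail_sconsI tail_refl by blast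
    then have "m < 1 + wval 2 v" using OmU by (fastforce simp: Up_def)
    moreover have "2 * wval 2 (1 ## v) < m" using OmD[OF v] by (simp add: Dn_def)
    then have "1 + wval 2 v < m" using wval_scons[of 2 1 v] Om_binary[OF v] by simp
    ultimately show False by simp
  qed
  define K where "K = (2::nat) ^ length \<rho>"
  define c where "c = (\<beta> - 2) / (\<beta> - 1) / \<beta> ^ K"
  define q where "q = 1 / \<beta> ^ K"
  have K: "1 \<le> K" by (simp add: K_def)
  have c0: "0 < c" unfolding c_def using b2 by simp
  have q0: "0 < q" "q < 1" unfolding q_def using b2 K by (auto intro!: one_less_power)
  have sep: "c * q ^ n \<le> \<bar>wval \<beta> (apply_inf \<rho> x) - wval \<beta> (apply_inf \<rho> y)\<bar>"
    if h: "binary x" "binary y" "\<exists>i\<le>n. x i \<noteq> y i" for x y n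
  proof -
    obtain j where j: "Suc j \<le> K * Suc n" "apply_inf \<rho> x j \<noteq> apply_inf \<rho> y j"
      using apply_sep[OF h(3,1,2), of \<rho>] unfolding K_def by blast
    then have "\<exists>i\<le>K * Suc n - 1. apply_inf \<rho> x i \<noteq> apply_inf \<rho> y i" by (intro exI[of _ j]) auto
    then have "(\<beta> - 2) / (\<beta> - 1) / \<beta> ^ Suc (K * Suc n - 1) \<le> \<bar>wval \<beta> (apply_inf \<rho> x) - wval \<beta> (apply_inf \<rho> y)\<bar>"
      using wval_sep[OF b2] h by simp
    moreover have "Suc (K * Suc n - 1) = K + K * n" using K by simp
    moreover have "(\<beta> - 2) / (\<beta> - 1) / \<beta> ^ (K + K * n) = c * q ^ n"
      by (simp add: c_def q_def power_add power_mult power_divide)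
    ultimately show ?thesis by metis
  qed
  have in_Ub: "rw (apply_inf \<rho> x) \<in> Ub \<beta> m" if "binary x" for x
    using Om_in_Ub[OF m b2] Om[of \<beta>] b2 that by simp
  show "hausdorff_dim (pib \<beta> ` Ub \<beta> m) > 0"
    by (rule hausdorff_dim_pos[of "\<lambda>x. wval \<beta> (apply_inf \<rho> x)", OF _ sep c0 q0]) (use in_Ub in auto)
  show "uncountable (Ub \<beta> m \<inter> {u. \<forall>k. u k \<in> {0, 1}})"
  proof
    assume c: "countable (Ub \<beta> m \<inter> {u. \<forall>k. u k \<in> {0, 1}})"
    have sub: "(\<lambda>x. rw (apply_inf \<rho> x)) ` Collect binary \<subseteq> Ub \<beta> m \<inter> {u. \<forall>k. u k \<in> {0, 1}}"
    proof -
      have "rw (apply_inf \<rho> x) k \<in> {0, 1}" if "binary x" for x k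
        using binaryD[OF binary_apply[OF that], of \<rho> k] by (auto simp: rw_def)
      then show ?thesis using in_Ub by blast
    qed
    have inj: "inj_on (\<lambda>x. rw (apply_inf \<rho> x)) (Collect binary)"
    proof (rule inj_onI, rule ccontr)
      fix x y assume h: "x \<in> Collect binary" "y \<in> Collect binary" "rw (apply_inf \<rho> x) = rw (apply_inf \<rho> y)" "x \<noteq> y"
      then obtain n where "x n \<noteq> y n" by auto
      then have "c * q ^ n \<le> 0" using sep[of x y n] h by auto
      moreover have "0 < c * q ^ n" using c0 q0 by simp
      ultimately show False by linarith
    qed
    have "countable (Collect binary)" using countable_image_inj_on[OF countable_subset[OF sub c] inj] .
    moreover have "{0..1::real} \<subseteq> wval 2 ` Collect binary" using binary_expansion_exists by (auto simp: image_iff) (metis atLeastAtMost_iff)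
    ultimately have "countable {0..1::real}" using countable_image countable_subset by blast
    then show False using uncountable_closed_interval[of 0 "1::real"] by simp
  qed
qed

text \<open>Renormalising by \<open>L R\<^sup>N L\<close> (respectively \<open>R L\<^sup>N R\<close>) inside level \<open>\<tau>\<close> turns the two
  strict inequalities into room for all binary words.\<close>

lemma room_L:
  assumes m: "1 < m" "m \<le> 2" and b: "1 < \<beta>"
    and U: "Up m \<beta> (los \<tau> (0 ## a01))" and D: "Dn m \<beta> (his \<tau> a10)"
  shows "\<exists>\<rho>. Up m \<beta> (los \<rho> z0) \<and> Dn m \<beta> (his \<rho> z1)"
proof -
  have *: "\<exists>\<rho>. Up m \<gamma> (los \<rho> z0) \<and> Dn m \<gamma> (his \<rho> z1)" if g: "2 \<le> \<gamma>" "\<beta> \<le> \<gamma>" for \<gamma>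
  proof -
    have Ug: "Up m \<gamma> (los \<tau> (0 ## a01))" and Dg: "Dn m \<gamma> (his \<tau> a10)"
      using Up_mono[OF m(1) b g(2) _ U] Dn_mono[OF m(1) b g(2) _ D] by auto
    then obtain N where N: "\<And>y. binary y \<Longrightarrow> agree N (los \<tau> (0 ## a01)) y \<Longrightarrow> Up m \<gamma> y"
      using Up_open[of \<gamma> "los \<tau> (0 ## a01)" m] g by auto
    \<comment> \<open>\<open>R\<close> fixes \<open>w01\<close> and \<open>lo L w01\<close> is
      \<open>0 ## a01\<close>, so the assumed lower bound is the word \<open>w01\<close> seen
      through \<open>\<tau> L R^N\<close>. By contraction \<open>z0\<close> shares its first N
      letters there. The upper bound at level \<open>\<rho>\<close> cannot exceed
      \<open>hi L z1 = a10\<close> seen through \<open>\<tau>\<close>.\<close>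
    define \<rho> where "\<rho> = \<tau> @ [L] @ replicate N R @ [L]"
    have r: "los (replicate N R) w01 = w01" by (induction N) (auto simp: lo_hi_const simp del: lo.simps)
    have h0: "z0 0 = 0" "w01 0 = 0" by (auto simp: z0_def w01_def)
    have "agree N (los (\<tau> @ [L] @ replicate N R) w01) (los (\<tau> @ [L] @ replicate N R) z0)"
      by (rule los_contract) (auto simp: h0)
    moreover have "los (\<tau> @ [L] @ replicate N R) w01 = los \<tau> (0 ## a01)"
      using r by (simp add: lo_hi_const del: lo.simps)
    moreover have "los (\<tau> @ [L] @ replicate N R) z0 = los \<rho> z0"
      by (simp add: \<rho>_def lo_hi_const del: lo.simps)
    ultimately have "Up m \<gamma> (los \<rho> z0)" using N by simp
    moreover have "Dn m \<gamma> (his \<rho> z1)"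
    proof -
      have "lex_le (his (\<tau> @ [L]) (his (replicate N R @ [L]) z1)) (his (\<tau> @ [L]) z1)"
        by (intro his_lex_le lex_le_z1) simp_all
      then have "lex_le (his \<rho> z1) (his \<tau> a10)" by (simp add: \<rho>_def lo_hi_const del: hi.simps)
      then show ?thesis using dncD[OF dnc_Dn[OF g(1)], OF Dg] by simp
    qed
    ultimately show ?thesis by blast
  qed
  \<comment> \<open>For a base below 2 the bounds also hold at base 2, where the full shift would
    fit in; this was excluded by \<open>dimension_pos\<close>.\<close>
  show ?thesis
  proof (cases "2 \<le> \<beta>")
    case False
    then obtain \<rho> where "Up m 2 (los \<rho> z0)" "Dn m 2 (his \<rho> z1)" using *[of 2] by auto
    then show ?thesis using dimension_pos(1)[OF m, of 2 \<rho>] by simp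
  qed (use * in auto)
qed

lemma room_R:
  assumes m: "1 < m" "m \<le> 2" and b: "1 < \<beta>"
    and U: "Up m \<beta> (los \<tau> a01)" and D: "Dn m \<beta> (his \<tau> (1 ## a10))"
  shows "\<exists>\<rho>. Up m \<beta> (los \<rho> z0) \<and> Dn m \<beta> (his \<rho> z1)"
proof -
  have *: "\<exists>\<rho>. Up m \<gamma> (los \<rho> z0) \<and> Dn m \<gamma> (his \<rho> z1)" if g: "2 \<le> \<gamma>" "\<beta> \<le> \<gamma>" for \<gamma>
  proof -
    have Ug: "Up m \<gamma> (los \<tau> a01)" and Dg: "Dn m \<gamma> (his \<tau> (1 ## a10))"
      using Up_mono[OF m(1) b g(2) _ U] Dn_mono[OF m(1) b g(2) _ D] by auto
    then obtain N where N: "\<And>y. binary y \<Longrightarrow> agree N (his \<tau> (1 ## a10)) y \<Longrightarrow> Dn m \<gamma> y"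
      using Dn_open[of \<gamma> "his \<tau> (1 ## a10)" m] g by auto
    \<comment> \<open>The dual choice: \<open>L\<close> fixes \<open>w10\<close>,
      \<open>hi R w10\<close> is \<open>1 ## a10\<close>, and \<open>lo R z0 = a01\<close> takes
      care of the lower bound.\<close>
    define \<rho> where "\<rho> = \<tau> @ [R] @ replicate N L @ [R]"
    have r: "his (replicate N L) w10 = w10" by (induction N) (auto simp: lo_hi_const simp del: hi.simps)
    have h1: "z1 0 = 1" "w10 0 = 1" by (auto simp: z1_def w10_def)
    have "agree N (his (\<tau> @ [R] @ replicate N L) w10) (his (\<tau> @ [R] @ replicate N L) z1)"
      by (rule his_contract) (auto simp: h1)
    moreover have "his (\<tau> @ [R] @ replicate N L) w10 = his \<tau> (1 ## a10)"
      using r by (simp add: lo_hi_const del: hi.simps)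
    moreover have "his (\<tau> @ [R] @ replicate N L) z1 = his \<rho> z1"
      by (simp add: \<rho>_def lo_hi_const del: hi.simps)
    ultimately have "Dn m \<gamma> (his \<rho> z1)" using N by simp
    moreover have "Up m \<gamma> (los \<rho> z0)"
    proof -
      have "lex_le (los (\<tau> @ [R]) z0) (los (\<tau> @ [R]) (los (replicate N L @ [R]) z0))"
        by (intro los_lex_le z0_lex_le) simp_all
      then have "lex_le (los \<tau> a01) (los \<rho> z0)" by (simp add: \<rho>_def lo_hi_const del: lo.simps)
      then show ?thesis using upcD[OF upc_Up[OF g(1)], OF Ug] by simp
    qed
    ultimately show ?thesis by blast
  qed
  show ?thesis
  proof (cases "2 \<le> \<beta>")
    case False
    then obtain \<rho> where "Up m 2 (los \<rho> z0)" "Dn m 2 (his \<rho> z1)" using *[of 2] by auto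
    then show ?thesis using dimension_pos(1)[OF m, of 2 \<rho>] by simp
  qed (use * in auto)
qed

subsection \<open>Infimum and supremum of an orbit\<close>

text \<open>The infimum need not be attained; it suffices that tails share arbitrarily long prefixes
  with it.\<close>

lemma infw_eqI:
  assumes "binary i" "\<And>v. tail u v \<Longrightarrow> lex_le i v" "\<And>n. \<exists>v. tail u v \<and> agree n v i"
  shows "infw u = i"
  unfolding infw_def lex_inf_def orbit_tail
proof (rule the_equality)
  have *: "lex_le t i" if "\<forall>x\<in>{v. tail u v}. lex_le t x" for t
    by (rule lex_le_limit) (use assms(3) that in blast)
  then show "binary i \<and> (\<forall>x\<in>{v. tail u v}. lex_le i x) \<and>
    (\<forall>t. binary t \<and> (\<forall>x\<in>{v. tail u v}. lex_le t x) \<longrightarrow> lex_le t i)"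
    using assms(1,2) by blast
  fix s assume "binary s \<and> (\<forall>x\<in>{v. tail u v}. lex_le s x) \<and>
    (\<forall>t. binary t \<and> (\<forall>x\<in>{v. tail u v}. lex_le t x) \<longrightarrow> lex_le t s)"
  then have "lex_le i s" "lex_le s i" using assms(1,2) * by blast+
  then show "s = i" using lex_le_antisym by blast
qed

lemma supw_eqI:
  assumes "binary s" "\<And>v. tail u v \<Longrightarrow> lex_le v s" "\<And>n. \<exists>v. tail u v \<and> agree n v s"
  shows "supw u = s"
  unfolding supw_def lex_sup_def orbit_tail
proof (rule the_equality)
  have *: "lex_le s t" if "\<forall>x\<in>{v. tail u v}. lex_le x t" for t
    by (rule lex_ge_limit) (use assms(3) that in blast)
  then show "binary s \<and> (\<forall>x\<in>{v. tail u v}. lex_le x s) \<and>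
    (\<forall>t. binary t \<and> (\<forall>x\<in>{v. tail u v}. lex_le x t) \<longrightarrow> lex_le s t)"
    using assms(1,2) by blast
  fix i assume "binary i \<and> (\<forall>x\<in>{v. tail u v}. lex_le x i) \<and>
    (\<forall>t. binary t \<and> (\<forall>x\<in>{v. tail u v}. lex_le x t) \<longrightarrow> lex_le i t)"
  then have "lex_le i s" "lex_le s i" using assms(1,2) * by blast+
  then show "i = s" using lex_le_antisym by blast
qed

text \<open>The infimum is required to be approached by tails that follow a one, and the supremum
  by tails that follow a zero; this is what makes the relation stable under substitutions.\<close>

definition extremes :: "(nat \<Rightarrow> nat) \<Rightarrow> (nat \<Rightarrow> nat) \<Rightarrow> (nat \<Rightarrow> nat) \<Rightarrow> bool" where
  "extremes u i s \<longleftrightarrow> binary u \<and> binary i \<and> binary s \<and> i 0 = 0 \<and> s 0 = 1 \<and>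
     (\<forall>v. tail u v \<longrightarrow> lex_le i v \<and> lex_le v s) \<and>
     (\<forall>n. \<exists>v. tail u (1 ## v) \<and> agree n v i) \<and> (\<forall>n. \<exists>v. tail u (0 ## v) \<and> agree n v s)"

text \<open>The bounds follow by applying the result on admissible images to lexicographic
  half-lines. The approximating tails come from \<open>subst_tail_one\<close> and
  \<open>subst_tail_zero\<close>, which need the letter recorded in front.\<close>

lemma extremes_subst:
  assumes e: "extremes u i s" shows "extremes (subst_inf t u) (lo t i) (hi t s)"
proof -
  have b: "binary u" "binary i" "binary s" "i 0 = 0" "s 0 = 1"
    and bd: "\<And>v. tail u v \<Longrightarrow> lex_le i v \<and> lex_le v s"
    and ai: "\<And>n. \<exists>v. tail u (1 ## v) \<and> agree n v i" and as: "\<And>n. \<exists>v. tail u (0 ## v) \<and> agree n v s"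
    using e unfolding extremes_def by blast+
  have "subst_inf t u \<in> Om (lex_le (lo t i)) (\<lambda>x. lex_le x (hi t s))"
  proof (rule subst_in_Om)
    show "upc (lex_le (lo t i))" "dnc (\<lambda>x. lex_le x (hi t s))"
      unfolding upc_def dnc_def using lex_le_trans by blast+
    show "u \<in> Om (\<lambda>x. lex_le (lo t i) (lo t x)) (\<lambda>x. lex_le (hi t x) (hi t s))"
      unfolding Om_def using b bd lo_lex_le hi_lex_le tail_binary by auto
  qed
  then have "\<forall>v. tail (subst_inf t u) v \<longrightarrow> lex_le (lo t i) v \<and> lex_le v (hi t s)"
    unfolding Om_def by blast
  moreover have "\<exists>v. tail (subst_inf t u) (1 ## v) \<and> agree n v (lo t i)" for n
  proof -
    obtain v where v: "tail u (1 ## v)" "agree (Suc n) v i" using ai by blast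
    have "v 0 = 0" using v(2) b(4) by (auto simp: agree_def)
    moreover have "binary v" using tail_binary[OF tail_sconsI[OF v(1)] b(1)] .
    ultimately have "agree (Suc (Suc n)) (lo t v) (lo t i)" using lo_grow v(2) b by blast
    then have "agree n (lo t v) (lo t i)" by (rule agree_mono) simp
    then show ?thesis using subst_tail_one[OF v(1)] by blast
  qed
  moreover have "\<exists>v. tail (subst_inf t u) (0 ## v) \<and> agree n v (hi t s)" for n
  proof -
    obtain v where v: "tail u (0 ## v)" "agree (Suc n) v s" using as by blast
    have v1: "v 0 = 1" using v(2) b(5) by (auto simp: agree_def)
    moreover have bv: "binary v" using tail_binary[OF tail_sconsI[OF v(1)] b(1)] .
    ultimately have "agree (Suc (Suc n)) (hi t v) (hi t s)" using hi_grow v(2) b by blast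
    then have "agree n (hi t v) (hi t s)" by (rule agree_mono) simp
    then show ?thesis using subst_tail_zero[OF v(1) v1 bv] by blast
  qed
  ultimately show ?thesis unfolding extremes_def using b lo_0[of i t] hi_1[of s t] by simp
qed

lemma extremes_apply: "extremes u i s \<Longrightarrow> extremes (apply_inf \<tau> u) (los \<tau> i) (his \<tau> s)"
  by (induction \<tau>) (auto intro: extremes_subst)

lemma extremesI:
  assumes "binary u" "i 0 = 0" "s 0 = 1" "\<And>v. tail u v \<Longrightarrow> lex_le i v \<and> lex_le v s"
    "tail u (1 ## i)" "tail u (0 ## s)"
  shows "extremes u i s"
proof -
  have "binary (1 ## i)" "binary (0 ## s)" using assms tail_binary by blast+
  then show ?thesis unfolding extremes_def using assms agree_refl by auto
qed

lemma alternating_lex: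
  "lex_le a01 a10" "lex_le (0 ## v) a10" "lex_le a01 (1 ## v)" "lex_le (0 ## 0 ## v) a01"
  "lex_le a10 (1 ## 1 ## v)" "lex_le (0 ## a01) a01" "lex_le a10 (1 ## a10)"
  "lex_le (1 ## 0 ## a01) a10" "lex_le a01 (0 ## 1 ## a10)"
proof -
  have a: "a01 = 0 ## 1 ## a01" "a10 = 1 ## 0 ## a10" using a01_unfold a10_unfold by simp_all
  show "lex_le a01 a10" by (rule subst[OF a(1)[symmetric]], rule subst[OF a(2)[symmetric]]) simp
  show "lex_le (0 ## v) a10" by (rule subst[OF a(2)[symmetric]]) simp
  show "lex_le a01 (1 ## v)" by (rule subst[OF a(1)[symmetric]]) simp
  show "lex_le (0 ## 0 ## v) a01" by (rule subst[OF a(1)[symmetric]]) simp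
  show "lex_le a10 (1 ## 1 ## v)" by (rule subst[OF a(2)[symmetric]]) simp
  show 6: "lex_le (0 ## a01) a01" by (rule zero_scons_le) simp
  show 7: "lex_le a10 (1 ## a10)" by (rule one_scons_ge) simp
  show "lex_le (1 ## 0 ## a01) a10" using 6 by (subst a10_unfold) simp
  show "lex_le a01 (0 ## 1 ## a10)" using 7 by (subst a01_unfold) simp
qed

lemma M_words: "subst_inf M w10 = 1 ## 0 ## a01" "subst_inf M w010 = 0 ## 1 ## 1 ## 0 ## a01"
  "subst_inf M w01 = 0 ## 1 ## a10" "subst_inf M w101 = 1 ## 0 ## 0 ## 1 ## a10"
  "hi M w10 = 1 ## 1 ## 0 ## a01" "lo M w01 = 0 ## 0 ## 1 ## a10"
  by (simp_all add: w10_eq w010_eq w01_eq w101_eq subst_const)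

lemma tails_a: "tail a01 v \<longleftrightarrow> v = a01 \<or> v = a10" "tail a10 v \<longleftrightarrow> v = a01 \<or> v = a10"
proof -
  have "tail a01 a10" "tail a10 a01"
    by (subst a01_unfold, simp add: tail_scons) (subst a10_unfold, simp add: tail_scons)
  then show "tail a01 v \<longleftrightarrow> v = a01 \<or> v = a10" "tail a10 v \<longleftrightarrow> v = a01 \<or> v = a10"
    using tail_a01 tail_a10 tail_refl by blast+
qed

text \<open>The first two words share their infimum and the last two their supremum. Hence g is the
  same at both ends of the first kind of interval, and f at both ends of the second.\<close>

lemma extremes_M:
  "extremes (subst_inf M w10) (0 ## a01) a10"
  "extremes (subst_inf M w010) (0 ## a01) (hi M w10)"
  "extremes (subst_inf M w01) a01 (1 ## a10)"
  "extremes (subst_inf M w101) (lo M w01) (1 ## a10)"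
proof -
  have a: "a01 0 = 0" "a10 0 = 1" by (simp_all add: a01_def a10_def)
  note lex = alternating_lex alternating_lex[unfolded One_nat_def]
  show "extremes (subst_inf M w10) (0 ## a01) a10"
    unfolding M_words
  proof (rule extremesI)
    show "tail (1 ## 0 ## a01) (0 ## a10)"
      using a01_unfold by (metis tail_scons tail_refl)
  qed (auto simp: a tail_scons tails_a lex)
  show "extremes (subst_inf M w010) (0 ## a01) (hi M w10)"
    unfolding M_words by (rule extremesI) (auto simp: a tail_scons tails_a lex)
  show "extremes (subst_inf M w01) a01 (1 ## a10)"
    unfolding M_words
  proof (rule extremesI)
    show "tail (0 ## 1 ## a10) (1 ## a01)"
      using a10_unfold by (metis tail_scons tail_refl)
  qed (auto simp: a tail_scons tails_a lex)
  show "extremes (subst_inf M w101) (lo M w01) (1 ## a10)"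
    unfolding M_words by (rule extremesI) (auto simp: a tail_scons tails_a lex)
qed


subsection \<open>The functions \<open>f\<close>, \<open>g\<close> and the crossing point \<open>\<mu>\<close>\<close>

text \<open>These conditions make f, g and mu well behaved: infinitely many ones in s give a
  solution for f throughout m in (1,2], and \<open>lex_le i (shift 1 s)\<close> decides the sign at
  base 2 in the search for the crossing.\<close>

definition nice :: "(nat \<Rightarrow> nat) \<Rightarrow> (nat \<Rightarrow> nat) \<Rightarrow> (nat \<Rightarrow> nat) \<Rightarrow> bool" where
  "nice u i s \<longleftrightarrow> infw u = i \<and> supw u = s \<and> binary i \<and> binary s \<and> s 0 = 1 \<and>
     (\<forall>k. \<exists>j\<ge>k. s j = 1) \<and> lex_le i (shift 1 s)"

lemma niceD:
  assumes "nice u i s"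
  shows "infw u = i" "supw u = s" "binary i" "binary s" "s 0 = 1" "\<And>k. \<exists>j\<ge>k. s j = 1" "lex_le i (shift 1 s)"
  using assms unfolding nice_def by blast+

text \<open>If s ended in zeros, \<open>z0\<close> would be a limit of tails of u, so i would be at
  most \<open>z0\<close>.\<close>

lemma extremes_nice:
  assumes e: "extremes u i s" and "i \<noteq> z0" shows "nice u i s"
proof -
  have b: "binary u" "binary i" "binary s" "i 0 = 0" "s 0 = 1"
    and bd: "\<And>v. tail u v \<Longrightarrow> lex_le i v \<and> lex_le v s"
    and ai: "\<And>n. \<exists>v. tail u (1 ## v) \<and> agree n v i" and as: "\<And>n. \<exists>v. tail u (0 ## v) \<and> agree n v s"
    using e unfolding extremes_def by blast+
  have "infw u = i" by (rule infw_eqI) (use b bd ai tail_sconsI in blast)+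
  moreover have "supw u = s" by (rule supw_eqI) (use b bd as tail_sconsI in blast)+
  moreover have i_le: "lex_le i (shift k s)" for k
  proof (rule lex_le_limit)
    fix n
    obtain v where v: "tail u (0 ## v)" "agree (k + n) v s" using as by blast
    have "tail u (shift k v)" using tail_trans[OF tail_sconsI[OF v(1)] tail_shift] .
    moreover have "agree n (shift k v) (shift k s)" using v(2) by (auto simp: agree_def shift_apply)
    ultimately show "\<exists>v. agree n v (shift k s) \<and> lex_le i v" using bd by blast
  qed
  moreover have "\<exists>j\<ge>k. s j = 1" for k
  proof (rule ccontr)
    assume h: "\<not> (\<exists>j\<ge>k. s j = 1)"
    have "shift k s j = 0" for j
    proof -
      have "s (k + j) \<noteq> 1" using h by auto
      then show ?thesis using binaryD[OF b(3), of "k + j"] by (simp add: shift_apply)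
    qed
    then have "shift k s = z0" by (auto simp: z0_def)
    then have "lex_le i z0" using i_le[of k] by simp
    then show False using assms(2) lex_le_antisym z0_lex_le by blast
  qed
  ultimately show ?thesis unfolding nice_def using b by blast
qed

lemma f_root:
  assumes s: "binary s" "s 0 = 1" "\<And>k. \<exists>j\<ge>k. s j = 1" and m: "1 < m" "m \<le> 2"
  shows "\<exists>\<beta>>1. \<beta> * wval \<beta> s = m"
proof -
  obtain a where a: "a \<ge> 1" "s a = 1" using s(3) by blast
  obtain b where b: "b \<ge> Suc a" "s b = 1" using s(3) by blast
  \<comment> \<open>At this base the ones at a and b, counted after the leading digit, contribute at
    least 1/2 each; so the left-hand side is at least 2, hence at least m.\<close>
  define \<gamma> where "\<gamma> = root b 2"
  have b0: "b > 0" using b by simp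
  have g: "1 < \<gamma>" "\<gamma> ^ b = 2" unfolding \<gamma>_def using b0 by (simp_all add: real_root_gt_1_iff)
  \<comment> \<open>The constant makes \<open>1 / (B - 1)\<close> equal to
    \<open>(m - 1) / m\<close>, so even a tail of ones stays within m - 1.\<close>
  define B where "B = 2 + 1 / (m - 1)"
  have B: "1 < B" unfolding B_def using m by (simp add: add_pos_pos)
  have low: "m \<le> \<gamma> * wval \<gamma> s"
  proof -
    have sh: "rw (shift 1 s) (a - 1) = 1" "rw (shift 1 s) (b - 1) = 1"
      using a b by (simp_all add: rw_def shift_apply)
    have "(\<Sum>k\<in>{a - 1, b - 1}. rw (shift 1 s) k / \<gamma> ^ Suc k) \<le> wval \<gamma> (shift 1 s)"
      unfolding pib_def
      by (rule sum_le_suminf[OF pib_summable[of _ _ 1]])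
        (use g s rw_bound(1)[of "shift 1 s"] rw_bound(2)[of "shift 1 s"] in auto)
    then have "1 / \<gamma> ^ a + 1 / \<gamma> ^ b \<le> wval \<gamma> (shift 1 s)"
      using a b sh by (simp add: Suc_diff_le del: power_Suc)
    moreover have "1 / \<gamma> ^ b \<le> 1 / \<gamma> ^ a"
      using g b by (intro divide_left_mono power_increasing mult_pos_pos) auto
    moreover have "1 / \<gamma> ^ b = 1 / 2" using g by simp
    ultimately have "1 \<le> wval \<gamma> (shift 1 s)" by linarith
    then show ?thesis using f_equation[of \<gamma> s] g s m by simp
  qed
  have high: "B * wval B s \<le> m"
  proof -
    have "B * wval B s = 1 + wval B (shift 1 s)" using f_equation[of B s] B s by simp
    also have "\<dots> \<le> 1 + 1 / (B - 1)" using wval_le[of B "shift 1 s"] B s by simp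
    also have "1 / (B - 1) = (m - 1) / m" unfolding B_def using m by (simp add: field_simps)
    also have "(m - 1) / m \<le> (m - 1) / 1" using m by (intro divide_left_mono) auto
    finally show ?thesis by simp
  qed
  have cont: "continuous_on {1<..} (\<lambda>\<beta>. \<beta> * wval \<beta> s)"
    by (intro continuous_at_imp_continuous_on ballI continuous_intros wval_isCont) (use s in auto)
  have "\<gamma> \<le> B"
  proof (rule ccontr)
    assume h: "\<not> \<gamma> \<le> B"
    then have "Dn m \<gamma> s" using Dn_less[OF m(1) B _ s(1) high] by simp
    then show False using low by (simp add: Dn_def)
  qed
  then obtain \<beta> where "\<beta> \<ge> \<gamma>" "\<beta> \<le> B" "\<beta> * wval \<beta> s = m"
    using IVT2'[of "\<lambda>\<beta>. \<beta> * wval \<beta> s" B m \<gamma>] low high continuous_on_subset[OF cont, of "{\<gamma>..B}"] g by force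
  then show ?thesis using g by (intro exI[of _ \<beta>]) auto
qed

text \<open>The root lies between m, where a tail of ones would give exactly m, and 1 + m, where the
  zero word does.\<close>

lemma g_root:
  assumes i: "binary i" and m: "1 < m"
  shows "\<exists>\<beta>>1. (\<beta> - 1) * (1 + wval \<beta> i) = m"
proof -
  have low: "(m - 1) * (1 + wval m i) \<le> m"
  proof -
    have "(m - 1) * (1 + wval m i) \<le> (m - 1) * (1 + 1 / (m - 1))"
      using wval_le[OF m i] m by (intro mult_left_mono add_left_mono) auto
    also have "\<dots> = m" using m by (simp add: field_simps)
    finally show ?thesis .
  qed
  have high: "m \<le> (1 + m - 1) * (1 + wval (1 + m) i)"
    using wval_nonneg[of "1 + m" i] i m by (simp add: algebra_simps)
  have "continuous_on {m..1 + m} (\<lambda>\<beta>. (\<beta> - 1) * (1 + wval \<beta> i))"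
    by (intro continuous_at_imp_continuous_on ballI continuous_intros wval_isCont) (use i m in auto)
  then obtain \<beta> where "\<beta> \<ge> m" "\<beta> \<le> 1 + m" "(\<beta> - 1) * (1 + wval \<beta> i) = m"
    using IVT'[of "\<lambda>\<beta>. (\<beta> - 1) * (1 + wval \<beta> i)" m m "1 + m"] low high by auto
  then show ?thesis using m by (intro exI[of _ \<beta>]) auto
qed

lemma ffun_props:
  assumes n: "nice u i s" and m: "1 < m" "m \<le> 2"
  shows "1 < ffun u m" "ffun u m * wval (ffun u m) s = m" "\<And>\<beta>. 1 < \<beta> \<Longrightarrow> Dn m \<beta> s \<longleftrightarrow> ffun u m < \<beta>"
    "\<And>\<beta>. 1 < \<beta> \<Longrightarrow> \<beta> * wval \<beta> s = m \<Longrightarrow> ffun u m = \<beta>"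
proof -
  note N = niceD[OF n]
  have uniq: "\<beta> = \<gamma>" if "1 < \<beta>" "\<beta> * wval \<beta> s = m" "1 < \<gamma>" "\<gamma> * wval \<gamma> s = m" for \<beta> \<gamma>
    using Dn_less[OF m(1) that(1) _ N(4), of \<gamma>] Dn_less[OF m(1) that(3) _ N(4), of \<beta>] that
    by (cases \<beta> \<gamma> rule: linorder_cases) (auto simp: Dn_def)
  have e: "\<exists>!\<beta>. \<beta> > 1 \<and> \<beta> * pib \<beta> (rw (supw u)) = m"
    unfolding N(2) using f_root[OF N(4,5,6) m] uniq by blast
  have f: "ffun u m > 1 \<and> ffun u m * pib (ffun u m) (rw (supw u)) = m"
    unfolding ffun_def by (rule theI'[OF e])
  then show f1: "1 < ffun u m" and f2: "ffun u m * wval (ffun u m) s = m" using N(2) by auto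
  show "Dn m \<beta> s \<longleftrightarrow> ffun u m < \<beta>" if "1 < \<beta>" for \<beta>
    using Dn_less[OF m(1) f1 _ N(4), of \<beta>] Dn_mono[OF m(1) that _ N(4), of "ffun u m"] f2
    by (metis Dn_def linorder_not_less order_refl less_irrefl)
  show "\<And>\<beta>. 1 < \<beta> \<Longrightarrow> \<beta> * wval \<beta> s = m \<Longrightarrow> ffun u m = \<beta>" using uniq f1 f2 by blast
qed

lemma gfun_props:
  assumes i: "infw u = i" "binary i" and m: "1 < m"
  shows "1 < gfun u m" "(gfun u m - 1) * (1 + wval (gfun u m) i) = m"
    "\<And>\<beta>. 1 < \<beta> \<Longrightarrow> Up m \<beta> i \<longleftrightarrow> gfun u m < \<beta>"
    "\<And>\<beta>. 1 < \<beta> \<Longrightarrow> (\<beta> - 1) * (1 + wval \<beta> i) = m \<Longrightarrow> gfun u m = \<beta>"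
proof -
  have uniq: "\<beta> = \<gamma>" if "1 < \<beta>" "(\<beta> - 1) * (1 + wval \<beta> i) = m" "1 < \<gamma>" "(\<gamma> - 1) * (1 + wval \<gamma> i) = m" for \<beta> \<gamma>
    using Up_less[OF m that(1) _ i(2), of \<gamma>] Up_less[OF m that(3) _ i(2), of \<beta>] that
    by (cases \<beta> \<gamma> rule: linorder_cases) (auto simp: Up_def)
  have e: "\<exists>!\<beta>. \<beta> > 1 \<and> (\<beta> - 1) * (1 + pib \<beta> (rw (infw u))) = m"
    unfolding i(1) using g_root[OF i(2) m] uniq by blast
  have f: "gfun u m > 1 \<and> (gfun u m - 1) * (1 + pib (gfun u m) (rw (infw u))) = m"
    unfolding gfun_def by (rule theI'[OF e])
  then show f1: "1 < gfun u m" and f2: "(gfun u m - 1) * (1 + wval (gfun u m) i) = m" using i by auto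
  show "Up m \<beta> i \<longleftrightarrow> gfun u m < \<beta>" if "1 < \<beta>" for \<beta>
    using Up_less[OF m f1 _ i(2), of \<beta>] Up_mono[OF m that _ i(2), of "gfun u m"] f2
    by (metis Up_def linorder_not_less order_refl less_irrefl)
  show "\<And>\<beta>. 1 < \<beta> \<Longrightarrow> (\<beta> - 1) * (1 + wval \<beta> i) = m \<Longrightarrow> gfun u m = \<beta>" using uniq f1 f2 by blast
qed

lemma flt_iff:
  assumes n: "nice u i s" and m: "1 < m" "m \<le> 2"
  shows "flt m s i \<longleftrightarrow> ffun u m < gfun u m" "glt m i s \<longleftrightarrow> gfun u m < ffun u m"
proof -
  note N = niceD[OF n] and F = ffun_props[OF n m] and G = gfun_props[OF N(1,3) m(1)]
  show "flt m s i \<longleftrightarrow> ffun u m < gfun u m"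
    unfolding flt_def using F(3) G(1,3) by (meson linorder_not_less less_irrefl less_le_trans)
  show "glt m i s \<longleftrightarrow> gfun u m < ffun u m"
    unfolding glt_def using F(1,3) G(3) by (meson linorder_not_less less_irrefl less_le_trans)
qed

text \<open>The crossing is sought in the base and not in m: where the two left-hand sides coincide,
  their common value is the required m. It is the only one because f decreases and g increases in
  m.\<close>

lemma mu_props:
  assumes n: "nice u i s" and m: "1 < m" "m \<le> 2"
  shows "m \<le> mu u \<longleftrightarrow> gfun u m \<le> ffun u m" "mu u \<le> m \<longleftrightarrow> ffun u m \<le> gfun u m"
proof -
  note N = niceD[OF n] and F = ffun_props[OF n] and G = gfun_props[OF N(1,3)]
  have wval_cont: "continuous_on {2..3} (\<lambda>\<beta>. wval \<beta> x)" if "binary x" for x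
    by (intro continuous_at_imp_continuous_on ballI wval_isCont) (use that in auto)
  \<comment> \<open>At base 2 the sign reduces to \<open>lex_le i (shift 1 s)\<close>. At base 3 the
    side of f is at most 3/2 and the side of g at least 2.\<close>
  let ?h = "\<lambda>\<beta>. \<beta> * wval \<beta> s - (\<beta> - 1) * (1 + wval \<beta> i)"
  have bs: "binary (shift 1 s)" using N(4) by simp
  have "?h 3 \<le> 0"
  proof -
    have "3 * wval 3 s \<le> 1 + 1 / 2" using f_equation[of 3 s] wval_le[of 3 "shift 1 s"] N bs by simp
    moreover have "0 \<le> wval 3 i" using wval_nonneg N by simp
    ultimately show ?thesis by simp
  qed
  moreover have "0 \<le> ?h 2"
    using f_equation[of 2 s] wval_lex_le[of 2 i "shift 1 s"] N bs by simp
  moreover have "continuous_on {2..3} ?h"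
    using wval_cont[OF N(3)] wval_cont[OF N(4)] by (intro continuous_intros) auto
  ultimately obtain \<beta> where b: "2 \<le> \<beta>" "\<beta> \<le> 3" "?h \<beta> = 0" using IVT2'[of ?h 3 0 2] by auto
  define m' where "m' = \<beta> * wval \<beta> s"
  have m'e: "m' = 1 + wval \<beta> (shift 1 s)" using f_equation[of \<beta> s] b N by (simp add: m'_def)
  have "0 < wval \<beta> (shift 1 s)"
  proof -
    obtain j where j: "j \<ge> 1" "s j = 1" using N(6) by blast
    then have "0 < rw (shift 1 s) (j - 1)" by (simp add: rw_def shift_apply)
    \<comment> \<open>Base 4 merely lies beyond the range of \<open>\<beta>\<close>; a strict
      decrease down to a nonnegative value shows positivity.\<close>
    then have "wval 4 (shift 1 s) < wval \<beta> (shift 1 s)"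
      by (rule pib_strict_antimono[of _ _ _ 1 "j - 1", rotated 4]) (use b bs in \<open>auto simp: rw_bound\<close>)
    then show ?thesis using wval_nonneg[of 4 "shift 1 s"] bs by simp
  qed
  moreover have "wval \<beta> (shift 1 s) \<le> 1"
  proof -
    have "1 / (\<beta> - 1) \<le> 1" using b by simp
    then show ?thesis using wval_le[of \<beta> "shift 1 s"] b bs by linarith
  qed
  ultimately have m': "1 < m'" "m' \<le> 2" using m'e by simp_all
  have cross: "ffun u m' = \<beta>" "gfun u m' = \<beta>"
    using F(4)[OF m', of \<beta>] G(4)[OF m'(1), of \<beta>] b m'_def by simp_all
  have fdec: "ffun u y < ffun u x" if "1 < x" "x < y" "y \<le> 2" for x y
  proof -
    have "Dn y (ffun u x) s" unfolding Dn_def using F(2)[of x] that by simp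
    then show ?thesis using F(3)[of y "ffun u x"] F(1)[of x] that by simp
  qed
  have ginc: "gfun u x < gfun u y" if "1 < x" "x < y" for x y
  proof -
    have "Up x (gfun u y) i" unfolding Up_def using G(2)[of y] that by simp
    then show ?thesis using G(3)[of x "gfun u y"] G(1)[of y] that by simp
  qed
  have lt: "gfun u x < ffun u x" if "1 < x" "x < m'" for x
    using fdec[of x m'] ginc[of x m'] cross that m' by simp
  have gt: "ffun u x < gfun u x" if "m' < x" "x \<le> 2" for x
    using fdec[of m' x] ginc[of m' x] cross that m' by simp
  have "mu u = m'" unfolding mu_def
  proof (rule the_equality)
    show "1 < m' \<and> m' \<le> 2 \<and> ffun u m' = gfun u m'" using m' cross by simp
    show "x = m'" if "1 < x \<and> x \<le> 2 \<and> ffun u x = gfun u x" for x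
      using lt[of x] gt[of x] that by (cases x m' rule: linorder_cases) auto
  qed
  then show "m \<le> mu u \<longleftrightarrow> gfun u m \<le> ffun u m" "mu u \<le> m \<longleftrightarrow> ffun u m \<le> gfun u m"
    using lt[of m] gt[of m] cross m by (cases m m' rule: linorder_cases; simp)+
qed

section \<open>The words of the theorem at an arbitrary level\<close>

lemma los_neq_z0:
  assumes "x \<noteq> z0" "binary x" shows "los \<tau> x \<noteq> z0"
proof (induction \<tau>)
  case (Cons t \<tau>)
  have "lex_less z0 (los \<tau> x)" using Cons z0_lex_le[of "los \<tau> x"] by (auto simp: lex_le_def)
  then have "lex_less (subst_inf t z0) (subst_inf t (los \<tau> x))" using subst_lex_less assms(2) by simp
  moreover have "lex_le z0 (subst_inf t z0)" by simp
  ultimately have "subst_inf t (los \<tau> x) \<noteq> z0" using lex_not_le by force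
  then show ?case using z0_unfold by (cases t) (auto, metis scons_inject)
qed (use assms in simp)

lemma nice_apply:
  "nice (apply_inf (\<tau> @ [M]) w10) (los \<tau> (0 ## a01)) (his \<tau> a10)"
  "nice (apply_inf (\<tau> @ [M]) w010) (los \<tau> (0 ## a01)) (his \<tau> (hi M w10))"
  "nice (apply_inf (\<tau> @ [M]) w01) (los \<tau> a01) (his \<tau> (1 ## a10))"
  "nice (apply_inf (\<tau> @ [M]) w101) (los \<tau> (lo M w01)) (his \<tau> (1 ## a10))"
proof -
  have "a01 1 \<noteq> z0 1" "(0 ## a01) (Suc 1) \<noteq> z0 (Suc 1)" "(lo M w01) (Suc (Suc 0)) \<noteq> z0 (Suc (Suc 0))"
    unfolding M_words by (simp_all add: z0_def a01_def)
  then have "a01 \<noteq> z0" "0 ## a01 \<noteq> z0" "lo M w01 \<noteq> z0" by metis+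
  then have ne: "los \<tau> a01 \<noteq> z0" "los \<tau> (0 ## a01) \<noteq> z0" "los \<tau> (lo M w01) \<noteq> z0"
    by (simp_all add: los_neq_z0 del: lo.simps)
  show "nice (apply_inf (\<tau> @ [M]) w10) (los \<tau> (0 ## a01)) (his \<tau> a10)"
    "nice (apply_inf (\<tau> @ [M]) w010) (los \<tau> (0 ## a01)) (his \<tau> (hi M w10))"
    "nice (apply_inf (\<tau> @ [M]) w01) (los \<tau> a01) (his \<tau> (1 ## a10))"
    "nice (apply_inf (\<tau> @ [M]) w101) (los \<tau> (lo M w01)) (his \<tau> (1 ## a10))"
    using extremes_nice[OF extremes_apply[OF extremes_M(1)] ne(2)]
      extremes_nice[OF extremes_apply[OF extremes_M(2)] ne(2)]
      extremes_nice[OF extremes_apply[OF extremes_M(3)] ne(1)]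
      extremes_nice[OF extremes_apply[OF extremes_M(4)] ne(3)]
    by (simp_all del: lo.simps hi.simps)
qed

lemma nice_w01: "nice w01 w01 z1"
proof -
  have t: "tail w01 v \<longleftrightarrow> v = w01 \<or> v = z1" for v
    unfolding w01_eq by (auto simp: tail_scons tail_z1)
  have "lex_le w01 z1" by simp
  have "infw w01 = w01" by (rule infw_eqI) (use t agree_refl in auto)
  moreover have "supw w01 = z1" by (rule supw_eqI) (use t agree_refl in auto)
  moreover have "shift 1 z1 = z1" by (auto simp: z1_def shift_def)
  moreover have "z1 j = 1" for j by (simp add: z1_def)
  ultimately show ?thesis unfolding nice_def by auto
qed

subsection \<open>Limit words\<close>

definition pre :: "(nat \<Rightarrow> subst) \<Rightarrow> nat \<Rightarrow> subst list" where
  "pre \<sigma> n = map \<sigma> [0..<n]"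

lemma pre_simps [simp]: "pre \<sigma> 0 = []" "pre \<sigma> (Suc n) = pre \<sigma> n @ [\<sigma> n]" "length (pre \<sigma> n) = n"
  by (simp_all add: pre_def)

lemma pre_split: "k \<le> n \<Longrightarrow> \<exists>\<rho>. pre \<sigma> n = pre \<sigma> k @ \<rho>"
  unfolding pre_def by (metis le0 le_add_diff_inverse map_append upt_add_eq_append)

text \<open>Letter k is read at level k + 1, where contraction has already fixed it.\<close>

definition ilim :: "(nat \<Rightarrow> subst) \<Rightarrow> nat \<Rightarrow> nat" where
  "ilim \<sigma> = (\<lambda>k. los (pre \<sigma> (Suc k)) z0 k)"

definition slim :: "(nat \<Rightarrow> subst) \<Rightarrow> nat \<Rightarrow> nat" where
  "slim \<sigma> = (\<lambda>k. his (pre \<sigma> (Suc k)) z1 k)"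

lemma ilim_agree:
  assumes "binary x" "x 0 = 0" shows "agree n (los (pre \<sigma> n) x) (ilim \<sigma>)"
  unfolding agree_def
proof (intro allI impI)
  fix k assume "k < n"
  then obtain \<rho> where r: "pre \<sigma> n = pre \<sigma> (Suc k) @ \<rho>" using pre_split[of "Suc k" n \<sigma>] by auto
  have "agree (Suc k) (los (pre \<sigma> (Suc k)) (los \<rho> x)) (los (pre \<sigma> (Suc k)) z0)"
    by (rule los_contract) (use assms in \<open>auto simp: los_0 z0_def[THEN fun_cong] simp del: pre_simps(2)\<close>)
  then show "los (pre \<sigma> n) x k = ilim \<sigma> k" unfolding r ilim_def agree_def by (simp del: pre_simps(2))
qed

lemma slim_agree:
  assumes "binary x" "x 0 = 1" shows "agree n (his (pre \<sigma> n) x) (slim \<sigma>)"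
  unfolding agree_def
proof (intro allI impI)
  fix k assume "k < n"
  then obtain \<rho> where r: "pre \<sigma> n = pre \<sigma> (Suc k) @ \<rho>" using pre_split[of "Suc k" n \<sigma>] by auto
  have "agree (Suc k) (his (pre \<sigma> (Suc k)) (his \<rho> x)) (his (pre \<sigma> (Suc k)) z1)"
    by (rule his_contract) (use assms his_1[of x \<rho>] in \<open>auto simp: z1_def[THEN fun_cong] simp del: pre_simps(2)\<close>)
  then show "his (pre \<sigma> n) x k = slim \<sigma> k" unfolding r slim_def agree_def by (simp del: pre_simps(2))
qed

lemma binary_lim [simp]: "binary (ilim \<sigma>)" "binary (slim \<sigma>)"
proof -
  have "ilim \<sigma> k \<in> {0,1}" "slim \<sigma> k \<in> {0,1}" for k
    unfolding ilim_def slim_def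
    using binaryD[of "los (pre \<sigma> (Suc k)) z0" k] binaryD[of "his (pre \<sigma> (Suc k)) z1" k] by auto
  then show "binary (ilim \<sigma>)" "binary (slim \<sigma>)" unfolding binary_def by blast+
qed

text \<open>Both changes of letter occur. They supply the tails, with the right letter in front,
  whose images approach the infimum and the supremum.\<close>

definition mixed :: "(nat \<Rightarrow> nat) \<Rightarrow> bool" where
  "mixed u \<longleftrightarrow> (\<exists>v. tail u (1 ## v) \<and> v 0 = 0) \<and> (\<exists>v. tail u (0 ## v) \<and> v 0 = 1)"

lemma mixed_subst: assumes "mixed u" "binary u" shows "mixed (subst_inf t u)"
proof -
  obtain v w where v: "tail u (1 ## v)" "v 0 = 0" and w: "tail u (0 ## w)" "w 0 = 1"
    using assms(1) unfolding mixed_def by blast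
  have b: "binary v" "binary w" using tail_binary[OF tail_sconsI[OF v(1)] assms(2)]
      tail_binary[OF tail_sconsI[OF w(1)] assms(2)] .
  show ?thesis unfolding mixed_def
    using subst_tail_one[OF v(1)] lo_0[OF v(2) b(1)] subst_tail_zero[OF w b(2)] hi_1[OF w(2) b(2)] by blast
qed

lemma mixed_M: assumes "binary u" shows "mixed (subst_inf M u)"
proof -
  obtain c d v where e: "u = c ## d ## v" by (metis scons_cases)
  then have "c = 0 \<or> c = 1" "d = 0 \<or> d = 1" using assms by auto
  then show ?thesis unfolding mixed_def e
    by (elim disjE) (auto simp: tail_scons intro: exI[of _ "0 ## _ ## _"] exI[of _ "1 ## _ ## _"])
qed

lemma mixed_L: assumes "tail u (1 ## v)" "binary u" shows "mixed (subst_inf L u)"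
proof -
  have t: "tail (subst_inf L u) (0 ## 1 ## subst_inf L v)" using subst_tail[OF assms(1), of L] by simp
  have b: "binary v" using tail_binary[OF tail_sconsI[OF assms(1)] assms(2)] .
  show ?thesis unfolding mixed_def
  proof
    show "\<exists>v. tail (subst_inf L u) (1 ## v) \<and> v 0 = 0"
      by (rule exI[of _ "subst_inf L v"]) (use tail_sconsI[OF t] subst_L_0[OF b] in auto)
    show "\<exists>v. tail (subst_inf L u) (0 ## v) \<and> v 0 = 1"
      by (rule exI[of _ "1 ## subst_inf L v"]) (use t in auto)
  qed
qed

text \<open>Any image under \<open>M\<close> has both changes, and so has \<open>L\<close> applied
  to a word containing a 1. If \<open>M\<close> stops occurring, primitivity yields an
  \<open>L\<close> followed directly by an \<open>R\<close>, and images under \<open>R\<close>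
  contain ones.\<close>

lemma limit_word_mixed:
  assumes p: "primitive \<sigma>" and b: "\<And>n. binary (U n)" and U: "\<And>n. U n = subst_inf (\<sigma> n) (U (Suc n))"
  shows "mixed (U n)"
proof -
  have down: "mixed (U n)" if "mixed (U k)" "n \<le> k" for k
    using that(2,1)
  proof (induction rule: inc_induct)
    case (step j)
    then show ?case using mixed_subst[of "U (Suc j)" "\<sigma> j"] b U[of j] by simp
  qed
  show ?thesis
  proof (cases "\<exists>k\<ge>n. \<sigma> k = M")
    case True
    then obtain k where k: "k \<ge> n" "\<sigma> k = M" by blast
    then have "mixed (U k)" using mixed_M[OF b[of "Suc k"]] U[of k] by simp
    then show ?thesis using down k by blast
  next
    case False
    have "\<exists>j\<ge>n. \<sigma> j = L"
    proof (rule ccontr)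
      assume "\<not> (\<exists>j\<ge>n. \<sigma> j = L)"
      then have "\<forall>j\<ge>n. \<sigma> j = R" using False by (metis subst.exhaust)
      then show False using p unfolding primitive_def by blast
    qed
    then obtain j where j: "j \<ge> n" "\<sigma> j = L" by blast
    \<comment> \<open>The first substitution after j other than \<open>L\<close> must be
      \<open>R\<close>, and the one just before it is \<open>L\<close>.\<close>
    have ex: "\<exists>k. j \<le> k \<and> \<sigma> k \<noteq> L" using p unfolding primitive_def by blast
    define k where "k = (LEAST k. j \<le> k \<and> \<sigma> k \<noteq> L)"
    have k: "j \<le> k" "\<sigma> k \<noteq> L" unfolding k_def using LeastI_ex[OF ex] by blast+
    have "k \<noteq> j" using k j by auto
    then obtain l where l: "k = Suc l" "j \<le> l" using k(1) by (cases k) auto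
    have "\<sigma> l = L" using not_less_Least[of l "\<lambda>k. j \<le> k \<and> \<sigma> k \<noteq> L"] l unfolding k_def[symmetric] by auto
    have "\<sigma> k = R" using k(2) False k(1) j(1) subst.exhaust by (metis order_trans)
    then have "U k = subst_inf R (U (Suc k))" using U[of k] by simp
    moreover obtain c w where cw: "U (Suc k) = c ## w" by (rule scons_cases)
    moreover have "c = 0 \<or> c = 1" using b[of "Suc k"] cw by auto
    ultimately have "tail (U k) (1 ## subst_inf R w)" by (auto simp: tail_scons)
    then have "mixed (U l)" using mixed_L[OF _ b[of k]] U[of l] \<open>\<sigma> l = L\<close> l by simp
    then show ?thesis using down l j by auto
  qed
qed

lemma apply_tail_one: "tail u (1 ## v) \<Longrightarrow> tail (apply_inf \<tau> u) (1 ## los \<tau> v)"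
  by (induction \<tau>) (auto intro: subst_tail_one[simplified])

lemma apply_tail_zero: "tail u (0 ## v) \<Longrightarrow> v 0 = 1 \<Longrightarrow> binary v \<Longrightarrow> tail (apply_inf \<tau> u) (0 ## his \<tau> v)"
  by (induction \<tau>) (auto intro!: subst_tail_zero simp: his_1[simplified])

text \<open>The extremes depend on \<open>\<sigma>\<close> alone: at level n the tails lie between
  the images of \<open>z0\<close> and \<open>z1\<close>, and contraction makes these bounds and the
  approximating tails converge to the same words.\<close>

lemma limit_word_nice:
  assumes p: "primitive \<sigma>" and lw: "limit_word \<sigma> u" shows "nice u (ilim \<sigma>) (slim \<sigma>)"
proof -
  obtain U where U0: "U 0 = u" and b: "\<And>n. binary (U n)" and U: "\<And>n. U n = subst_inf (\<sigma> n) (U (Suc n))"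
    using lw unfolding limit_word_def by blast
  have u: "u = apply_inf (pre \<sigma> n) (U n)" for n
  proof (induction n)
    case (Suc n) then show ?case using U[of n] by simp
  qed (simp add: U0)
  have z: "z0 0 = 0" "z1 0 = 1" by (simp_all add: z0_def z1_def)
  have bounds: "lex_le (los (pre \<sigma> n) z0) v \<and> lex_le v (his (pre \<sigma> n) z1)" if "tail u v" for n v
  proof -
    have "apply_inf (pre \<sigma> n) (U n) \<in> Om (lex_le (los (pre \<sigma> n) z0)) (\<lambda>x. lex_le x (his (pre \<sigma> n) z1))"
    proof (rule apply_in_Om)
      show "upc (lex_le (los (pre \<sigma> n) z0))" "dnc (\<lambda>x. lex_le x (his (pre \<sigma> n) z1))"
        unfolding upc_def dnc_def using lex_le_trans by blast+
      show "U n \<in> Om (\<lambda>x. lex_le (los (pre \<sigma> n) z0) (los (pre \<sigma> n) x)) (\<lambda>x. lex_le (his (pre \<sigma> n) x) (his (pre \<sigma> n) z1))"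
        unfolding Om_def using b los_lex_le his_lex_le tail_binary by simp
    qed
    then show ?thesis using that unfolding u[of n, symmetric] Om_def by blast
  qed
  have appr: "(\<exists>v. tail u (1 ## v) \<and> agree n v (ilim \<sigma>)) \<and> (\<exists>v. tail u (0 ## v) \<and> agree n v (slim \<sigma>))" for n
  proof -
    obtain v w where v: "tail (U n) (1 ## v)" "v 0 = 0" and w: "tail (U n) (0 ## w)" "w 0 = 1"
      using limit_word_mixed[OF p b U, of n] unfolding mixed_def by blast
    have bv: "binary v" "binary w" using tail_binary[OF tail_sconsI[OF v(1)] b]
      tail_binary[OF tail_sconsI[OF w(1)] b] .
    show ?thesis
      using apply_tail_one[OF v(1), of "pre \<sigma> n"] apply_tail_zero[OF w bv(2), of "pre \<sigma> n"] u[of n]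
        ilim_agree[OF bv(1) v(2)] slim_agree[OF bv(2) w(2)] by metis
  qed
  have "extremes u (ilim \<sigma>) (slim \<sigma>)"
    unfolding extremes_def
  proof (intro conjI allI impI)
    show "binary u" using b U0 by metis
    have "los (pre \<sigma> 1) z0 0 = 0" "his (pre \<sigma> 1) z1 0 = 1" using los_0[of z0 "pre \<sigma> 1"] his_1[of z1 "pre \<sigma> 1"] z by simp_all
    then show "ilim \<sigma> 0 = 0" "slim \<sigma> 0 = 1" by (simp_all add: ilim_def slim_def)
    fix v assume v: "tail u v"
    show "lex_le (ilim \<sigma>) v"
      by (rule lex_ge_limit) (use bounds[OF v] ilim_agree[of z0] z in auto)
    show "lex_le v (slim \<sigma>)"
      by (rule lex_le_limit) (use bounds[OF v] slim_agree[of z1] z in auto)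
  qed (use appr in auto)
  moreover have "ilim \<sigma> \<noteq> z0"
  proof
    assume h: "ilim \<sigma> = z0"
    \<comment> \<open>Only \<open>L\<close> fixes \<open>z0\<close>, so one other substitution
      already lifts the lower bound at that level, and with it the infimum, above
      \<open>z0\<close>.\<close>
    obtain n where n: "\<sigma> n \<noteq> L" using p unfolding primitive_def by blast
    have "lo (\<sigma> n) z0 0 = 0" "lo (\<sigma> n) z0 (Suc 0) \<noteq> 0 \<or> lo (\<sigma> n) z0 (Suc (Suc 0)) \<noteq> 0"
      using n by (cases "\<sigma> n"; simp add: subst_const a01_def)+
    then have "lo (\<sigma> n) z0 \<noteq> z0" by (auto simp: z0_def)
    then have ne: "los (pre \<sigma> (Suc n)) z0 \<noteq> z0" using los_neq_z0 by simp
    have "lex_le (los (pre \<sigma> (Suc n)) z0) (ilim \<sigma>)"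
    proof (rule lex_le_limit)
      fix k
      obtain v where "tail u (1 ## v)" "agree k v (ilim \<sigma>)" using appr by blast
      then show "\<exists>v. agree k v (ilim \<sigma>) \<and> lex_le (los (pre \<sigma> (Suc n)) z0) v"
        using bounds tail_sconsI by blast
    qed
    then show False using ne h lex_le_antisym z0_lex_le by metis
  qed
  ultimately show ?thesis by (rule extremes_nice)
qed

lemma limit_word_exists:
  assumes p: "primitive \<sigma>" shows "\<exists>u. limit_word \<sigma> u"
proof -
  \<comment> \<open>Images of \<open>z0\<close> under finite pieces of \<open>\<sigma>\<close> that
    begin at n. The recursion over n holds exactly for them and passes to the limit in k.\<close>
  define W where "W n k = apply_inf (map \<sigma> [n..<n + k]) z0" for n k
  have W: "W n (Suc k) = subst_inf (\<sigma> n) (W (Suc n) k)" for n k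
    unfolding W_def by (simp add: upt_conv_Cons del: upt_Suc)
  have bW: "binary (W n k)" for n k by (simp add: W_def)
  have W0: "W n k 0 = 0" for n k
  proof (induction k arbitrary: n)
    case 0 then show ?case by (simp add: W_def z0_def)
  next
    case (Suc k)
    obtain v where "W (Suc n) k = 0 ## v" using scons_hd[OF Suc bW] by blast
    then show ?case unfolding W by (cases "\<sigma> n") auto
  qed
  text \<open>Words starting with \<open>0\<close> gain a common letter at each step that is not an \<open>L\<close>.\<close>
  have stable: "\<exists>K. \<forall>k\<ge>K. agree l (W n k) (W n K)" for l n
  proof (induction l arbitrary: n)
    case 0 then show ?case by auto
  next
    case (Suc l)
    have "\<exists>j. n \<le> j \<and> \<sigma> j \<noteq> L" using p unfolding primitive_def by blast
    then obtain j where j: "n \<le> j" "\<sigma> j \<noteq> L" by blast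
    from j(1) show ?case
    proof (induction rule: inc_induct)
      case base
      obtain K where K: "\<And>k. k \<ge> K \<Longrightarrow> agree l (W (Suc j) k) (W (Suc j) K)" using Suc.IH by blast
      have "agree (Suc l) (W j k) (W j (Suc K))" if h: "k \<ge> Suc K" for k
      proof -
        obtain k' where k': "k = Suc k'" "k' \<ge> K" using h by (cases k) auto
        obtain v v' where v: "W (Suc j) k' = 0 ## v" "W (Suc j) K = 0 ## v'"
          using scons_hd[OF W0 bW] by metis
        show ?thesis
        proof (cases l)
          case 0 then show ?thesis using W0 by (simp add: agree_def)
        next
          case (Suc l')
          then have "agree l' v v'" using K[OF k'(2)] v by simp
          then have "agree l' (subst_inf (\<sigma> j) v) (subst_inf (\<sigma> j) v')" by (rule subst_agree)
          then show ?thesis unfolding k'(1) W v Suc using j(2) by (cases "\<sigma> j") auto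
        qed
      qed
      then show ?case by blast
    next
      case (step i)
      then obtain K where K: "\<And>k. k \<ge> K \<Longrightarrow> agree (Suc l) (W (Suc i) k) (W (Suc i) K)" by blast
      have "agree (Suc l) (W i k) (W i (Suc K))" if h: "k \<ge> Suc K" for k
      proof -
        obtain k' where k': "k = Suc k'" "k' \<ge> K" using h by (cases k) auto
        show ?thesis unfolding k' W by (rule subst_agree) (rule K[OF k'(2)])
      qed
      then show ?case by blast
    qed
  qed
  then obtain K where K: "\<And>l n k. k \<ge> K l n \<Longrightarrow> agree l (W n k) (W n (K l n))" by metis
  \<comment> \<open>Letter i is taken where the first i + 1 letters have become stable.\<close>
  define U where "U n = (\<lambda>i. W n (K (Suc i) n) i)" for n
  have UW: "\<exists>K. \<forall>k\<ge>K. agree l (U n) (W n k)" for l n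
  proof (intro exI[of _ "Max ((\<lambda>i. K (Suc i) n) ` {..l})"] allI impI)
    fix k assume k: "Max ((\<lambda>i. K (Suc i) n) ` {..l}) \<le> k"
    show "agree l (U n) (W n k)" unfolding agree_def
    proof (intro allI impI)
      fix i assume "i < l"
      then have "K (Suc i) n \<le> k" using k by (auto intro: order_trans[OF Max_ge])
      then show "U n i = W n k i" using K[of "Suc i" n k] unfolding U_def agree_def by auto
    qed
  qed
  have "U n = subst_inf (\<sigma> n) (U (Suc n))" for n
  proof (rule agree_eqI)
    fix l
    obtain K1 where K1: "\<And>k. k \<ge> K1 \<Longrightarrow> agree l (U n) (W n k)" using UW by blast
    obtain K2 where K2: "\<And>k. k \<ge> K2 \<Longrightarrow> agree l (U (Suc n)) (W (Suc n) k)" using UW by blast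
    let ?k = "max K1 K2"
    have "agree l (U n) (W n (Suc ?k))" by (rule K1) simp
    moreover have "agree l (U (Suc n)) (W (Suc n) ?k)" by (rule K2) simp
    then have "agree l (subst_inf (\<sigma> n) (U (Suc n))) (W n (Suc ?k))" unfolding W by (rule subst_agree)
    ultimately show "agree l (U n) (subst_inf (\<sigma> n) (U (Suc n)))" using agree_trans agree_sym by blast
  qed
  moreover have "binary (U n)" for n unfolding binary_def U_def using bW binaryD by (metis insertCI)
  ultimately show ?thesis unfolding limit_word_def by blast
qed

subsection \<open>Every \<open>m\<close> is covered\<close>

text \<open>The invariant of the path followed by \<open>m\<close>. It fails for the empty path exactly if
  \<open>m \<ge> mu w01\<close>, and it cannot survive \<open>L\<^sup>\<infinity>\<close> or \<open>R\<^sup>\<infinity>\<close> because both conditions are open.\<close>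

definition window :: "real \<Rightarrow> subst list \<Rightarrow> bool" where
  "window m \<tau> \<longleftrightarrow> flt m (his \<tau> w10) (los \<tau> z0) \<and> glt m (los \<tau> w01) (his \<tau> z1)"

text \<open>By monotonicity of f and g in m, the first test says that m lies below the mu of
  \<open>\<tau> M w10\<close>, the second that it lies above the mu of
  \<open>\<tau> M w01\<close>.\<close>

definition next_subst :: "real \<Rightarrow> subst list \<Rightarrow> subst" where
  "next_subst m \<tau> = (if glt m (los \<tau> (lo L w01)) (his \<tau> (hi L z1)) then L
     else if flt m (his \<tau> (hi R w10)) (los \<tau> (lo R z0)) then R else M)"

text \<open>Base 2 separates f at \<open>w10\<close> from g at \<open>z0\<close>: both left-hand
  sides equal 1 there and are below m.\<close>

lemma window_Nil:
  assumes "1 < m" "m \<le> 2" "m < mu w01" shows "window m []"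
proof -
  have p0: "wval 2 z0 = 0" by (simp add: rw_def pib_def z0_def)
  then have "wval 2 w10 = 1 / 2" using wval_scons[of 2 1 z0] by (simp add: w10_eq)
  then have "Dn m 2 w10" "\<not> Up m 2 z0" using assms p0 by (simp_all add: Dn_def Up_def)
  then have "flt m w10 z0" unfolding flt_def by (intro exI[of _ 2]) auto
  moreover have "glt m w01 z1"
    using mu_props(2)[OF nice_w01 assms(1,2)] flt_iff(2)[OF nice_w01 assms(1,2)] assms(3) by auto
  ultimately show ?thesis by (simp add: window_def)
qed

text \<open>The \<open>L\<close>-child inherits its lower condition, as \<open>L\<close> fixes
  \<open>z0\<close> and \<open>w10\<close>; the \<open>R\<close>-child inherits its upper one. For
  \<open>M\<close> both are new, and they are what is left of the middle range when the two gaps are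
  removed.\<close>

lemma window_step:
  assumes m: "1 < m" "m \<le> 2" and w: "window m \<tau>"
    and 1: "m \<notin> {mu (apply_inf (\<tau> @ [M]) w10) .. mu (apply_inf (\<tau> @ [M]) w010)}"
    and 2: "m \<notin> {mu (apply_inf (\<tau> @ [M]) w101) .. mu (apply_inf (\<tau> @ [M]) w01)}"
  shows "window m (\<tau> @ [next_subst m \<tau>])"
proof -
  note F = flt_iff[OF nice_apply(1) m, of \<tau>] flt_iff[OF nice_apply(2) m, of \<tau>]
    flt_iff[OF nice_apply(3) m, of \<tau>] flt_iff[OF nice_apply(4) m, of \<tau>]
  note MU = mu_props[OF nice_apply(1) m, of \<tau>] mu_props[OF nice_apply(2) m, of \<tau>]
    mu_props[OF nice_apply(3) m, of \<tau>] mu_props[OF nice_apply(4) m, of \<tau>]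
  let ?A = "glt m (los \<tau> (lo L w01)) (his \<tau> (hi L z1))"
  let ?B = "flt m (his \<tau> (hi R w10)) (los \<tau> (lo R z0))"
  have A: "?A \<longleftrightarrow> \<not> mu (apply_inf (\<tau> @ [M]) w10) \<le> m"
    unfolding MU F lo_hi_const by auto
  have B: "?B \<longleftrightarrow> \<not> m \<le> mu (apply_inf (\<tau> @ [M]) w01)"
    unfolding MU F lo_hi_const by auto
  consider (L) ?A | (R) "\<not> ?A" ?B | (M) "\<not> ?A" "\<not> ?B" by blast
  then show ?thesis
  proof cases
    case L
    then have "next_subst m \<tau> = L" by (simp add: next_subst_def del: lo.simps hi.simps)
    then show ?thesis using L w by (simp add: window_def lo_hi_const del: lo.simps hi.simps)
  next
    case R
    then have "next_subst m \<tau> = R" by (simp add: next_subst_def del: lo.simps hi.simps)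
    then show ?thesis using R w by (simp add: window_def lo_hi_const del: lo.simps hi.simps)
  next
    case M
    then have n: "next_subst m \<tau> = M" by (simp add: next_subst_def del: lo.simps hi.simps)
    have "\<not> m \<le> mu (apply_inf (\<tau> @ [M]) w010)" using A M 1 by auto
    then have "flt m (his \<tau> (hi M w10)) (los \<tau> (0 ## a01))" unfolding MU F by auto
    moreover have "\<not> mu (apply_inf (\<tau> @ [M]) w101) \<le> m" using B M 2 by auto
    then have "glt m (los \<tau> (lo M w01)) (his \<tau> (1 ## a10))" unfolding MU F by auto
    ultimately show ?thesis using n by (simp add: window_def lo_hi_const del: lo.simps hi.simps)
  qed
qed

lemma fixed_const:
  "los (replicate k L) z0 = z0" "his (replicate k L) w10 = w10"
  "los (replicate k R) w01 = w01" "his (replicate k R) z1 = z1"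
  by (induction k) (simp_all add: lo_hi_const del: lo.simps hi.simps)

lemma pre_const: "\<forall>n\<ge>N. \<sigma> n = t \<Longrightarrow> pre \<sigma> (N + k) = pre \<sigma> N @ replicate k t"
  by (induction k) (auto simp: replicate_append_same)

lemma zw_hd: "z0 0 = 0" "w01 0 = 0" "z1 0 = 1" "w10 0 = 1"
  by (simp_all add: z0_def z1_def w01_def w10_def)

text \<open>Along \<open>L^k\<close> the pair \<open>w10\<close>, \<open>z0\<close> stays fixed,
  while contraction pulls the images of \<open>z1\<close> and \<open>w01\<close> towards it.
  Openness carries the strict inequality over to that pair, against the other half of the window;
  \<open>R\<close> is dual.\<close>

lemma window_primitive:
  assumes m: "1 < m" and w: "\<And>n. window m (pre \<sigma> n)" shows "primitive \<sigma>"
  unfolding primitive_def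
proof (intro conjI notI; elim exE)
  fix N assume h: "\<forall>n\<ge>N. \<sigma> n = L"
  let ?\<tau> = "pre \<sigma> N"
  have "flt m (his ?\<tau> w10) (los ?\<tau> z0)" using w[of N] by (simp add: window_def)
  then obtain k where k: "\<And>s i. binary s \<Longrightarrow> binary i \<Longrightarrow> agree k (his ?\<tau> w10) s \<Longrightarrow> agree k (los ?\<tau> z0) i \<Longrightarrow> flt m s i"
    using flt_open[OF m, of "his ?\<tau> w10" "los ?\<tau> z0"] by auto
  let ?\<rho> = "?\<tau> @ replicate k L"
  have "agree k (his ?\<rho> w10) (his ?\<rho> z1)" "agree k (los ?\<rho> z0) (los ?\<rho> w01)"
    by (rule his_contract los_contract; simp add: zw_hd)+
  then have "flt m (his ?\<rho> z1) (los ?\<rho> w01)" using k[of "his ?\<rho> z1" "los ?\<rho> w01"] by (simp add: fixed_const)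
  moreover have "glt m (los ?\<rho> w01) (his ?\<rho> z1)"
    using w[of "N + k"] pre_const[OF h, of k] by (simp add: window_def)
  ultimately show False using flt_glt[OF m, of "his ?\<rho> z1" "los ?\<rho> w01"] by simp
next
  fix N assume h: "\<forall>n\<ge>N. \<sigma> n = R"
  let ?\<tau> = "pre \<sigma> N"
  have "glt m (los ?\<tau> w01) (his ?\<tau> z1)" using w[of N] by (simp add: window_def)
  then obtain k where k: "\<And>s i. binary s \<Longrightarrow> binary i \<Longrightarrow> agree k (his ?\<tau> z1) s \<Longrightarrow> agree k (los ?\<tau> w01) i \<Longrightarrow> glt m i s"
    using glt_open[OF m, of "his ?\<tau> z1" "los ?\<tau> w01"] by auto
  let ?\<rho> = "?\<tau> @ replicate k R"
  have "agree k (his ?\<rho> z1) (his ?\<rho> w10)" "agree k (los ?\<rho> w01) (los ?\<rho> z0)"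
    by (rule his_contract los_contract; simp add: zw_hd)+
  then have "glt m (los ?\<rho> z0) (his ?\<rho> w10)" using k[of "his ?\<rho> w10" "los ?\<rho> z0"] by (simp add: fixed_const)
  moreover have "flt m (his ?\<rho> w10) (los ?\<rho> z0)"
    using w[of "N + k"] pre_const[OF h, of k] by (simp add: window_def)
  ultimately show False using flt_glt[OF m, of "his ?\<rho> w10" "los ?\<rho> z0"] by simp
qed

text \<open>A strict inequality between f and g at the limit word would hold at a finite level for
  every pair of test words with the right first letters, and one half of the window says the
  opposite.\<close>

lemma coverage:
  assumes m: "1 < m" "m \<le> 2"
    and 1: "\<And>\<sigma>. \<sigma> \<in> endsM \<Longrightarrow> m \<notin> {mu (apply_inf \<sigma> w10) .. mu (apply_inf \<sigma> w010)}"
    and 2: "\<And>\<sigma>. \<sigma> \<in> endsM \<Longrightarrow> m \<notin> {mu (apply_inf \<sigma> w101) .. mu (apply_inf \<sigma> w01)}"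
    and 3: "m < mu w01"
  shows "\<exists>u\<in>S_LMR. m = mu u"
proof -
  define p where "p = rec_nat [] (\<lambda>_ \<tau>. \<tau> @ [next_subst m \<tau>])"
  define \<sigma> where "\<sigma> n = next_subst m (p n)" for n
  have p: "p 0 = []" "p (Suc n) = p n @ [next_subst m (p n)]" for n by (simp_all add: p_def)
  have pp: "pre \<sigma> n = p n" for n by (induction n) (simp_all add: p \<sigma>_def)
  have w: "window m (pre \<sigma> n)" for n
    unfolding pp
  proof (induction n)
    case 0 then show ?case using window_Nil[OF m 3] by (simp add: p)
  next
    case (Suc n)
    have "p n @ [M] \<in> endsM" by (auto simp: endsM_def)
    then show ?case unfolding p by (intro window_step[OF m Suc] 1 2)
  qed
  have prim: "primitive \<sigma>" using window_primitive[OF m(1) w] .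
  then obtain u where u: "limit_word \<sigma> u" using limit_word_exists by blast
  have n: "nice u (ilim \<sigma>) (slim \<sigma>)" using limit_word_nice[OF prim u] .
  have agr: "agree N (ilim \<sigma>) (los (pre \<sigma> N) x)" if "binary x" "x 0 = 0" for N x
    using ilim_agree[OF that] agree_sym by blast
  have agr': "agree N (slim \<sigma>) (his (pre \<sigma> N) x)" if "binary x" "x 0 = 1" for N x
    using slim_agree[OF that] agree_sym by blast
  have "\<not> flt m (slim \<sigma>) (ilim \<sigma>)"
  proof
    assume "flt m (slim \<sigma>) (ilim \<sigma>)"
    then obtain N where "\<And>s i. binary s \<Longrightarrow> binary i \<Longrightarrow> agree N (slim \<sigma>) s \<Longrightarrow> agree N (ilim \<sigma>) i \<Longrightarrow> flt m s i"
      using flt_open[OF m(1), of "slim \<sigma>" "ilim \<sigma>"] by auto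
    then have "flt m (his (pre \<sigma> N) z1) (los (pre \<sigma> N) w01)" using agr agr' by (simp add: zw_hd)
    then show False using w[of N] flt_glt[OF m(1)] unfolding window_def
      by (meson binary_los binary_his binary_zs)
  qed
  moreover have "\<not> glt m (ilim \<sigma>) (slim \<sigma>)"
  proof
    assume "glt m (ilim \<sigma>) (slim \<sigma>)"
    then obtain N where "\<And>s i. binary s \<Longrightarrow> binary i \<Longrightarrow> agree N (slim \<sigma>) s \<Longrightarrow> agree N (ilim \<sigma>) i \<Longrightarrow> glt m i s"
      using glt_open[OF m(1), of "slim \<sigma>" "ilim \<sigma>"] by auto
    then have "glt m (los (pre \<sigma> N) z0) (his (pre \<sigma> N) w10)" using agr agr' by (simp add: zw_hd)
    then show False using w[of N] flt_glt[OF m(1)] unfolding window_def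
      by (meson binary_los binary_his binary_zs)
  qed
  ultimately have "m = mu u" using mu_props[OF n m] flt_iff[OF n m] by auto
  moreover have "u \<in> S_LMR" using prim u unfolding S_LMR_def by blast
  ultimately show ?thesis by blast
qed


subsection \<open>The critical base\<close>

lemma Lcrit_eqI:
  assumes m: "1 < m" "m \<le> 2" and l1: "1 < l"
    and up: "\<And>\<beta>. l < \<beta> \<Longrightarrow> \<exists>\<rho>. Up m \<beta> (los \<rho> z0) \<and> Dn m \<beta> (his \<rho> z1)"
    and low: "\<And>\<beta>. 1 < \<beta> \<Longrightarrow> \<beta> < l \<Longrightarrow> countable (Ub \<beta> m \<inter> {u. \<forall>k. u k \<in> {0, 1}})"
  shows "Lcrit m = l \<and> (\<forall>\<beta>>l. hausdorff_dim (pib \<beta> ` Ub \<beta> m) > 0)"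
proof -
  let ?S = "{\<beta>. \<beta> > 1 \<and> uncountable (Ub \<beta> m \<inter> {u. \<forall>k. u k \<in> {0, 1}})}"
  have pos: "\<beta> \<in> ?S \<and> hausdorff_dim (pib \<beta> ` Ub \<beta> m) > 0" if b: "l < \<beta>" for \<beta>
  proof -
    obtain \<rho> where r: "Up m \<beta> (los \<rho> z0)" "Dn m \<beta> (his \<rho> z1)" using up[OF b] by blast
    have "1 < \<beta>" using b l1 by simp
    then show ?thesis using dimension_pos[OF m _ r] by auto
  qed
  have lb: "l \<le> \<beta>" if S: "\<beta> \<in> ?S" for \<beta>
  proof (rule ccontr)
    assume "\<not> l \<le> \<beta>"
    then have "countable (Ub \<beta> m \<inter> {u. \<forall>k. u k \<in> {0, 1}})" using S by (intro low) simp_all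
    then show False using S by blast
  qed
  have "Inf ?S = l"
  proof (rule antisym)
    show "l \<le> Inf ?S"
    proof (rule cInf_greatest)
      have "l + 1 \<in> ?S" using pos[of "l + 1"] by simp
      then show "?S \<noteq> {}" by blast
    qed (rule lb)
    show "Inf ?S \<le> l"
    proof (rule dense_ge)
      fix x assume "l < x"
      then have "x \<in> ?S" using pos by blast
      then show "Inf ?S \<le> x" by (rule cInf_lower) (rule bdd_belowI[OF lb])
    qed
  qed
  then show ?thesis using pos unfolding Lcrit_def by blast
qed

lemma endsM_cases: assumes "\<sigma> \<in> endsM" obtains \<tau> where "\<sigma> = \<tau> @ [M]"
  using assms unfolding endsM_def by blast

text \<open>Above g, which is at least f for the first word, its infimum and supremum are the bounds
  required by \<open>room_L\<close>. Below g, the second word has f at least g, so both bounds fail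
  at level \<open>\<tau> M\<close>.\<close>

lemma Lcrit_case1:
  assumes m: "1 < m" "m \<le> 2" and s: "\<sigma> \<in> endsM"
    and h: "m \<in> {mu (apply_inf \<sigma> w10) .. mu (apply_inf \<sigma> w010)}"
  shows "Lcrit m = gfun (apply_inf \<sigma> w10) m \<and>
    (\<forall>\<beta>>gfun (apply_inf \<sigma> w10) m. hausdorff_dim (pib \<beta> ` Ub \<beta> m) > 0)"
proof -
  obtain \<tau> where \<sigma>: "\<sigma> = \<tau> @ [M]" using s by (rule endsM_cases)
  let ?u = "apply_inf (\<tau> @ [M]) w10" and ?v = "apply_inf (\<tau> @ [M]) w010"
  note n = nice_apply(1,2)[of \<tau>]
  note N = niceD[OF n(1)] niceD[OF n(2)]
  note F = ffun_props[OF n(1) m] ffun_props[OF n(2) m]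
  note G = gfun_props[OF N(1,3) m(1)]
  have fg: "ffun ?u m \<le> gfun ?u m" "gfun ?v m \<le> ffun ?v m"
    using h mu_props[OF n(1) m] mu_props[OF n(2) m] unfolding \<sigma> by auto
  \<comment> \<open>Both end words have the same infimum, and g depends only on it.\<close>
  have gg: "gfun ?v m = gfun ?u m" using N(1,8) by (simp add: gfun_def)
  show ?thesis unfolding \<sigma>
  proof (rule Lcrit_eqI[OF m G(1)])
    fix \<beta> assume b: "gfun ?u m < \<beta>"
    then have b1: "1 < \<beta>" using G(1) by simp
    show "\<exists>\<rho>. Up m \<beta> (los \<rho> z0) \<and> Dn m \<beta> (his \<rho> z1)"
      by (rule room_L[OF m b1, of \<tau>]) (use G(3)[OF b1] F(3)[OF b1] b fg in auto)
  next
    fix \<beta> assume b: "1 < \<beta>" "\<beta> < gfun ?u m"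
    show "countable (Ub \<beta> m \<inter> {u. \<forall>k. u k \<in> {0, 1}})"
    proof (rule countable_low0[OF m b(1), of "\<tau> @ [M]"])
      show "\<not> Up m \<beta> (los (\<tau> @ [M]) z0)" using G(3)[OF b(1)] b by (simp add: lo_hi_const del: lo.simps)
      show "\<not> Dn m \<beta> (his (\<tau> @ [M]) w10)" using F(7)[OF b(1)] b fg gg by (simp del: hi.simps)
    qed
  qed
qed

text \<open>Dual to the first case: \<open>room_R\<close> applies above f of the first word, and the
  common supremum transfers f to the second word, whose g is at least f.\<close>

lemma Lcrit_case2:
  assumes m: "1 < m" "m \<le> 2" and s: "\<sigma> \<in> endsM"
    and h: "m \<in> {mu (apply_inf \<sigma> w101) .. mu (apply_inf \<sigma> w01)}"
  shows "Lcrit m = ffun (apply_inf \<sigma> w01) m \<and>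
    (\<forall>\<beta>>ffun (apply_inf \<sigma> w01) m. hausdorff_dim (pib \<beta> ` Ub \<beta> m) > 0)"
proof -
  obtain \<tau> where \<sigma>: "\<sigma> = \<tau> @ [M]" using s by (rule endsM_cases)
  let ?u = "apply_inf (\<tau> @ [M]) w01" and ?v = "apply_inf (\<tau> @ [M]) w101"
  note n = nice_apply(3,4)[of \<tau>]
  note N = niceD[OF n(1)] niceD[OF n(2)]
  note F = ffun_props[OF n(1) m]
  note G = gfun_props[OF N(1,3) m(1)] gfun_props[OF N(8,10) m(1)]
  have fg: "gfun ?u m \<le> ffun ?u m" "ffun ?v m \<le> gfun ?v m"
    using h mu_props[OF n(1) m] mu_props[OF n(2) m] unfolding \<sigma> by auto
  have ff: "ffun ?v m = ffun ?u m" using N(2,9) by (simp add: ffun_def)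
  show ?thesis unfolding \<sigma>
  proof (rule Lcrit_eqI[OF m F(1)])
    fix \<beta> assume b: "ffun ?u m < \<beta>"
    then have b1: "1 < \<beta>" using F(1) by simp
    show "\<exists>\<rho>. Up m \<beta> (los \<rho> z0) \<and> Dn m \<beta> (his \<rho> z1)"
      by (rule room_R[OF m b1, of \<tau>]) (use G(3)[OF b1] F(3)[OF b1] b fg in auto)
  next
    fix \<beta> assume b: "1 < \<beta>" "\<beta> < ffun ?u m"
    show "countable (Ub \<beta> m \<inter> {u. \<forall>k. u k \<in> {0, 1}})"
    proof (rule countable_low1[OF m b(1), of "\<tau> @ [M]"])
      show "\<not> Up m \<beta> (los (\<tau> @ [M]) w01)" using G(7)[OF b(1)] b fg ff by (simp del: lo.simps)
      show "\<not> Dn m \<beta> (his (\<tau> @ [M]) z1)" using F(3)[OF b(1)] b by (simp add: lo_hi_const del: hi.simps)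
    qed
  qed
qed

text \<open>\<open>R\<close> fixes \<open>w01\<close> and \<open>z1\<close>, the infimum and
  supremum here, so powers of \<open>R\<close> give enough room above g. Below g no tail may begin
  with 0, and no renormalisation is involved.\<close>

lemma Lcrit_case3:
  assumes m: "1 < m" "m \<le> 2" and h: "mu w01 \<le> m"
  shows "Lcrit m = gfun w01 m \<and> (\<forall>\<beta>>gfun w01 m. hausdorff_dim (pib \<beta> ` Ub \<beta> m) > 0)"
proof -
  note N = niceD[OF nice_w01] and F = ffun_props[OF nice_w01 m]
  note G = gfun_props[OF N(1,3) m(1)]
  have fg: "ffun w01 m \<le> gfun w01 m" using h mu_props[OF nice_w01 m] by simp
  show ?thesis
  proof (rule Lcrit_eqI[OF m G(1)])
    fix \<beta> assume b: "gfun w01 m < \<beta>"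
    then have b1: "1 < \<beta>" using G(1) by simp
    then have "Up m \<beta> w01" "Dn m \<beta> z1" using G(3)[OF b1] F(3)[OF b1] b fg by auto
    then obtain k where k: "\<And>y. binary y \<Longrightarrow> agree k w01 y \<Longrightarrow> Up m \<beta> y" using Up_open[OF b1, of w01 m] by auto
    have "agree k (los (replicate k R) w01) (los (replicate k R) z0)"
      by (rule los_contract) (simp_all add: zw_hd)
    then have "Up m \<beta> (los (replicate k R) z0)" using k by (simp add: fixed_const)
    moreover have "Dn m \<beta> (his (replicate k R) z1)" using \<open>Dn m \<beta> z1\<close> by (simp add: fixed_const)
    ultimately show "\<exists>\<rho>. Up m \<beta> (los \<rho> z0) \<and> Dn m \<beta> (his \<rho> z1)" by blast
  next
    fix \<beta> assume b: "1 < \<beta>" "\<beta> < gfun w01 m"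
    show "countable (Ub \<beta> m \<inter> {u. \<forall>k. u k \<in> {0, 1}})"
      by (rule countable_low1[OF m b(1), of "[]"]) (use G(3)[OF b(1)] b in auto)
  qed
qed

text \<open>At the crossing both constraints change at the same base. Above it both hold strictly
  and hence at a finite level for the full shift; below it both fail strictly and hence at a finite
  level as well.\<close>

lemma Lcrit_case4:
  assumes m: "1 < m" "m \<le> 2" and u: "u \<in> S_LMR" and h: "m = mu u"
  shows "Lcrit m = ffun u m \<and> (\<forall>\<beta>>ffun u m. hausdorff_dim (pib \<beta> ` Ub \<beta> m) > 0)"
proof -
  obtain \<sigma> where s: "primitive \<sigma>" "limit_word \<sigma> u" using u unfolding S_LMR_def by blast
  have n: "nice u (ilim \<sigma>) (slim \<sigma>)" using limit_word_nice[OF s] .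
  note N = niceD[OF n] and F = ffun_props[OF n m]
  note G = gfun_props[OF N(1,3) m(1)]
  have fg: "ffun u m = gfun u m" using h mu_props[OF n m] by simp
  have agr: "agree k (ilim \<sigma>) (los (pre \<sigma> l) x)" if "binary x" "x 0 = 0" "k \<le> l" for k l x
    using agree_mono[OF ilim_agree[OF that(1,2)] that(3)] agree_sym by blast
  have agr': "agree k (slim \<sigma>) (his (pre \<sigma> l) x)" if "binary x" "x 0 = 1" "k \<le> l" for k l x
    using agree_mono[OF slim_agree[OF that(1,2)] that(3)] agree_sym by blast
  show ?thesis
  proof (rule Lcrit_eqI[OF m F(1)])
    fix \<beta> assume b: "ffun u m < \<beta>"
    then have b1: "1 < \<beta>" using F(1) by simp
    then have "Up m \<beta> (ilim \<sigma>)" "Dn m \<beta> (slim \<sigma>)" using G(3)[OF b1] F(3)[OF b1] b fg by auto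
    then obtain k l where k: "\<And>y. binary y \<Longrightarrow> agree k (ilim \<sigma>) y \<Longrightarrow> Up m \<beta> y"
      and l: "\<And>y. binary y \<Longrightarrow> agree l (slim \<sigma>) y \<Longrightarrow> Dn m \<beta> y"
      using Up_open[OF b1, of "ilim \<sigma>" m] Dn_open[OF b1, of "slim \<sigma>" m] by auto
    have "Up m \<beta> (los (pre \<sigma> (max k l)) z0)" "Dn m \<beta> (his (pre \<sigma> (max k l)) z1)"
      by (rule k l; simp add: agr agr' zw_hd)+
    then show "\<exists>\<rho>. Up m \<beta> (los \<rho> z0) \<and> Dn m \<beta> (his \<rho> z1)" by blast
  next
    fix \<beta> assume b: "1 < \<beta>" "\<beta> < ffun u m"
    \<comment> \<open>Openness needs a strict failure; equality at \<open>\<beta>\<close> would make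
      the constraint hold at the larger base g itself.\<close>
    have "(\<beta> - 1) * (1 + wval \<beta> (ilim \<sigma>)) < m"
    proof (rule ccontr)
      assume "\<not> ?thesis"
      then have "Up m (gfun u m) (ilim \<sigma>)" using Up_less[OF m(1) b(1) _ N(3)] b fg by simp
      then show False using G(3)[OF G(1)] by simp
    qed
    then obtain k where k: "\<And>y. binary y \<Longrightarrow> agree k (ilim \<sigma>) y \<Longrightarrow> \<not> Up m \<beta> y"
      using not_Up_open[OF b(1), of "ilim \<sigma>" m] by auto
    have "m < \<beta> * wval \<beta> (slim \<sigma>)"
    proof (rule ccontr)
      assume "\<not> ?thesis"
      then have "Dn m (ffun u m) (slim \<sigma>)" using Dn_less[OF m(1) b(1) _ N(4)] b by simp
      then show False using F(3)[OF F(1)] by simp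
    qed
    then obtain l where l: "\<And>y. binary y \<Longrightarrow> agree l (slim \<sigma>) y \<Longrightarrow> \<not> Dn m \<beta> y"
      using not_Dn_open[OF b(1), of "slim \<sigma>" m] by auto
    have "\<not> Up m \<beta> (los (pre \<sigma> (max k l)) w01)" "\<not> Dn m \<beta> (his (pre \<sigma> (max k l)) z1)"
      by (rule k l; simp add: agr agr' zw_hd)+
    then show "countable (Ub \<beta> m \<inter> {u. \<forall>k. u k \<in> {0, 1}})" by (rule countable_low1[OF m b(1)])
  qed
qed

theorem theorem1:
  fixes m :: real
  assumes "1 < m" and "m \<le> 2"
  shows "(\<forall>\<sigma>\<in>endsM. m \<in> {mu (apply_inf \<sigma> w10) .. mu (apply_inf \<sigma> w010)} \<longrightarrow>
            Lcrit m = gfun (apply_inf \<sigma> w10) m)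
       \<and> (\<forall>\<sigma>\<in>endsM. m \<in> {mu (apply_inf \<sigma> w101) .. mu (apply_inf \<sigma> w01)} \<longrightarrow>
            Lcrit m = ffun (apply_inf \<sigma> w01) m)
       \<and> (m \<in> {mu w01 .. 2} \<longrightarrow> Lcrit m = gfun w01 m)
       \<and> (\<forall>u\<in>S_LMR. m = mu u \<longrightarrow> Lcrit m = ffun u m)
       \<and> ((\<exists>\<sigma>\<in>endsM. m \<in> {mu (apply_inf \<sigma> w10) .. mu (apply_inf \<sigma> w010)})
          \<or> (\<exists>\<sigma>\<in>endsM. m \<in> {mu (apply_inf \<sigma> w101) .. mu (apply_inf \<sigma> w01)})
          \<or> m \<in> {mu w01 .. 2}
          \<or> (\<exists>u\<in>S_LMR. m = mu u))
       \<and> (\<forall>\<beta>. \<beta> > Lcrit m \<longrightarrow> hausdorff_dim (pib \<beta> ` Ub \<beta> m) > 0)"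
proof -
  note C1 = Lcrit_case1[OF assms] and C2 = Lcrit_case2[OF assms]
    and C3 = Lcrit_case3[OF assms] and C4 = Lcrit_case4[OF assms]
  have cover: "(\<exists>\<sigma>\<in>endsM. m \<in> {mu (apply_inf \<sigma> w10) .. mu (apply_inf \<sigma> w010)})
          \<or> (\<exists>\<sigma>\<in>endsM. m \<in> {mu (apply_inf \<sigma> w101) .. mu (apply_inf \<sigma> w01)})
          \<or> m \<in> {mu w01 .. 2}
          \<or> (\<exists>u\<in>S_LMR. m = mu u)"
    using coverage[OF assms] assms(2) by (meson atLeastAtMost_iff not_le)
  then have "\<forall>\<beta>. \<beta> > Lcrit m \<longrightarrow> hausdorff_dim (pib \<beta> ` Ub \<beta> m) > 0"
  proof (elim disjE bexE)
    fix \<sigma> assume "\<sigma> \<in> endsM" "m \<in> {mu (apply_inf \<sigma> w10) .. mu (apply_inf \<sigma> w010)}"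
    from C1[OF this] show ?thesis by simp
  next
    fix \<sigma> assume "\<sigma> \<in> endsM" "m \<in> {mu (apply_inf \<sigma> w101) .. mu (apply_inf \<sigma> w01)}"
    from C2[OF this] show ?thesis by simp
  next
    assume "m \<in> {mu w01..2}"
    then show ?thesis using C3 by simp
  next
    fix u assume "u \<in> S_LMR" "m = mu u"
    from C4[OF this] show ?thesis by simp
  qed
  then show ?thesis using C1 C2 C3 C4 cover by (intro conjI ballI impI) auto
qed

end
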